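(* Let $L$ be a fixed Lévy process with $L_1\sim\mu\neq\delta_0$, let $T$ and $\tilde T$ be subordinators independent of $L$, and let $L^T$, $L^{\tilde T}$ be two-sided Lévy processes with $L^T_s=L_{T_s}$ and $L^{\tilde T}_s=L_{\tilde T_s}$ for $s\ge0$. Let $f:\mathbb{R}\to\mathbb{R}$ be integrable with $f(x)=0$ for $x\le0$ and with nowhere vanishing Fourier transform, and assume the processes $Y_t=\int_{-\infty}^t f(t-s)\,dL^T_s$ and $\tilde Y_t=\int_{-\infty}^t f(t-s)\,dL^{\tilde T}_s$, $t\in\mathbb{R}$, are well defined. If $Y$ and $\tilde Y$ have the same law (as processes), then $T$ and $\tilde T$ have the same law.
   Context: A subordinator is a Lévy process with non-decreasing paths. A two-sided Lévy process $(Z_t)_{t\in\mathbb{R}}$ is a càdlàg process with stationary independent increments indexed by $\mathbb{R}$; integrals $\int f(t-s)dZ_s$ are in the sense of integration of deterministic functions with respect to the homogeneous Lévy basis $Z((s,t])=Z_t-Z_s$. The Fourier transform of $f$ is $\hat f(\theta)=\int_{\mathbb{R}}e^{i\theta x}f(x)dx$. *)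

theory Defs
  imports "HOL-Probability.Probability"
begin

definition conv_in_prob :: "'a measure \<Rightarrow> (nat \<Rightarrow> 'a \<Rightarrow> real) \<Rightarrow> ('a \<Rightarrow> real) \<Rightarrow> bool" where
  "conv_in_prob M X Y \<longleftrightarrow>
     (\<forall>e>0. ((\<lambda>n. measure M {\<omega> \<in> space M. e < \<bar>X n \<omega> - Y \<omega>\<bar>}) \<longlonglongrightarrow> 0))"

definition levy_process :: "'a measure \<Rightarrow> (real \<Rightarrow> 'a \<Rightarrow> real) \<Rightarrow> bool" where
  "levy_process M L \<longleftrightarrow>
     (\<forall>t\<ge>0. L t \<in> borel_measurable M) \<and>
     (AE \<omega> in M. L 0 \<omega> = 0) \<and>
     (\<forall>(t::nat \<Rightarrow> real) n. 0 \<le> t 0 \<and> strict_mono t \<longrightarrow>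
        prob_space.indep_vars M (\<lambda>_. borel) (\<lambda>i \<omega>. L (t (Suc i)) \<omega> - L (t i) \<omega>) {..<n}) \<and>
     (\<forall>s h. 0 \<le> s \<and> 0 \<le> h \<longrightarrow>
        distr M borel (\<lambda>\<omega>. L (s + h) \<omega> - L s \<omega>) = distr M borel (\<lambda>\<omega>. L h \<omega> - L 0 \<omega>)) \<and>
     (AE \<omega> in M. \<forall>t\<ge>0. ((\<lambda>s. L s \<omega>) \<longlongrightarrow> L t \<omega>) (at_right t) \<and>
                        (0 < t \<longrightarrow> (\<exists>l. ((\<lambda>s. L s \<omega>) \<longlongrightarrow> l) (at_left t))))"

definition subordinator :: "'a measure \<Rightarrow> (real \<Rightarrow> 'a \<Rightarrow> real) \<Rightarrow> bool" where
  "subordinator M T \<longleftrightarrow> levy_process M T \<and> (AE \<omega> in M. mono_on {0..} (\<lambda>t. T t \<omega>))"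

definition levy_process2 :: "'a measure \<Rightarrow> (real \<Rightarrow> 'a \<Rightarrow> real) \<Rightarrow> bool" where
  "levy_process2 M Z \<longleftrightarrow>
     (\<forall>t. Z t \<in> borel_measurable M) \<and>
     (AE \<omega> in M. Z 0 \<omega> = 0) \<and>
     (\<forall>(t::nat \<Rightarrow> real) n. strict_mono t \<longrightarrow>
        prob_space.indep_vars M (\<lambda>_. borel) (\<lambda>i \<omega>. Z (t (Suc i)) \<omega> - Z (t i) \<omega>) {..<n}) \<and>
     (\<forall>s h. 0 \<le> h \<longrightarrow>
        distr M borel (\<lambda>\<omega>. Z (s + h) \<omega> - Z s \<omega>) = distr M borel (\<lambda>\<omega>. Z h \<omega> - Z 0 \<omega>)) \<and>
     (AE \<omega> in M. \<forall>t. ((\<lambda>s. Z s \<omega>) \<longlongrightarrow> Z t \<omega>) (at_right t) \<and>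
                      (\<exists>l. ((\<lambda>s. Z s \<omega>) \<longlongrightarrow> l) (at_left t)))"

definition path0 :: "(real \<Rightarrow> 'a \<Rightarrow> real) \<Rightarrow> 'a \<Rightarrow> real \<Rightarrow> real" where
  "path0 X \<omega> = (\<lambda>t\<in>{0..}. X t \<omega>)"

definition path :: "(real \<Rightarrow> 'a \<Rightarrow> real) \<Rightarrow> 'a \<Rightarrow> real \<Rightarrow> real" where
  "path X \<omega> = (\<lambda>t. X t \<omega>)"

section \<open>The homogeneous Levy basis of a two-sided Levy process and integration
  of deterministic functions (Rajput--Rosinski)\<close>

definition levy_basis_of :: "'a measure \<Rightarrow> (real \<Rightarrow> 'a \<Rightarrow> real) \<Rightarrow> (real set \<Rightarrow> 'a \<Rightarrow> real) \<Rightarrow> bool" where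
  "levy_basis_of M Z \<Lambda> \<longleftrightarrow>
     (\<forall>A. A \<in> sets borel \<and> bounded A \<longrightarrow> \<Lambda> A \<in> borel_measurable M) \<and>
     (\<forall>s t. s \<le> t \<longrightarrow> (AE \<omega> in M. \<Lambda> {s<..t} \<omega> = Z t \<omega> - Z s \<omega>)) \<and>
     (\<forall>(A::nat \<Rightarrow> real set) n. (\<forall>i<n. A i \<in> sets borel \<and> bounded (A i)) \<and>
        disjoint_family_on A {..<n} \<longrightarrow>
        prob_space.indep_vars M (\<lambda>_. borel) (\<lambda>i. \<Lambda> (A i)) {..<n}) \<and>
     (\<forall>A::nat \<Rightarrow> real set. (\<forall>i. A i \<in> sets borel \<and> bounded (A i)) \<and> disjoint_family A \<and>
        bounded (\<Union>i. A i) \<longrightarrow> (AE \<omega> in M. (\<lambda>i. \<Lambda> (A i) \<omega>) sums \<Lambda> (\<Union>i. A i) \<omega>))"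

definition lb_integral :: "'a measure \<Rightarrow> (real \<Rightarrow> 'a \<Rightarrow> real) \<Rightarrow> (real \<Rightarrow> real) \<Rightarrow> ('a \<Rightarrow> real) \<Rightarrow> bool" where
  "lb_integral M Z g X \<longleftrightarrow>
     g \<in> borel_measurable borel \<and> X \<in> borel_measurable M \<and>
     (\<exists>\<Lambda> (K::nat \<Rightarrow> nat) (c::nat \<Rightarrow> nat \<Rightarrow> real) (B::nat \<Rightarrow> nat \<Rightarrow> real set).
        levy_basis_of M Z \<Lambda> \<and>
        (\<forall>n j. B n j \<in> sets borel \<and> bounded (B n j)) \<and>
        (AE s in lborel. (\<lambda>n. \<Sum>j<K n. c n j * indicator (B n j) s) \<longlonglongrightarrow> g s) \<and>
        (\<forall>A \<in> sets borel. \<exists>XA \<in> borel_measurable M.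
           conv_in_prob M (\<lambda>n \<omega>. \<Sum>j<K n. c n j * \<Lambda> (A \<inter> B n j) \<omega>) XA) \<and>
        conv_in_prob M (\<lambda>n \<omega>. \<Sum>j<K n. c n j * \<Lambda> (B n j) \<omega>) X)"

definition fourier :: "(real \<Rightarrow> real) \<Rightarrow> real \<Rightarrow> complex" where
  "fourier f \<theta> = (LINT x|lborel. cis (\<theta> * x) * complex_of_real (f x))"

end

theory Submission
  imports Defs "HOL-Complex_Analysis.Complex_Analysis"
begin

text \<open>
  Let \<open>\<kappa>\<close> and \<open>\<kappa>'\<close> be the characteristic exponents of the two subordinated processes. The joint
  characteristic functions of \<open>Y\<close> are \<open>exp (\<integral> \<kappa> (g s) ds)\<close> for \<open>g\<close> in the span \<open>V\<close> of the translates
  \<open>s \<mapsto> f (t - s)\<close>, so \<open>\<integral> D (g s) ds = 0\<close> modulo \<open>2 \<pi> \<i>\<close> for \<open>D = \<kappa> - \<kappa>'\<close> and all \<open>g\<close> in \<open>V\<close>. Passing from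
  \<open>D\<close> to its bounded second differences with steps \<open>k s\<close>, \<open>k\<close> in \<open>V\<close>, removes the ambiguity. Replacing
  \<open>g\<close> by \<open>g + u f (t - \<cdot>)\<close> and averaging over \<open>u\<close> localises the integral to the set where
  \<open>f (t - s) = 0\<close>; doing this for all \<open>t \<le> \<tau>\<close> localises it to half-lines, because \<open>f\<close> is causal. Hence
  the integrands vanish, \<open>D\<close> is a quadratic polynomial, and it is zero because \<open>\<integral> f \<noteq> 0\<close>.

  If \<open>\<psi>\<close> is the exponent of \<open>L\<close>, then \<open>E exp (\<i> u L_{T_s}) = E exp (T_s \<psi> u)\<close>. So the Laplace transforms of
  \<open>T_s\<close> and \<open>T'_s\<close> agree on the range of \<open>\<psi>\<close>; by continuity this range is either a line of purely
  imaginary numbers or has an accumulation point in the open left half-plane.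
\<close>

section \<open>Characteristic exponents\<close>

text \<open>The span \<open>V\<close> is not closed under multiplication by indicators, so the
  vanishing of the integrals cannot be localised by restricting \<open>g\<close>; this is why
  weights are produced by averaging. Averaging over arbitrarily large \<open>u\<close> needs an
  integrand dominated independently of \<open>u\<close>. \<open>D\<close> may grow, but the second
  difference of an exponent \<kappa> with step y is bounded by - Re (\<kappa> y) uniformly in the
  base point, and this bound is integrable along \<open>k s\<close> for \<open>k\<close> in
  \<open>V\<close>. The average removes the part where the perturbation is nonzero, because shifting
  a long interval by a fixed amount hardly changes the integral of a bounded function. Bounds on
  exponents are obtained from \<kappa> u = lim n (char (\<mu> (1 / n)) u - 1) rather than from a
  Levy-Khintchine triplet. The formula exp (\<integral> \<kappa> (g s) ds) presupposes that \<kappa>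
  \<circ> g is integrable; this is extracted from the convergence in probability over every Borel
  set that the definition of the stochastic integral demands.\<close>

lemma multiplicative_right_continuous_imp_exp:
  fixes g :: "real \<Rightarrow> complex"
  assumes mult: "\<And>s t. 0 \<le> s \<Longrightarrow> 0 \<le> t \<Longrightarrow> g (s + t) = g s * g t"
    and lim: "(g \<longlongrightarrow> 1) (at_right 0)"
  obtains c where "\<And>t. 0 \<le> t \<Longrightarrow> g t = exp (of_real t * c)"
proof -
  have "\<forall>\<^sub>F t in at_right 0. dist (g t) 1 < 1"
    using lim by (rule tendstoD) simp
  then obtain b where b: "0 < b" "\<And>t. 0 < t \<Longrightarrow> t < b \<Longrightarrow> dist (g t) 1 < 1"
    by (auto simp: eventually_at_right_field)
  have Re_pos: "Re (g t) > 0" if "0 < t" "t < b" for t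
  proof -
    have "\<bar>Re (g t - 1)\<bar> < 1"
      using abs_Re_le_cmod[of "g t - 1"] b(2)[OF that] by (simp add: dist_norm)
    then show ?thesis by simp
  qed
  define e where "e = b / 2"
  have e: "0 < e" "e < b" using b(1) by (auto simp: e_def)
  define c where "c = Ln (g e) / e"
  have dyadic: "g (e / 2 ^ n) = exp (of_real (e / 2 ^ n) * c)" for n
  proof (induction n)
    case 0
    have "g e \<noteq> 0" using Re_pos[OF e] by auto
    then show ?case using e by (simp add: c_def mult.commute)
  next
    case (Suc n)
    define x where "x = g (e / 2 ^ Suc n)"
    define y where "y = exp (of_real (e / 2 ^ Suc n) * c)"
    have "x * x = g (e / 2 ^ n)"
      using mult[of "e / 2 ^ Suc n" "e / 2 ^ Suc n"] e by (simp add: x_def)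
    moreover have "y * y = exp (of_real (e / 2 ^ n) * c)"
      by (simp add: y_def mult.commute flip: exp_add)
    \<comment> \<open>Both numbers are square roots of the same value. Having positive real parts
      they cannot be opposite, so the principal branch chosen at \<open>e\<close> stays the right
      one at every halving.\<close>
    ultimately have "(x - y) * (x + y) = 0"
      using Suc by (simp add: algebra_simps)
    moreover have "Re x > 0"
    proof -
      have "e / 2 ^ Suc n \<le> e / 1" using e one_le_power[of "2 :: real" "Suc n"] by (intro divide_left_mono) linarith+
      moreover have "0 < e / 2 ^ Suc n" using e by simp
      ultimately show ?thesis using e unfolding x_def by (intro Re_pos) linarith+
    qed
    moreover have "Re y > 0"
    proof -
      have nz: "g e \<noteq> 0" using Re_pos[OF e] by auto
      have 1: "\<bar>Im (Ln (g e))\<bar> < pi / 2"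
        using Re_pos[OF e] nz Re_Ln_pos_lt[of "g e"] by blast
      have 2: "of_real (e / 2 ^ Suc n) * c = Ln (g e) / of_real (2 ^ Suc n)"
        using e by (simp add: c_def)
      have "\<bar>Im (of_real (e / 2 ^ Suc n) * c)\<bar> = \<bar>Im (Ln (g e))\<bar> / 2 ^ Suc n"
        unfolding 2 Im_divide_of_real by (simp add: abs_divide)
      also have "\<dots> \<le> \<bar>Im (Ln (g e))\<bar> / 1"
        using one_le_power[of "2 :: real" "Suc n"] by (intro divide_left_mono) linarith+
      also have "\<dots> < pi / 2" using 1 by simp
      finally have "cos (Im (of_real (e / 2 ^ Suc n) * c)) > 0"
        by (intro cos_gt_zero_pi) linarith+
      then show ?thesis unfolding y_def Re_exp by simp
    qed
    ultimately have "x = y"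
      by (auto simp: add_eq_0_iff)
    then show ?case by (simp add: x_def y_def)
  qed
  have dyadic_mult: "g (real k * (e / 2 ^ n)) = exp (of_real (real k * (e / 2 ^ n)) * c)" for k n
  proof (induction k)
    case 0
    have "g 0 * g e = g e" using mult[of 0 e] e by simp
    moreover have "g e \<noteq> 0" using Re_pos[OF e] by auto
    ultimately show ?case by simp
  next
    case (Suc k)
    have "g (real (Suc k) * (e / 2 ^ n)) = g (real k * (e / 2 ^ n)) * g (e / 2 ^ n)"
      using mult[of "real k * (e / 2 ^ n)" "e / 2 ^ n"] e by (simp add: algebra_simps add_divide_distrib)
    also have "\<dots> = exp (of_real (real k * (e / 2 ^ n)) * c + of_real (e / 2 ^ n) * c)"
      by (simp only: Suc dyadic exp_add)
    also have "\<dots> = exp (of_real (real (Suc k) * (e / 2 ^ n)) * c)"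
      by (simp add: algebra_simps add_divide_distrib)
    finally show ?case .
  qed
  have "g t = exp (of_real t * c)" if t: "0 \<le> t" for t
  proof -
    \<comment> \<open>The \<open>+ 1\<close> puts the grid point strictly to the right of
      \<open>t\<close>, so that \<open>h n\<close> tends to 0 from the right, the side covered by
      \<open>lim\<close>.\<close>
    define k where "k n = nat \<lfloor>t / (e / 2 ^ n)\<rfloor> + 1" for n :: nat
    define h where "h n = real (k n) * (e / 2 ^ n) - t" for n
    have h: "0 < h n" "h n \<le> e / 2 ^ n" for n
    proof -
      have d: "0 < e / 2 ^ n" using e by simp
      have "0 \<le> \<lfloor>t / (e / 2 ^ n)\<rfloor>"
        using t d by (simp only: zero_le_floor divide_nonneg_pos)
      then have "real (k n) = of_int \<lfloor>t / (e / 2 ^ n)\<rfloor> + 1"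
        unfolding k_def by simp
      then have "t / (e / 2 ^ n) < real (k n)" "real (k n) - 1 \<le> t / (e / 2 ^ n)"
        by linarith+
      then have "t < real (k n) * (e / 2 ^ n)" "(real (k n) - 1) * (e / 2 ^ n) \<le> t"
        by (simp_all only: pos_divide_less_eq[OF d] pos_le_divide_eq[OF d])
      then show "0 < h n" "h n \<le> e / 2 ^ n"
        using d by (simp_all add: h_def left_diff_distrib diff_divide_distrib) 
    qed
    have h0: "h \<longlonglongrightarrow> 0"
    proof (rule tendsto_sandwich[of "\<lambda>_. 0" _ _ "\<lambda>n. e / 2 ^ n"])
      show "(\<lambda>n. e / 2 ^ n) \<longlonglongrightarrow> 0"
        using tendsto_mult[OF tendsto_const[of e] LIMSEQ_power_zero[of "1/2 :: real"]]
        by (simp add: power_one_over field_simps)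
      show "\<forall>\<^sub>F n in sequentially. 0 \<le> h n" using h(1) by (simp add: less_imp_le)
      show "\<forall>\<^sub>F n in sequentially. h n \<le> e / 2 ^ n" using h(2) by simp
    qed simp
    then have "filterlim h (at_right 0) sequentially"
      using h(1) by (intro tendsto_imp_filterlim_at_right) simp_all
    then have "(\<lambda>n. g (h n)) \<longlonglongrightarrow> 1"
      using lim by (rule filterlim_compose[rotated])
    then have "(\<lambda>n. g t * g (h n)) \<longlonglongrightarrow> g t * 1"
      by (intro tendsto_intros)
    moreover have "g t * g (h n) = exp (of_real (t + h n) * c)" for n
    proof -
      have "g t * g (h n) = g (t + h n)" using mult[OF t, of "h n"] h[of n] by simp
      also have "t + h n = real (k n) * (e / 2 ^ n)" by (simp add: h_def)
      also have "g \<dots> = exp (of_real \<dots> * c)" by (rule dyadic_mult)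
      finally show ?thesis by (simp add: h_def)
    qed
    moreover have "(\<lambda>n. exp (of_real (t + h n) * c)) \<longlonglongrightarrow> exp (of_real (t + 0) * c)"
      by (intro tendsto_intros h0)
    ultimately show ?thesis by (simp add: LIMSEQ_unique)
  qed
  then show ?thesis by (rule that)
qed

text \<open>The Laplace transform in \<open>t\<close> of the semigroup exp (t z), taken at 1. From
  the quotient \<open>z\<close> can be recovered without taking a logarithm.\<close>

lemma resolvent_integral:
  fixes z :: complex
  assumes "Re z \<le> 0"
  shows "(LBINT t=0..\<infinity>. complex_of_real (exp (- t)) * exp (of_real t * z)) = 1 / (1 - z)"
    and "set_integrable lborel (einterval 0 \<infinity>) (\<lambda>t. complex_of_real (exp (- t)) * exp (of_real t * z))"
proof -
  have nz: "1 - z \<noteq> 0" "z - 1 \<noteq> 0" using assms by auto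
  have eq: "complex_of_real (exp (- t)) * exp (t * z) = exp (t * (z - 1))" for t
    unfolding exp_of_real[symmetric] exp_add[symmetric] by (simp add: algebra_simps)
  have exp_int: "set_integrable lborel (einterval 0 \<infinity>) (\<lambda>t. exp (-t) :: real)"
  proof (rule interval_integral_FTC_nonneg(1)[where F = "\<lambda>t. - exp (- t)" and A = "- 1" and B = 0])
    show "(((\<lambda>t. - exp (- t) :: real) \<circ> real_of_ereal) \<longlongrightarrow> - 1) (at_right 0)"
      by (auto simp: ereal_tendsto_simps zero_ereal_def intro!: tendsto_eq_intros)
    have "((\<lambda>t. - exp (- t) :: real) \<longlongrightarrow> - 0) at_top"
      by (intro tendsto_minus filterlim_compose[OF exp_at_bot] filterlim_uminus_at_bot_at_top)
    then show "(((\<lambda>t. - exp (- t) :: real) \<circ> real_of_ereal) \<longlongrightarrow> 0) (at_left \<infinity>)"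
      by (simp add: ereal_tendsto_simps)
  qed (auto intro!: derivative_eq_intros continuous_intros)
  show int: "set_integrable lborel (einterval 0 \<infinity>) (\<lambda>t. complex_of_real (exp (- t)) * exp (t * z))"
    unfolding eq
  proof (rule set_integrable_bound[OF exp_int])
    show "AE t in lborel. t \<in> einterval 0 \<infinity> \<longrightarrow> norm (exp (complex_of_real t * (z - 1))) \<le> norm (exp (-t))"
    proof (intro AE_I2 impI)
      fix t :: real assume "t \<in> einterval 0 \<infinity>"
      then have "t * Re z \<le> 0" using assms by (auto simp: einterval_def intro: mult_nonneg_nonpos)
      then show "norm (exp (complex_of_real t * (z - 1))) \<le> norm (exp (-t))"
        by (simp add: norm_exp_eq_Re right_diff_distrib)
    qed
  qed (auto simp: set_borel_measurable_def)
  have "(LBINT t=0..\<infinity>. exp (t * (z - 1))) = 0 - 1 / (z - 1)"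
  proof (rule interval_integral_FTC_integrable[where F = "\<lambda>t. exp (of_real t * (z - 1)) / (z - 1)"])
    fix t :: real
    show "((\<lambda>t. exp (of_real t * (z - 1)) / (z - 1)) has_vector_derivative exp (of_real t * (z - 1))) (at t)"
    proof (rule has_vector_derivative_real_field)
      have "((\<lambda>w. exp (w * (z - 1)) / (z - 1)) has_field_derivative exp (of_real t * (z - 1)) * (z - 1) / (z - 1)) (at (of_real t))"
        by (intro DERIV_cdivide) (auto intro!: derivative_eq_intros)
      then show "((\<lambda>w. exp (w * (z - 1)) / (z - 1)) has_field_derivative exp (of_real t * (z - 1))) (at (of_real t))"
        using nz by simp
    qed
    show "isCont (\<lambda>t. exp (of_real t * (z - 1))) t"
      by (intro continuous_intros)
  next
    show "set_integrable lborel (einterval 0 \<infinity>) (\<lambda>t. exp (of_real t * (z - 1)))"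
      using int unfolding eq .
    have "((\<lambda>t. exp (of_real t * (z - 1)) / (z - 1)) \<longlongrightarrow> exp (of_real 0 * (z - 1)) / (z - 1)) (at_right 0)"
      by (intro tendsto_divide tendsto_exp tendsto_mult tendsto_of_real tendsto_ident_at tendsto_const nz)
    then show "(((\<lambda>t. exp (of_real t * (z - 1)) / (z - 1)) \<circ> real_of_ereal) \<longlongrightarrow> 1 / (z - 1)) (at_right 0)"
      by (simp add: ereal_tendsto_simps zero_ereal_def)
    have "((\<lambda>t. exp (of_real t * (z - 1)) / (z - 1)) \<longlongrightarrow> 0) at_top"
    proof (rule Lim_null_comparison)
      show "((\<lambda>t. exp (- t) / cmod (z - 1)) \<longlongrightarrow> 0) at_top"
        by (intro tendsto_divide_zero) (rule filterlim_compose[OF exp_at_bot], simp add: filterlim_uminus_at_bot filterlim_ident)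
      show "\<forall>\<^sub>F t in at_top. norm (exp (of_real t * (z - 1)) / (z - 1)) \<le> exp (- t) / cmod (z - 1)"
        using eventually_ge_at_top[of 0]
      proof eventually_elim
        case (elim t)
        have "t * Re z \<le> 0" using elim assms by (rule mult_nonneg_nonpos)
        then have "norm (exp (of_real t * (z - 1))) \<le> exp (- t)"
          by (simp add: norm_exp_eq_Re right_diff_distrib)
        then show ?case unfolding norm_divide by (rule divide_right_mono) simp
      qed
    qed
    then show "(((\<lambda>t. exp (of_real t * (z - 1)) / (z - 1)) \<circ> real_of_ereal) \<longlongrightarrow> 0) (at_left \<infinity>)"
      by (simp add: ereal_tendsto_simps)
  qed auto
  then show "(LBINT t=0..\<infinity>. complex_of_real (exp (- t)) * exp (of_real t * z)) = 1 / (1 - z)"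
    unfolding eq using minus_divide_right[of 1 "z - 1"] by simp
qed

text \<open>Each single \<open>t\<close> determines \<open>of_real t * \<kappa> u\<close> only
  modulo 2 \<pi> \<i>, so \<open>\<kappa>\<close> might jump. With all \<open>t\<close> at once,
  dominated convergence makes the resolvent \<open>1 / (1 - \<kappa> u)\<close> continuous, and
  \<open>\<kappa>\<close> is recovered from it.\<close>

lemma continuous_on_if_continuous_on_exp:
  fixes \<kappa> :: "real \<Rightarrow> complex"
  assumes cont: "\<And>t. 0 \<le> t \<Longrightarrow> continuous_on UNIV (\<lambda>u. exp (of_real t * \<kappa> u))"
    and Re: "\<And>u. Re (\<kappa> u) \<le> 0"
  shows "continuous_on UNIV \<kappa>"
proof -
  define R where "R u = (LBINT t=0..\<infinity>. complex_of_real (exp (- t)) * exp (of_real t * \<kappa> u))" for u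
  have R: "R u = 1 / (1 - \<kappa> u)" for u
    unfolding R_def by (rule resolvent_integral(1)[OF Re])
  have nz: "1 - \<kappa> u \<noteq> 0" for u using Re[of u] by auto
  have "(R \<longlongrightarrow> R u) (at u)" for u
  proof (rule tendsto_at_iff_sequentially[THEN iffD2], intro allI impI)
    fix X :: "nat \<Rightarrow> real" assume X: "X \<longlonglongrightarrow> u"
    have 1: "set_integrable lborel (einterval 0 \<infinity>) (\<lambda>t. complex_of_real (exp (- t)) * exp (of_real t * 0))"
      by (rule resolvent_integral(2)) simp
    have "(\<lambda>n. CLINT t:einterval 0 \<infinity>|lborel. complex_of_real (exp (- t)) * exp (of_real t * \<kappa> (X n)))
      \<longlonglongrightarrow> (CLINT t:einterval 0 \<infinity>|lborel. complex_of_real (exp (- t)) * exp (of_real t * \<kappa> u))"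
      unfolding set_lebesgue_integral_def
    proof (rule integral_dominated_convergence)
      show "integrable lborel (\<lambda>t. indicator (einterval 0 \<infinity>) t *\<^sub>R exp (- t))"
        using integrable_norm[OF 1[unfolded set_integrable_def]] by (simp add: abs_mult)
      show "AE t in lborel. (\<lambda>n. indicator (einterval 0 \<infinity>) t *\<^sub>R (complex_of_real (exp (- t)) * exp (of_real t * \<kappa> (X n))))
        \<longlonglongrightarrow> indicator (einterval 0 \<infinity>) t *\<^sub>R (complex_of_real (exp (- t)) * exp (of_real t * \<kappa> u))"
      proof (intro AE_I2)
        fix t :: real
        show "(\<lambda>n. indicator (einterval 0 \<infinity>) t *\<^sub>R (complex_of_real (exp (- t)) * exp (of_real t * \<kappa> (X n))))
          \<longlonglongrightarrow> indicator (einterval 0 \<infinity>) t *\<^sub>R (complex_of_real (exp (- t)) * exp (of_real t * \<kappa> u))"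
        proof (cases "0 \<le> t")
          case True
          have "(\<lambda>n. exp (of_real t * \<kappa> (X n))) \<longlonglongrightarrow> exp (of_real t * \<kappa> u)"
            using continuous_on_tendsto_compose[OF cont[OF True] X UNIV_I] by simp
          then show ?thesis by (intro tendsto_scaleR tendsto_mult tendsto_const)
        qed (auto simp: einterval_def)
      qed
      show "AE t in lborel. norm (indicator (einterval 0 \<infinity>) t *\<^sub>R (complex_of_real (exp (- t)) * exp (of_real t * \<kappa> (X n))))
        \<le> indicator (einterval 0 \<infinity>) t *\<^sub>R exp (- t)" for n
        using Re[of "X n"] by (auto simp: indicator_def einterval_def norm_mult mult_nonneg_nonpos)
    qed auto
    then show "(R \<circ> X) \<longlonglongrightarrow> R u"
      by (simp add: R_def comp_def interval_lebesgue_integral_def)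
  qed
  then have "continuous_on UNIV R" by (simp add: continuous_on_def)
  then have "continuous_on UNIV (\<lambda>u. 1 - 1 / R u)"
    by (intro continuous_intros) (use R nz in auto)
  moreover have "1 - 1 / R u = \<kappa> u" for u using nz[of u] by (simp add: R)
  ultimately show ?thesis by simp
qed

text \<open>Requiring \<open>char_eq\<close> for all \<open>t\<close> determines
  \<open>\<kappa>\<close> uniquely, as a derivative at time 0; no branch of the logarithm is
  involved.\<close>

locale levy_exponent =
  fixes \<mu> :: "real \<Rightarrow> real measure" and \<kappa> :: "real \<Rightarrow> complex"
  assumes distribution: "0 \<le> t \<Longrightarrow> real_distribution (\<mu> t)"
    and char_eq: "0 \<le> t \<Longrightarrow> char (\<mu> t) u = exp (of_real t * \<kappa> u)"
begin

text \<open>This is the derivative of exp (t \<kappa> u) at t = 0. It makes \<open>\<kappa>\<close>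
  a limit of compound Poisson exponents, so that inequalities for exponents reduce to trigonometric
  inequalities under an integral.\<close>

lemma tendsto_exponent: "(\<lambda>n. of_nat n * (char (\<mu> (1 / real n)) u - 1)) \<longlonglongrightarrow> \<kappa> u"
proof -
  have "((\<lambda>z. exp (z * \<kappa> u)) has_field_derivative \<kappa> u) (at 0)"
    by (auto intro!: derivative_eq_intros)
  then have 1: "(\<lambda>z. (exp (z * \<kappa> u) - 1) / z) \<midarrow>0\<rightarrow> \<kappa> u"
    by (simp add: DERIV_def)
  have "filterlim (\<lambda>n. complex_of_real (1 / real n)) (at 0) sequentially"
  proof (rule filterlim_atI)
    have "(\<lambda>n. complex_of_real (1 / real n)) \<longlonglongrightarrow> complex_of_real 0"
      by (intro tendsto_of_real lim_1_over_n)
    then show "(\<lambda>n. complex_of_real (1 / real n)) \<longlonglongrightarrow> 0" by simp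
    show "\<forall>\<^sub>F n in sequentially. complex_of_real (1 / real n) \<noteq> 0"
      using eventually_gt_at_top[of 0] by eventually_elim simp
  qed
  then have "(\<lambda>n. (exp (complex_of_real (1 / real n) * \<kappa> u) - 1) / complex_of_real (1 / real n)) \<longlonglongrightarrow> \<kappa> u"
    using 1 by (rule filterlim_compose[rotated])
  then show ?thesis
    by (simp add: char_eq mult.commute)
qed

lemma exponent_zero [simp]: "\<kappa> 0 = 0"
proof -
  have "char (\<mu> (1 / real n)) 0 = 1" for n
    using real_distribution.char_zero[OF distribution, of "1 / real n"] by simp
  then have "(\<lambda>n::nat. 0) \<longlonglongrightarrow> \<kappa> 0"
    using tendsto_exponent[of 0] by simp
  then show ?thesis by (simp add: LIMSEQ_const_iff)
qed

lemma Re_exponent_nonpos: "Re (\<kappa> u) \<le> 0"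
proof -
  have "exp (Re (\<kappa> u)) \<le> 1"
    using real_distribution.cmod_char_le_1[OF distribution, of 1 u] char_eq[of 1 u]
    by (simp add: norm_exp_eq_Re)
  then show ?thesis by simp
qed

lemma continuous_on_exponent: "continuous_on UNIV \<kappa>"
proof (rule continuous_on_if_continuous_on_exp)
  fix t :: real assume "0 \<le> t"
  then show "continuous_on UNIV (\<lambda>u. exp (of_real t * \<kappa> u))"
    using real_distribution.isCont_char[OF distribution, of t]
    by (simp add: continuous_on_eq_continuous_at flip: char_eq)
qed (rule Re_exponent_nonpos)

lemma exponent_uminus: "\<kappa> (- u) = cnj (\<kappa> u)"
proof -
  have "char (\<mu> (1 / real n)) (- u) = cnj (char (\<mu> (1 / real n)) u)" for n
    unfolding char_def unfolding Bochner_Integration.integral_cnj[symmetric] by (simp add: exp_cnj)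
  then have "(\<lambda>n. cnj (of_nat n * (char (\<mu> (1 / real n)) u - 1))) \<longlonglongrightarrow> \<kappa> (- u)"
    using tendsto_exponent[of "- u"] by simp
  moreover have "(\<lambda>n. cnj (of_nat n * (char (\<mu> (1 / real n)) u - 1))) \<longlonglongrightarrow> cnj (\<kappa> u)"
    by (intro tendsto_cnj tendsto_exponent)
  ultimately show ?thesis by (rule LIMSEQ_unique)
qed

lemma Re_char: "Re (char (\<mu> (1 / real n)) u) = (LINT x|\<mu> (1 / real n). cos (u * x))"
proof -
  interpret real_distribution "\<mu> (1 / real n)" by (rule distribution) simp
  have "Re (char (\<mu> (1 / real n)) u) = (LINT x|\<mu> (1 / real n). Re (iexp (u * x)))"
    unfolding char_def by (rule integral_Re[symmetric]) (auto intro!: integrable_iexp)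
  then show ?thesis by (simp add: Re_exp)
qed

text \<open>\<open>1 - cos\<close> is twice a squared sine and the modulus of the sine is
  subadditive; the factors 2 come from (p + q)^2 \<le> 2 p^2 + 2 q^2. It will keep characteristic
  functions of sums of dependent integrals away from 0.\<close>

lemma Re_exponent_add_le: "- Re (\<kappa> (a + b)) \<le> 2 * - Re (\<kappa> a) + 2 * - Re (\<kappa> b)"
proof -
  let ?f = "\<lambda>n u. Re (of_nat n * (char (\<mu> (1 / real n)) u - 1))"
  have lim: "(\<lambda>n. ?f n u) \<longlonglongrightarrow> Re (\<kappa> u)" for u
    by (intro tendsto_Re tendsto_exponent)
  show ?thesis
  proof (rule LIMSEQ_le)
    show "(\<lambda>n. - ?f n (a + b)) \<longlonglongrightarrow> - Re (\<kappa> (a + b))"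
      by (intro tendsto_intros lim)
    show "(\<lambda>n. 2 * - ?f n a + 2 * - ?f n b) \<longlonglongrightarrow> 2 * - Re (\<kappa> a) + 2 * - Re (\<kappa> b)"
      by (intro tendsto_intros lim)
    have "- ?f n (a + b) \<le> 2 * - ?f n a + 2 * - ?f n b" for n
    proof -
      interpret real_distribution "\<mu> (1 / real n)" by (rule distribution) simp
      have int: "integrable (\<mu> (1 / real n)) (\<lambda>x. cos (u * x))" for u
        by (rule integrable_const_bound[of _ 1]) auto
      have f: "- ?f n u = n * (LINT x|\<mu> (1 / real n). 1 - cos (u * x))" for u
      proof -
        have "(LINT x|\<mu> (1 / real n). 1 - cos (u * x)) = 1 - (LINT x|\<mu> (1 / real n). cos (u * x))"
          using int[of u] by (subst Bochner_Integration.integral_diff) (use prob_space in simp_all)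
        then show ?thesis by (simp add: Re_char right_diff_distrib)
      qed
      have "(LINT x|\<mu> (1 / real n). 1 - cos ((a + b) * x))
        \<le> (LINT x|\<mu> (1 / real n). 2 * (1 - cos (a * x)) + 2 * (1 - cos (b * x)))"
      proof (rule integral_mono)
        fix x
        define s where "s = a * x / 2"
        define t where "t = b * x / 2"
        have half: "1 - cos (2 * r) = 2 * (sin r)\<^sup>2" for r :: real
          by (simp add: cos_double_sin)
        have "\<bar>sin (s + t)\<bar> \<le> \<bar>sin s\<bar> * \<bar>cos t\<bar> + \<bar>cos s\<bar> * \<bar>sin t\<bar>"
          unfolding sin_add abs_mult[symmetric] by (rule abs_triangle_ineq)
        also have "\<dots> \<le> \<bar>sin s\<bar> * 1 + 1 * \<bar>sin t\<bar>"
          by (intro add_mono mult_mono) auto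
        finally have "\<bar>sin (s + t)\<bar>\<^sup>2 \<le> (\<bar>sin s\<bar> + \<bar>sin t\<bar>)\<^sup>2"
          by (intro power_mono) auto
        also have "\<dots> \<le> 2 * (sin s)\<^sup>2 + 2 * (sin t)\<^sup>2"
          using sum_squares_bound[of "\<bar>sin s\<bar>" "\<bar>sin t\<bar>"] by (simp add: power2_sum)
        finally have "1 - cos (2 * (s + t)) \<le> 2 * (1 - cos (2 * s)) + 2 * (1 - cos (2 * t))"
          unfolding half by simp
        then show "1 - cos ((a + b) * x) \<le> 2 * (1 - cos (a * x)) + 2 * (1 - cos (b * x))"
          by (simp add: s_def t_def algebra_simps)
      qed (use int in auto)
      also have "\<dots> = 2 * (LINT x|\<mu> (1 / real n). 1 - cos (a * x)) + 2 * (LINT x|\<mu> (1 / real n). 1 - cos (b * x))"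
        using int by simp
      finally have "n * (LINT x|\<mu> (1 / real n). 1 - cos ((a + b) * x))
        \<le> n * (2 * (LINT x|\<mu> (1 / real n). 1 - cos (a * x)) + 2 * (LINT x|\<mu> (1 / real n). 1 - cos (b * x)))"
        by (intro mult_left_mono) auto
      then show ?thesis unfolding f by (simp add: algebra_simps)
    qed
    then show "\<exists>N. \<forall>n\<ge>N. - ?f n (a + b) \<le> 2 * - ?f n a + 2 * - ?f n b"
      by blast
  qed
qed

text \<open>Before the limit, the second difference is the integral of
  \<open>iexp (u * x) * of_real (1 - cos (y * x))\<close>, whose modulus does not depend on
  \<open>u\<close>. Hence the bound is uniform in \<open>u\<close> even if \<open>\<kappa>\<close>
  is unbounded.\<close>

lemma norm_second_difference_le:
  "norm (\<kappa> u - (\<kappa> (u + y) + \<kappa> (u - y)) / 2) \<le> - Re (\<kappa> y)"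
proof (rule LIMSEQ_le)
  let ?f = "\<lambda>n u. of_nat n * (char (\<mu> (1 / real n)) u - 1)"
  show "(\<lambda>n. norm (?f n u - (?f n (u + y) + ?f n (u - y)) / 2)) \<longlonglongrightarrow> norm (\<kappa> u - (\<kappa> (u + y) + \<kappa> (u - y)) / 2)"
    by (intro tendsto_intros tendsto_exponent) simp
  show "(\<lambda>n. - Re (?f n y)) \<longlonglongrightarrow> - Re (\<kappa> y)"
    by (intro tendsto_intros tendsto_exponent)
  have "norm (?f n u - (?f n (u + y) + ?f n (u - y)) / 2) \<le> - Re (?f n y)" for n
  proof -
    interpret real_distribution "\<mu> (1 / real n)" by (rule distribution) simp
    have int: "integrable (\<mu> (1 / real n)) (\<lambda>x. cos (u * x))" for u
      by (rule integrable_const_bound[of _ 1]) auto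
    have iint: "integrable (\<mu> (1 / real n)) (\<lambda>x. iexp (u * x))" for u
      by (intro integrable_iexp) auto
    have "?f n u - (?f n (u + y) + ?f n (u - y)) / 2
      = of_nat n * (char (\<mu> (1 / real n)) u - (char (\<mu> (1 / real n)) (u + y) + char (\<mu> (1 / real n)) (u - y)) / 2)"
      by (simp add: field_simps)
    also have "char (\<mu> (1 / real n)) u - (char (\<mu> (1 / real n)) (u + y) + char (\<mu> (1 / real n)) (u - y)) / 2
      = (CLINT x|\<mu> (1 / real n). iexp (u * x) - (iexp ((u + y) * x) + iexp ((u - y) * x)) / 2)"
      unfolding char_def using iint[of u] iint[of "u + y"] iint[of "u - y"] by simp
    also have "\<dots> = (CLINT x|\<mu> (1 / real n). iexp (u * x) * of_real (1 - cos (y * x)))"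
    proof (rule Bochner_Integration.integral_cong)
      fix x
      have "iexp (u * x) - (iexp ((u + y) * x) + iexp ((u - y) * x)) / 2
        = iexp (u * x) * (1 - (iexp (y * x) + iexp (- (y * x))) / 2)"
        by (simp add: algebra_simps add_divide_distrib flip: exp_add)
      also have "(iexp (y * x) + iexp (- (y * x))) / 2 = of_real (cos (y * x))"
        by (simp add: complex_eq_iff Re_exp Im_exp)
      finally show "iexp (u * x) - (iexp ((u + y) * x) + iexp ((u - y) * x)) / 2 = iexp (u * x) * of_real (1 - cos (y * x))"
        by simp
    qed simp
    finally have "norm (?f n u - (?f n (u + y) + ?f n (u - y)) / 2)
      = n * norm (CLINT x|\<mu> (1 / real n). iexp (u * x) * of_real (1 - cos (y * x)))"
      by (simp add: norm_mult)
    also have "\<dots> \<le> n * (LINT x|\<mu> (1 / real n). norm (iexp (u * x) * of_real (1 - cos (y * x))))"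
      by (intro mult_left_mono integral_norm_bound) auto
    also have "\<dots> = n * (LINT x|\<mu> (1 / real n). 1 - cos (y * x))"
      by (simp add: norm_mult del: of_real_diff)
    also have "\<dots> = - Re (?f n y)"
    proof -
      have "(LINT x|\<mu> (1 / real n). 1 - cos (y * x)) = 1 - (LINT x|\<mu> (1 / real n). cos (y * x))"
        using int[of y] by (subst Bochner_Integration.integral_diff) (use prob_space in simp_all)
      then show ?thesis by (simp add: Re_char right_diff_distrib)
    qed
    finally show ?thesis .
  qed
  then show "\<exists>N. \<forall>n\<ge>N. norm (?f n u - (?f n (u + y) + ?f n (u - y)) / 2) \<le> - Re (?f n y)"
    by blast
qed

end

section \<open>Convergence of integrals over all Borel sets\<close>

text \<open>Gliding hump: otherwise a subsequence of \<open>d\<close> carries mass on disjoint rings, and the integrals over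
  the union of the positive parts in these rings stay away from \<open>0\<close>.\<close>

lemma integral_norm_tendsto_zero_if_set_integrals:
  fixes d :: "nat \<Rightarrow> real \<Rightarrow> real"
  assumes int: "\<And>n. integrable lborel (d n)"
    and ae: "AE s in lborel. (\<lambda>n. d n s) \<longlonglongrightarrow> 0"
    and lim: "\<And>A. A \<in> sets borel \<Longrightarrow> (\<lambda>n. LINT s:A|lborel. d n s) \<longlonglongrightarrow> 0"
  shows "(\<lambda>n. LBINT s. \<bar>d n s\<bar>) \<longlonglongrightarrow> 0"
proof (rule ccontr)
  assume "\<not> ?thesis"
  then obtain e where e: "e > 0" and "\<not> (\<forall>\<^sub>F n in sequentially. \<bar>LBINT s. \<bar>d n s\<bar>\<bar> < e)"
    by (auto simp: tendsto_iff dist_real_def)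
  then have large: "\<exists>n>N. e \<le> (LBINT s. \<bar>d n s\<bar>)" for N
    by (auto simp: eventually_sequentially not_less) (meson Suc_le_eq)
  note [measurable] = borel_measurable_integrable[OF int]
  \<comment> \<open>On \<open>A m\<close>, which is bounded, all \<open>d n\<close> with
    \<open>n \<ge> m\<close> are dominated by 1, so their integrals over it tend to 0. The sets
    \<open>A m\<close> increase to almost the whole line.\<close>
  define A where "A m = {s \<in> {- real m..real m}. \<forall>n\<ge>m. \<bar>d n s\<bar> \<le> 1}" for m
  have A [measurable]: "A m \<in> sets borel" for m
    unfolding A_def by measurable
  have intA: "integrable lborel (\<lambda>s. indicator B s * \<bar>d n s\<bar>)" if "B \<in> sets borel" for B n
    using integrable_mult_indicator[OF _ integrable_abs[OF int], of B n] that by simp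
  have mono: "A m \<subseteq> A n" if "m \<le> n" for m n
    using that unfolding A_def by force
  have ae_A: "AE s in lborel. \<exists>m. s \<in> A m"
    using ae
  proof eventually_elim
    case (elim s)
    then obtain N where N: "\<And>n. n \<ge> N \<Longrightarrow> \<bar>d n s\<bar> < 1"
      using LIMSEQ_D[OF elim, of 1] by auto
    obtain m where m: "\<bar>s\<bar> \<le> real m" using real_arch_simple by blast
    have "\<bar>d n s\<bar> \<le> 1" if "n \<ge> N" for n using N[OF that] by simp
    then have "s \<in> A (max N m)"
      using m unfolding A_def by (auto simp: abs_le_iff)
    then show ?case by blast
  qed
  have near: "(\<lambda>n. LBINT s. indicator (A m) s * \<bar>d n s\<bar>) \<longlonglongrightarrow> 0" for m
  proof -
    have "(\<lambda>n. LBINT s. indicator (A m) s * \<bar>d (n + m) s\<bar>) \<longlonglongrightarrow> (LBINT s. indicator (A m) s * \<bar>0 :: real\<bar>)"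
    proof (rule integral_dominated_convergence[where w = "indicator {- real m..real m}"])
      show "AE s in lborel. (\<lambda>n. indicator (A m) s * \<bar>d (n + m) s\<bar>) \<longlonglongrightarrow> indicator (A m) s * \<bar>0 :: real\<bar>"
        using ae by eventually_elim (intro tendsto_intros LIMSEQ_ignore_initial_segment)
      show "AE s in lborel. norm (indicator (A m) s * \<bar>d (n + m) s\<bar>) \<le> indicator {- real m..real m} s" for n
        by (auto simp: A_def indicator_def)
    qed (auto intro!: integrable_real_indicator)
    then show ?thesis by (simp add: LIMSEQ_offset)
  qed
  have far: "(\<lambda>m. LBINT s. indicator (- A m) s * \<bar>d n s\<bar>) \<longlonglongrightarrow> 0" for n
  proof -
    have "(\<lambda>m. LBINT s. indicator (- A m) s * \<bar>d n s\<bar>) \<longlonglongrightarrow> (LINT s::real|lborel. (0 :: real))"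
    proof (rule integral_dominated_convergence[where w = "\<lambda>s. \<bar>d n s\<bar>" and s = "\<lambda>m s. indicator (- A m) s * \<bar>d n s\<bar>" and f = "\<lambda>_ :: real. 0 :: real"])
      show "AE s in lborel. (\<lambda>m. indicator (- A m) s * \<bar>d n s\<bar>) \<longlonglongrightarrow> (0 :: real)"
        using ae_A
      proof eventually_elim
        case (elim s)
        then obtain m where "s \<in> A m" by blast
        then have "\<And>k. k \<ge> m \<Longrightarrow> indicator (- A k) s * \<bar>d n s\<bar> = 0"
          using mono by (auto simp: indicator_def)
        then show ?case by (intro tendsto_eventually eventually_sequentiallyI[of m])
      qed
    qed (use int in \<open>auto simp: indicator_def\<close>)
    then show ?thesis by simp
  qed
  \<comment> \<open>A state consists of a cut-off and an index. The new index \<open>n'\<close> has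
    little mass inside \<open>A m\<close>, and the new cut-off \<open>m'\<close> leaves little mass
    of \<open>d n'\<close> outside \<open>A m'\<close>, so that the mass sits in the ring between
    them. The bounds e / 16, each counted twice below, cost e / 4 out of the e / 2 that half the
    norm contributes.\<close>
  define P where "P = (\<lambda>(m, n) (m', n').
      n < n' \<and> e \<le> (LBINT s. \<bar>d n' s\<bar>) \<and> m \<le> m' \<and>
      (LBINT s. indicator (A m) s * \<bar>d n' s\<bar>) < e / 16 \<and>
      (LBINT s. indicator (- A m') s * \<bar>d n' s\<bar>) < e / 16)"
  have "\<exists>q. \<forall>k. True \<and> P (q k) (q (Suc k))"
  proof (rule dependent_nat_choice)
    fix x :: "nat \<times> nat" and k :: nat
    obtain m n where x: "x = (m, n)" by (cases x)
    obtain N where N: "\<And>n. n \<ge> N \<Longrightarrow> (LBINT s. indicator (A m) s * \<bar>d n s\<bar>) < e / 16"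
      using LIMSEQ_D[OF near, of "e / 16" m] e by fastforce
    obtain n' where n': "n' > max n N" "e \<le> (LBINT s. \<bar>d n' s\<bar>)"
      using large by blast
    obtain K where K: "\<And>m. m \<ge> K \<Longrightarrow> (LBINT s. indicator (- A m) s * \<bar>d n' s\<bar>) < e / 16"
      using LIMSEQ_D[OF far, of "e / 16" n'] e by fastforce
    show "\<exists>y. True \<and> P x y"
      using n' N[of n'] K[of "max m K"] by (intro exI[of _ "(max m K, n')"]) (auto simp: x P_def)
  qed auto
  then obtain q where q: "\<And>k. P (q k) (q (Suc k))" by blast
  define m where "m k = fst (q k)" for k
  define n where "n k = snd (q (Suc k))" for k
  have P: "snd (q k) < n k" "e \<le> (LBINT s. \<bar>d (n k) s\<bar>)" "m k \<le> m (Suc k)"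
      "(LBINT s. indicator (A (m k)) s * \<bar>d (n k) s\<bar>) < e / 16"
      "(LBINT s. indicator (- A (m (Suc k))) s * \<bar>d (n k) s\<bar>) < e / 16" for k
    using q[of k] by (auto simp: P_def m_def n_def split: prod.splits)
  have "strict_mono n"
    unfolding strict_mono_Suc_iff using P(1)[of "Suc _"] by (auto simp: n_def)
  have "incseq m" using P(3) by (rule incseq_SucI)
  define G where "G = (\<Union>k. (A (m (Suc k)) - A (m k)) \<inter> {s. d (n k) s > 0})"
  have G [measurable]: "G \<in> sets borel" unfolding G_def by measurable
  have G_ring: "s \<in> G \<longleftrightarrow> d (n k) s > 0" if s: "s \<in> A (m (Suc k))" "s \<notin> A (m k)" for s k
  proof
    assume "s \<in> G"
    then obtain j where j: "s \<in> A (m (Suc j))" "s \<notin> A (m j)" "d (n j) s > 0"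
      by (auto simp: G_def)
    have "j = k"
    proof (rule ccontr)
      assume "j \<noteq> k"
      then consider "Suc j \<le> k" | "Suc k \<le> j" by linarith
      then show False
        by cases (use s j mono incseqD[OF \<open>incseq m\<close>] in blast)+
    qed
    then show "d (n k) s > 0" using j by simp
  qed (use s in \<open>auto simp: G_def\<close>)
  have "e / 4 + (LBINT s. d (n k) s) / 2 \<le> (LINT s:G|lborel. d (n k) s)" for k
  proof -
    let ?d = "d (n k)"
    \<comment> \<open>In the ring \<open>G\<close> selects exactly the positive part
      \<open>(\<bar>?d s\<bar> + ?d s) / 2\<close>. Outside the ring \<open>G\<close> depends on the
      other indices, and the subtracted terms absorb whatever happens there.\<close>
    have "(LBINT s. (\<bar>?d s\<bar> + ?d s) / 2 - 2 * (indicator (A (m k)) s * \<bar>?d s\<bar>)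
        - 2 * (indicator (- A (m (Suc k))) s * \<bar>?d s\<bar>)) \<le> (LINT s:G|lborel. ?d s)"
      unfolding set_lebesgue_integral_def
    proof (rule integral_mono)
      show "integrable lborel (\<lambda>s. indicator G s *\<^sub>R ?d s)"
        by (intro integrable_mult_indicator int) simp
      show "(\<bar>?d s\<bar> + ?d s) / 2 - 2 * (indicator (A (m k)) s * \<bar>?d s\<bar>)
        - 2 * (indicator (- A (m (Suc k))) s * \<bar>?d s\<bar>) \<le> indicator G s *\<^sub>R ?d s" for s
        using G_ring[of s k] by (cases "s \<in> A (m k)"; cases "s \<in> A (m (Suc k))"; cases "s \<in> G") (auto simp: abs_if)
    qed (intro Bochner_Integration.integrable_diff integrable_mult_right integrable_divide Bochner_Integration.integrable_add integrable_abs int intA; simp)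
    also have "(LBINT s. (\<bar>?d s\<bar> + ?d s) / 2 - 2 * (indicator (A (m k)) s * \<bar>?d s\<bar>)
        - 2 * (indicator (- A (m (Suc k))) s * \<bar>?d s\<bar>))
      = ((LBINT s. \<bar>?d s\<bar>) + (LBINT s. ?d s)) / 2 - 2 * (LBINT s. indicator (A (m k)) s * \<bar>?d s\<bar>)
        - 2 * (LBINT s. indicator (- A (m (Suc k))) s * \<bar>?d s\<bar>)"
      using intA[of "A (m k)" "n k"] intA[of "- A (m (Suc k))" "n k"] int[of "n k"] by simp
    finally show ?thesis
      using P[of k] by (simp add: field_simps)
  qed
  moreover have "(\<lambda>k. e / 4 + (LBINT s. d (n k) s) / 2) \<longlonglongrightarrow> e / 4 + 0 / 2"
    using LIMSEQ_subseq_LIMSEQ[OF lim[of UNIV] \<open>strict_mono n\<close>]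
    by (intro tendsto_intros) (simp_all add: comp_def set_lebesgue_integral_def)
  moreover have "(\<lambda>k. LINT s:G|lborel. d (n k) s) \<longlonglongrightarrow> 0"
    using LIMSEQ_subseq_LIMSEQ[OF lim[OF G] \<open>strict_mono n\<close>] by (simp add: comp_def)
  ultimately have "e / 4 + 0 / 2 \<le> 0"
    by (intro LIMSEQ_le) auto
  then show False using e by simp
qed

text \<open>A statement of Vitali-Hahn-Saks type. If \<open>q\<close> were not Cauchy in L1, the
  differences of two subsequences would converge to 0 almost everywhere and in integral over every
  Borel set, yet not in norm. Fatou's lemma then identifies the L1 limit with
  \<open>Q\<close>.\<close>

lemma integral_convergence_if_set_integrals_Cauchy:
  fixes q :: "nat \<Rightarrow> real \<Rightarrow> complex"
  assumes int: "\<And>n. integrable lborel (q n)"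
    and ae: "AE s in lborel. (\<lambda>n. q n s) \<longlonglongrightarrow> Q s"
    and [measurable]: "Q \<in> borel_measurable borel"
    and Cauchy: "\<And>A. A \<in> sets borel \<Longrightarrow> Cauchy (\<lambda>n. CLINT s:A|lborel. q n s)"
  shows "integrable lborel Q" and "(\<lambda>n. CLBINT s. q n s) \<longlonglongrightarrow> (CLBINT s. Q s)"
proof -
  note [measurable] = borel_measurable_integrable[OF int]
  have L1_Cauchy: "\<exists>N. \<forall>n\<ge>N. \<forall>m\<ge>N. (LBINT s. norm (q n s - q m s)) < e" if e: "e > 0" for e
  proof (rule ccontr)
    assume "\<not> ?thesis"
    then have "\<forall>N. \<exists>p. fst p \<ge> N \<and> snd p \<ge> N \<and> e \<le> (LBINT s. norm (q (fst p) s - q (snd p) s))"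
      by (simp add: not_less)
    from choice[OF this] obtain p where p: "\<And>k. fst (p k) \<ge> k" "\<And>k. snd (p k) \<ge> k"
      "\<And>k. e \<le> (LBINT s. norm (q (fst (p k)) s - q (snd (p k)) s))"
      by blast
    define n m where "n k = fst (p k)" and "m k = snd (p k)" for k
    have nm: "\<And>k. n k \<ge> k" "\<And>k. m k \<ge> k"
      "\<And>k. e \<le> (LBINT s. norm (q (n k) s - q (m k) s))"
      using p by (auto simp: n_def m_def)
    have top: "filterlim n at_top sequentially" "filterlim m at_top sequentially"
      using nm by (auto intro: filterlim_at_top_mono[OF filterlim_ident])
    let ?d = "\<lambda>k s. q (n k) s - q (m k) s"
    have ae0: "AE s in lborel. (\<lambda>k. ?d k s) \<longlonglongrightarrow> 0"
      using ae
    proof eventually_elim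
      case (elim s)
      have "(\<lambda>k. ?d k s) \<longlonglongrightarrow> Q s - Q s"
        by (intro tendsto_diff filterlim_compose[OF elim] top)
      then show ?case by simp
    qed
    have lim0: "(\<lambda>k. CLINT s:A|lborel. ?d k s) \<longlonglongrightarrow> 0" if A: "A \<in> sets borel" for A
    proof -
      obtain l where l: "(\<lambda>n. CLINT s:A|lborel. q n s) \<longlonglongrightarrow> l"
        using Cauchy[OF A] Cauchy_convergent convergent_def by blast
      have "(\<lambda>k. (CLINT s:A|lborel. q (n k) s) - (CLINT s:A|lborel. q (m k) s)) \<longlonglongrightarrow> l - l"
        by (intro tendsto_diff filterlim_compose[OF l] top)
      moreover have "(CLINT s:A|lborel. ?d k s) = (CLINT s:A|lborel. q (n k) s) - (CLINT s:A|lborel. q (m k) s)" for k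
        using int A by (intro set_integral_diff) (auto simp: set_integrable_def intro!: integrable_mult_indicator)
      ultimately show ?thesis by simp
    qed
    have intd: "integrable lborel (\<lambda>s. indicator A s *\<^sub>R ?d k s)" if "A \<in> sets borel" for A k
      using int that by (intro integrable_mult_indicator) auto
    have "(\<lambda>k. LBINT s. \<bar>Re (?d k s)\<bar>) \<longlonglongrightarrow> 0"
    proof (rule integral_norm_tendsto_zero_if_set_integrals)
      show "AE s in lborel. (\<lambda>k. Re (?d k s)) \<longlonglongrightarrow> 0"
        using ae0 by eventually_elim (use tendsto_Re in fastforce)
      show "(\<lambda>k. LINT s:A|lborel. Re (?d k s)) \<longlonglongrightarrow> 0" if A: "A \<in> sets borel" for A
        using tendsto_Re[OF lim0[OF A]] integral_Re[OF intd[OF A]]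
        by (simp add: set_lebesgue_integral_def)
    qed (use int in auto)
    moreover have "(\<lambda>k. LBINT s. \<bar>Im (?d k s)\<bar>) \<longlonglongrightarrow> 0"
    proof (rule integral_norm_tendsto_zero_if_set_integrals)
      show "AE s in lborel. (\<lambda>k. Im (?d k s)) \<longlonglongrightarrow> 0"
        using ae0 by eventually_elim (use tendsto_Im in fastforce)
      show "(\<lambda>k. LINT s:A|lborel. Im (?d k s)) \<longlonglongrightarrow> 0" if A: "A \<in> sets borel" for A
        using tendsto_Im[OF lim0[OF A]] integral_Im[OF intd[OF A]]
        by (simp add: set_lebesgue_integral_def)
    qed (use int in auto)
    ultimately have "(\<lambda>k. (LBINT s. \<bar>Re (?d k s)\<bar>) + (LBINT s. \<bar>Im (?d k s)\<bar>)) \<longlonglongrightarrow> 0 + 0"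
      by (rule tendsto_add)
    moreover have "e \<le> (LBINT s. \<bar>Re (?d k s)\<bar>) + (LBINT s. \<bar>Im (?d k s)\<bar>)" for k
    proof -
      have "e \<le> (LBINT s. norm (?d k s))" by (rule nm)
      also have "\<dots> \<le> (LBINT s. \<bar>Re (?d k s)\<bar> + \<bar>Im (?d k s)\<bar>)"
        using int by (intro integral_mono cmod_le) auto
      also have "\<dots> = (LBINT s. \<bar>Re (?d k s)\<bar>) + (LBINT s. \<bar>Im (?d k s)\<bar>)"
        using int by (intro Bochner_Integration.integral_add) auto
      finally show ?thesis .
    qed
    ultimately have "e \<le> 0 + 0"
      by (intro LIMSEQ_le_const) auto
    then show False using e by simp
  qed
  have Fatou: "(\<integral>\<^sup>+ s. norm (q n s - Q s) \<partial>lborel) \<le> ennreal e"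
    if "\<And>m. m \<ge> N \<Longrightarrow> (LBINT s. norm (q n s - q m s)) < e" for n N e
  proof -
    have "(\<integral>\<^sup>+ s. norm (q n s - Q s) \<partial>lborel)
      = (\<integral>\<^sup>+ s. liminf (\<lambda>m. ennreal (norm (q n s - q m s))) \<partial>lborel)"
    proof (rule nn_integral_cong_AE)
      show "AE s in lborel. ennreal (norm (q n s - Q s)) = liminf (\<lambda>m. ennreal (norm (q n s - q m s)))"
        using ae
      proof eventually_elim
        case (elim s)
        have lim: "(\<lambda>m. ennreal (norm (q n s - q m s))) \<longlonglongrightarrow> ennreal (norm (q n s - Q s))"
          by (intro tendsto_ennrealI tendsto_intros elim)
        show ?case by (rule lim_imp_Liminf[OF sequentially_bot lim, symmetric])
      qed
    qed
    also have "\<dots> \<le> liminf (\<lambda>m. \<integral>\<^sup>+ s. norm (q n s - q m s) \<partial>lborel)"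
      by (intro nn_integral_liminf) simp
    also have "\<dots> = liminf (\<lambda>m. ennreal (LBINT s. norm (q n s - q m s)))"
      using int by (subst nn_integral_eq_integral) auto
    also have "\<dots> \<le> ennreal e"
    proof -
      have "\<forall>\<^sub>F m in sequentially. ennreal (LBINT s. norm (q n s - q m s)) \<le> ennreal e"
        using eventually_ge_at_top[of N] by eventually_elim (rule ennreal_leI, rule less_imp_le, rule that)
      then have "liminf (\<lambda>m. ennreal (LBINT s. norm (q n s - q m s))) \<le> liminf (\<lambda>m. ennreal e)"
        by (rule Liminf_mono)
      then show ?thesis by (simp add: Liminf_const)
    qed
    finally show ?thesis .
  qed
  obtain N where N: "\<And>n m. n \<ge> N \<Longrightarrow> m \<ge> N \<Longrightarrow> (LBINT s. norm (q n s - q m s)) < 1"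
    using L1_Cauchy[of 1] by auto
  have "integrable lborel (\<lambda>s. q N s - Q s)"
  proof (rule integrableI_bounded)
    show "(\<integral>\<^sup>+ s. norm (q N s - Q s) \<partial>lborel) < \<infinity>"
      using Fatou[of N N 1] N[of N] by (auto intro: le_less_trans)
  qed simp
  then have "integrable lborel (\<lambda>s. q N s - (q N s - Q s))"
    by (rule Bochner_Integration.integrable_diff[OF int])
  moreover have "(\<lambda>s. q N s - (q N s - Q s)) = Q" by auto
  ultimately show Q: "integrable lborel Q" by (simp only:)
  show "(\<lambda>n. CLBINT s. q n s) \<longlonglongrightarrow> (CLBINT s. Q s)"
  proof (rule tendsto_L1_int[OF int Q])
    show "(\<lambda>n. \<integral>\<^sup>+ s. norm (q n s - Q s) \<partial>lborel) \<longlonglongrightarrow> 0"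
    proof (rule tendsto_zero_ennreal)
      fix r :: real assume "0 < r"
      then obtain N where N: "\<And>n m. n \<ge> N \<Longrightarrow> m \<ge> N \<Longrightarrow> (LBINT s. norm (q n s - q m s)) < r / 2"
        using L1_Cauchy[of "r / 2"] by auto
      show "\<forall>\<^sub>F n in sequentially. (\<integral>\<^sup>+ s. norm (q n s - Q s) \<partial>lborel) < ennreal r"
        using eventually_ge_at_top[of N]
      proof eventually_elim
        case (elim n)
        have "(\<integral>\<^sup>+ s. norm (q n s - Q s) \<partial>lborel) \<le> ennreal (r / 2)"
          using N[OF elim] by (rule Fatou)
        also have "\<dots> < ennreal r" using \<open>0 < r\<close> by (intro ennreal_lessI) auto
        finally show ?case .
      qed
    qed
  qed
qed

text \<open>Resolves the \<open>2 \<pi> \<i>\<close> ambiguity of logarithms along a path starting at \<open>0\<close>.\<close>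

lemma small_if_exp_near_one:
  fixes e :: real
  assumes "e > 0"
  obtains \<delta> where "\<delta> > 0" "\<delta> < 1"
    "\<And>q :: real \<Rightarrow> complex. continuous_on {0..1} q \<Longrightarrow> q 0 = 0 \<Longrightarrow>
      (\<And>c. c \<in> {0..1} \<Longrightarrow> norm (exp (q c) - 1) < \<delta>) \<Longrightarrow> norm (q 1) < e"
proof -
  have "isCont Ln 1" by (rule continuous_at_Ln) simp
  then obtain r where r: "r > 0" "\<And>w. dist w 1 < r \<Longrightarrow> dist (Ln w) (Ln 1) < e"
    using assms unfolding continuous_at_eps_delta by blast
  \<comment> \<open>The bound 1 / 2 keeps \<open>exp (q c)\<close> in the right half-plane;
    \<open>r\<close> comes from the continuity of \<open>Ln\<close> at 1.\<close>
  define \<delta> where "\<delta> = min r (1 / 2)"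
  have "norm (q 1) < e" if q: "continuous_on {0..1} q" "q 0 = 0"
    "\<And>c. c \<in> {0..1} \<Longrightarrow> norm (exp (q c) - 1) < \<delta>" for q :: "real \<Rightarrow> complex"
  proof -
    have Re_pos: "Re (exp (q c)) > 0" if "c \<in> {0..1}" for c
      using q(3)[OF that] abs_Re_le_cmod[of "exp (q c) - 1"] unfolding \<delta>_def by (simp del: Re_exp) linarith
    have cont: "continuous_on {0..1} (\<lambda>c. Im (q c))" by (intro continuous_intros q)
    \<comment> \<open>The function \<open>\<bar>Im (q c)\<bar>\<close> starts at 0 and is
      continuous, so it cannot leave the strip without attaining pi / 2, where the cosine vanishes.
      Inside the strip \<open>Ln\<close> inverts \<open>exp\<close>.\<close>
    have bound: "\<bar>Im (q c)\<bar> < pi / 2" if c: "c \<in> {0..1}" for c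
    proof (rule ccontr)
      assume *: "\<not> ?thesis"
      have cos: "cos (Im (q c)) > 0" if "c \<in> {0..1}" for c
        using Re_pos[OF that] by (simp add: Re_exp zero_less_mult_iff)
      have "continuous_on {0..c} (\<lambda>c. \<bar>Im (q c)\<bar>)"
        using c by (intro continuous_intros continuous_on_subset[OF q(1)]) auto
      then obtain x where "0 \<le> x" "x \<le> c" "\<bar>Im (q x)\<bar> = pi / 2"
        using IVT'[of "\<lambda>c. \<bar>Im (q c)\<bar>" 0 "pi / 2" c] * c q(2) pi_gt_zero by auto
      moreover from this have "x \<in> {0..1}" using c by auto
      ultimately have "cos (pi / 2) > 0" using cos[of x] by (metis cos_abs_real)
      then show False by simp
    qed
    have "norm (exp (q 1) - 1) < r" using q(3)[of 1] by (simp add: \<delta>_def)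
    then have "norm (Ln (exp (q 1))) < e" using r(2)[of "exp (q 1)"] by (simp add: dist_norm)
    moreover have "Ln (exp (q 1)) = q 1"
      using bound[of 1] by (intro Ln_exp) auto
    ultimately show ?thesis by simp
  qed
  then show ?thesis using that[of \<delta>] r(1) by (simp add: \<delta>_def)
qed

section \<open>Homogeneous Levy bases\<close>

text \<open>Dynkin induction carried out inside a bounded window \<open>C\<close>. A Levy basis is
  controlled on bounded sets only, so complements are taken relative to a bounded half-open
  interval.\<close>

lemma bounded_borel_induct [consumes 2, case_names interval compl union]:
  fixes A :: "real set"
  assumes "A \<in> sets borel" "bounded A"
    and interval: "\<And>a b. a \<le> b \<Longrightarrow> P {a<..b}"
    and compl: "\<And>A a b. A \<in> sets borel \<Longrightarrow> a \<le> b \<Longrightarrow> A \<subseteq> {a<..b} \<Longrightarrow> P A \<Longrightarrow> P ({a<..b} - A)"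
    and union: "\<And>A :: nat \<Rightarrow> real set. (\<And>i. A i \<in> sets borel) \<Longrightarrow> disjoint_family A \<Longrightarrow>
      bounded (\<Union>i. A i) \<Longrightarrow> (\<And>i. P (A i)) \<Longrightarrow> P (\<Union>i. A i)"
  shows "P A"
proof -
  obtain a where a: "\<And>x. x \<in> A \<Longrightarrow> \<bar>x\<bar> \<le> a"
    using \<open>bounded A\<close> by (auto simp: bounded_iff)
  define C where "C = {- \<bar>a\<bar> - 1<..\<bar>a\<bar>}"
  have [measurable]: "C \<in> sets borel" by (simp add: C_def)
  have C: "bounded (B \<inter> C)" for B
    unfolding C_def by (rule bounded_subset[OF bounded_closed_interval[of "- \<bar>a\<bar> - 1" "\<bar>a\<bar>"]]) auto
  have PC: "P ({c<..d} \<inter> C)" for c d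
  proof -
    \<comment> \<open>The outer \<open>max\<close> keeps the end points ordered when the
      intersection is empty, as \<open>interval\<close> requires.\<close>
    have "{c<..d} \<inter> C = {max c (- \<bar>a\<bar> - 1)<..max (max c (- \<bar>a\<bar> - 1)) (min d \<bar>a\<bar>)}"
      unfolding C_def by auto
    then show ?thesis using interval by simp
  qed
  let ?G = "range (\<lambda>(a, b). {a <.. b::real})"
  have "Int_stable ?G"
  proof (rule Int_stableI)
    fix X Y assume "X \<in> ?G" "Y \<in> ?G"
    then obtain c d c' d' where "X = {c<..d}" "Y = {c'<..d'}" by auto
    then have "X \<inter> Y = {max c c'<..min d d'}" by auto
    then show "X \<inter> Y \<in> ?G" by auto
  qed
  moreover have "?G \<subseteq> Pow UNIV" by simp
  moreover have "A \<in> sigma_sets UNIV ?G"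
    using \<open>A \<in> sets borel\<close> by (simp add: borel_sigma_sets_Ioc)
  ultimately have "P (A \<inter> C)"
  proof (induction rule: sigma_sets_induct_disjoint)
    case (basic X)
    then show ?case using PC by auto
  next
    case empty
    show ?case using interval[of 0 0] by simp
  next
    case (compl X)
    then have [measurable]: "X \<in> sets borel" by (simp add: borel_sigma_sets_Ioc)
    have "(UNIV - X) \<inter> C = C - (X \<inter> C)" by auto
    then show ?case
      using assms(4)[of "X \<inter> C" "- \<bar>a\<bar> - 1" "\<bar>a\<bar>"] compl by (simp add: C_def)
  next
    case (union X)
    then have [measurable]: "X i \<in> sets borel" for i by (auto simp: borel_sigma_sets_Ioc)
    have "(\<Union>i. X i) \<inter> C = (\<Union>i. X i \<inter> C)" by auto
    moreover have "P (\<Union>i. X i \<inter> C)"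
    proof (rule assms(5))
      show "disjoint_family (\<lambda>i. X i \<inter> C)"
        using union(1) by (auto simp: disjoint_family_on_def)
      show "bounded (\<Union>i. X i \<inter> C)"
        using C[of "\<Union>i. X i"] by (simp add: Int_commute)
    qed (use union in auto)
    ultimately show ?case by simp
  qed
  moreover have "A \<inter> C = A" using a by (force simp: C_def)
  ultimately show ?thesis by simp
qed

lemma (in prob_space) char_distr:
  "X \<in> borel_measurable M \<Longrightarrow> char (distr M borel X) u = (CLINT \<omega>|M. iexp (u * X \<omega>))"
  unfolding char_def by (subst integral_distr) auto

lemma (in prob_space) tendsto_char_AE:
  fixes X :: "nat \<Rightarrow> 'a \<Rightarrow> real"
  assumes [measurable]: "\<And>n. X n \<in> borel_measurable M" "Y \<in> borel_measurable M"
    and "AE \<omega> in M. (\<lambda>n. X n \<omega>) \<longlonglongrightarrow> Y \<omega>"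
  shows "(\<lambda>n. char (distr M borel (X n)) u) \<longlonglongrightarrow> char (distr M borel Y) u"
  unfolding char_distr[OF assms(1)] char_distr[OF assms(2)]
proof (rule integral_dominated_convergence[where w = "\<lambda>_. 1"])
  show "AE \<omega> in M. (\<lambda>n. iexp (u * X n \<omega>)) \<longlonglongrightarrow> iexp (u * Y \<omega>)"
    using assms(3) by eventually_elim (intro tendsto_intros)
qed auto

locale levy_basis = prob_space M for M :: "'a measure" +
  fixes Z :: "real \<Rightarrow> 'a \<Rightarrow> real" and \<kappa> :: "real \<Rightarrow> complex"
  assumes levy2: "levy_process2 M Z"
    and exponent: "levy_exponent (\<lambda>t. distr M borel (Z t)) \<kappa>"
begin

sublocale levy_exponent "\<lambda>t. distr M borel (Z t)" \<kappa> by (rule exponent)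

lemma Z_measurable [measurable]: "Z t \<in> borel_measurable M"
  using levy2 by (simp add: levy_process2_def)

lemma char_increment:
  assumes "s \<le> t"
  shows "char (distr M borel (\<lambda>\<omega>. Z t \<omega> - Z s \<omega>)) u = exp (of_real (t - s) * \<kappa> u)"
proof -
  have "distr M borel (\<lambda>\<omega>. Z (s + (t - s)) \<omega> - Z s \<omega>) = distr M borel (\<lambda>\<omega>. Z (t - s) \<omega> - Z 0 \<omega>)"
  proof -
    have "\<forall>s h. 0 \<le> h \<longrightarrow> distr M borel (\<lambda>\<omega>. Z (s + h) \<omega> - Z s \<omega>) = distr M borel (\<lambda>\<omega>. Z h \<omega> - Z 0 \<omega>)"
      using levy2 unfolding levy_process2_def by (elim conjE)
    from this[rule_format, of "t - s" s] assms show ?thesis by simp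
  qed
  also have "\<dots> = distr M borel (Z (t - s))"
  proof (rule distr_cong_AE)
    have "AE \<omega> in M. Z 0 \<omega> = 0" using levy2 by (simp add: levy_process2_def)
    then show "AE \<omega> in M. Z (t - s) \<omega> - Z 0 \<omega> = Z (t - s) \<omega>" by eventually_elim simp
  qed auto
  finally show ?thesis using assms by (simp add: char_eq)
qed

context
  fixes \<Lambda> assumes basis: "levy_basis_of M Z \<Lambda>"
begin

lemma basis_measurable [measurable]: "A \<in> sets borel \<Longrightarrow> bounded A \<Longrightarrow> \<Lambda> A \<in> borel_measurable M"
  using basis by (simp add: levy_basis_of_def)

lemma basis_interval: "s \<le> t \<Longrightarrow> AE \<omega> in M. \<Lambda> {s<..t} \<omega> = Z t \<omega> - Z s \<omega>"
  using basis by (simp add: levy_basis_of_def)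

lemma basis_indep:
  fixes n :: nat
  assumes "\<And>i. i < n \<Longrightarrow> A i \<in> sets borel" "\<And>i. i < n \<Longrightarrow> bounded (A i)" "disjoint_family_on A {..<n}"
  shows "indep_vars (\<lambda>_. borel) (\<lambda>i. \<Lambda> (A i)) {..<n}"
proof -
  have "\<forall>(A::nat \<Rightarrow> real set) n. (\<forall>i<n. A i \<in> sets borel \<and> bounded (A i)) \<and>
      disjoint_family_on A {..<n} \<longrightarrow> indep_vars (\<lambda>_. borel) (\<lambda>i. \<Lambda> (A i)) {..<n}"
    using basis unfolding levy_basis_of_def by (elim conjE)
  then show ?thesis using assms by simp
qed

lemma basis_sums:
  fixes A :: "nat \<Rightarrow> real set"
  assumes "\<And>i. A i \<in> sets borel" "disjoint_family A" "bounded (\<Union>i. A i)"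
  shows "AE \<omega> in M. (\<lambda>i. \<Lambda> (A i) \<omega>) sums \<Lambda> (\<Union>i. A i) \<omega>"
proof -
  have "bounded (A i)" for i using assms(3) by (rule bounded_subset) auto
  moreover have "\<forall>A::nat \<Rightarrow> real set. (\<forall>i. A i \<in> sets borel \<and> bounded (A i)) \<and> disjoint_family A \<and>
      bounded (\<Union>i. A i) \<longrightarrow> (AE \<omega> in M. (\<lambda>i. \<Lambda> (A i) \<omega>) sums \<Lambda> (\<Union>i. A i) \<omega>)"
    using basis unfolding levy_basis_of_def by (elim conjE)
  ultimately show ?thesis using assms by simp
qed

text \<open>Countable additivity for the constantly empty sequence: a constant series converges only
  if its terms are 0.\<close>

lemma basis_empty: "AE \<omega> in M. \<Lambda> {} \<omega> = 0"
proof -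
  have "AE \<omega> in M. (\<lambda>i::nat. \<Lambda> {} \<omega>) sums \<Lambda> (\<Union>i::nat. {}) \<omega>"
    by (rule basis_sums) (auto simp: disjoint_family_on_def)
  then show ?thesis
    by eventually_elim (auto dest!: sums_summable simp: summable_const_iff)
qed

lemma basis_Un:
  assumes "A \<in> sets borel" "B \<in> sets borel" "bounded A" "bounded B" "A \<inter> B = {}"
  shows "AE \<omega> in M. \<Lambda> (A \<union> B) \<omega> = \<Lambda> A \<omega> + \<Lambda> B \<omega>"
proof -
  let ?A = "\<lambda>i::nat. if i = 0 then A else if i = 1 then B else {}"
  have eq: "(\<Union>i. ?A i) = A \<union> B"
  proof (intro equalityI subsetI)
    fix x assume "x \<in> A \<union> B"
    then show "x \<in> (\<Union>i. ?A i)"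
      by (elim UnE) (rule UN_I[of 0], simp, simp, rule UN_I[of 1], simp, simp)
  qed (auto split: if_splits)
  have "AE \<omega> in M. (\<lambda>i. \<Lambda> (?A i) \<omega>) sums \<Lambda> (\<Union>i. ?A i) \<omega>"
    by (rule basis_sums) (use assms eq in \<open>auto simp: disjoint_family_on_def\<close>)
  then show ?thesis
    using basis_empty
  proof eventually_elim
    case (elim \<omega>)
    have "(\<lambda>i. \<Lambda> (?A i) \<omega>) sums (\<Sum>i\<in>{0, 1}. \<Lambda> (?A i) \<omega>)"
      using elim(2) by (intro sums_finite) auto
    then have "(\<Sum>i\<in>{0, 1}. \<Lambda> (?A i) \<omega>) = \<Lambda> (\<Union>i. ?A i) \<omega>"
      using elim(1) by (rule sums_unique2)
    then show ?case unfolding eq by simp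
  qed
qed

lemma char_basis_Un:
  assumes "A \<in> sets borel" "B \<in> sets borel" "bounded A" "bounded B" "A \<inter> B = {}"
  shows "char (distr M borel (\<Lambda> (A \<union> B))) u = char (distr M borel (\<Lambda> A)) u * char (distr M borel (\<Lambda> B)) u"
proof -
  let ?A = "\<lambda>i::nat. if i = 0 then A else B"
  have "indep_vars (\<lambda>_. borel) (\<lambda>i. \<Lambda> (?A i)) {..<2}"
    by (rule basis_indep) (use assms in \<open>auto simp: disjoint_family_on_def less_2_cases_iff\<close>)
  from char_distr_sum[OF this, of u]
  have "char (distr M borel (\<lambda>\<omega>. \<Lambda> A \<omega> + \<Lambda> B \<omega>)) u = char (distr M borel (\<Lambda> A)) u * char (distr M borel (\<Lambda> B)) u"
    by (simp add: numeral_2_eq_2 lessThan_Suc mult.commute[of "char (distr M borel (\<Lambda> A)) u"]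
        add.commute[of "\<Lambda> A _"])
  moreover have "distr M borel (\<Lambda> (A \<union> B)) = distr M borel (\<lambda>\<omega>. \<Lambda> A \<omega> + \<Lambda> B \<omega>)"
    using basis_Un[OF assms] assms by (intro distr_cong_AE) auto
  ultimately show ?thesis by simp
qed

text \<open>For intervals this is the law of an increment of \<open>Z\<close>. Relative complements
  follow by division, since exponentials never vanish, and disjoint unions by independence and
  almost sure convergence of the series.\<close>

lemma char_basis:
  assumes "A \<in> sets borel" "bounded A"
  shows "char (distr M borel (\<Lambda> A)) u = exp (of_real (measure lborel A) * \<kappa> u)"
  using assms
proof (induction rule: bounded_borel_induct)
  case (interval a b)
  have "distr M borel (\<Lambda> {a<..b}) = distr M borel (\<lambda>\<omega>. Z b \<omega> - Z a \<omega>)"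
    by (intro distr_cong_AE basis_interval interval) auto
  then show ?case using interval by (simp add: char_increment)
next
  case (compl A a b)
  have bd: "bounded A" "bounded {a<..b}" "bounded ({a<..b} - A)"
    using compl(3) by (auto intro!: bounded_subset[OF bounded_closed_interval[of a b]] dest!: subsetD)
  have "measure lborel {a<..b} = measure lborel A + measure lborel ({a<..b} - A)"
  proof -
    have "measure lborel (A \<union> ({a<..b} - A)) = measure lborel A + measure lborel ({a<..b} - A)"
      using compl emeasure_bounded_finite[OF bd(1)] emeasure_bounded_finite[OF bd(3)]
      by (intro measure_Union) auto
    moreover have "A \<union> ({a<..b} - A) = {a<..b}" using compl(3) by auto
    ultimately show ?thesis by simp
  qed
  moreover have "A \<union> ({a<..b} - A) = {a<..b}" using compl by auto
  then have "char (distr M borel (\<Lambda> {a<..b})) u = char (distr M borel (\<Lambda> A)) u * char (distr M borel (\<Lambda> ({a<..b} - A))) u"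
    using char_basis_Un[of A "{a<..b} - A" u] compl bd by simp
  moreover have "distr M borel (\<Lambda> {a<..b}) = distr M borel (\<lambda>\<omega>. Z b \<omega> - Z a \<omega>)"
    by (intro distr_cong_AE basis_interval compl) auto
  ultimately show ?case
    using compl by (simp add: char_increment of_real_add distrib_right exp_add)
next
  case (union A)
  have bd: "bounded (\<Union>i\<in>I. A i)" for I using union(3) by (rule bounded_subset) auto
  have bd': "bounded (A i)" for i using bd[of "{i}"] by simp
  have [measurable]: "A i \<in> sets borel" for i using union by simp
  have fin: "emeasure lborel (\<Union>i\<in>I. A i) \<noteq> \<infinity>" for I
    using emeasure_bounded_finite[OF bd] by (simp add: less_top)
  have "AE \<omega> in M. (\<lambda>n. \<Sum>i<n. \<Lambda> (A i) \<omega>) \<longlonglongrightarrow> \<Lambda> (\<Union>i. A i) \<omega>"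
    using basis_sums[OF union(1-3)] by (simp add: sums_def)
  then have "(\<lambda>n. char (distr M borel (\<lambda>\<omega>. \<Sum>i<n. \<Lambda> (A i) \<omega>)) u) \<longlonglongrightarrow> char (distr M borel (\<Lambda> (\<Union>i. A i))) u"
    by (rule tendsto_char_AE[rotated 2]) (use union bd' in auto)
  moreover have "char (distr M borel (\<lambda>\<omega>. \<Sum>i<n. \<Lambda> (A i) \<omega>)) u = exp ((\<Sum>i<n. of_real (measure lborel (A i))) * \<kappa> u)" for n
    using union bd'
    by (subst char_distr_sum[OF basis_indep]) (auto simp: disjoint_family_on_def exp_sum sum_distrib_right)
  moreover have "(\<lambda>n. exp ((\<Sum>i<n. of_real (measure lborel (A i))) * \<kappa> u)) \<longlonglongrightarrow> exp (of_real (measure lborel (\<Union>i. A i)) * \<kappa> u)"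
  proof (intro tendsto_intros)
    have "(\<lambda>i. measure lborel (A i)) sums measure lborel (\<Union>i. A i)"
      using union fin[of UNIV] by (intro measure_UNION) auto
    then show "(\<lambda>n. \<Sum>i<n. complex_of_real (measure lborel (A i))) \<longlonglongrightarrow> of_real (measure lborel (\<Union>i. A i))"
      unfolding sums_def of_real_sum[symmetric] by (rule tendsto_of_real)
  qed
  ultimately show ?case by (simp add: LIMSEQ_unique)
qed

end

text \<open>Every instance of \<open>lb_integral\<close> hides a basis of its own behind an
  existential quantifier. This makes the integrals for different \<open>t\<close>
  comparable.\<close>

lemma basis_unique:
  assumes "levy_basis_of M Z \<Lambda>" "levy_basis_of M Z \<Lambda>'" "A \<in> sets borel" "bounded A"
  shows "AE \<omega> in M. \<Lambda> A \<omega> = \<Lambda>' A \<omega>"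
  using assms(3,4)
proof (induction rule: bounded_borel_induct)
  case (interval a b)
  show ?case
    using basis_interval[OF assms(1) interval] basis_interval[OF assms(2) interval]
    by eventually_elim simp
next
  case (compl A a b)
  have bd: "bounded A" "bounded ({a<..b} - A)"
    using compl(3) by (auto intro!: bounded_subset[OF bounded_closed_interval[of a b]] dest!: subsetD)
  have eq: "A \<union> ({a<..b} - A) = {a<..b}" using compl by auto
  have "AE \<omega> in M. \<Lambda> {a<..b} \<omega> = \<Lambda> A \<omega> + \<Lambda> ({a<..b} - A) \<omega>"
    using basis_Un[OF assms(1), of A "{a<..b} - A"] compl bd unfolding eq by simp
  moreover have "AE \<omega> in M. \<Lambda>' {a<..b} \<omega> = \<Lambda>' A \<omega> + \<Lambda>' ({a<..b} - A) \<omega>"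
    using basis_Un[OF assms(2), of A "{a<..b} - A"] compl bd unfolding eq by simp
  ultimately show ?case
    using compl(4) basis_interval[OF assms(1) compl(2)] basis_interval[OF assms(2) compl(2)]
    by eventually_elim simp
next
  case (union A)
  have "AE \<omega> in M. \<forall>i. \<Lambda> (A i) \<omega> = \<Lambda>' (A i) \<omega>"
    using union by (simp add: AE_all_countable)
  then show ?case
    using basis_sums[OF assms(1) union(1-3)] basis_sums[OF assms(2) union(1-3)]
    by eventually_elim (auto intro: sums_unique2)
qed

end

section \<open>Integrals of simple functions\<close>

text \<open>A list of pairs \<open>(c, B)\<close> represents the simple function \<open>\<Sum> c * indicator B\<close>; the sets may overlap.\<close>

definition simple_fun :: "(real \<times> real set) list \<Rightarrow> real \<Rightarrow> real" where
  "simple_fun xs s = (\<Sum>(c, B)\<leftarrow>xs. c * indicator B s)"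

definition simple_int :: "(real set \<Rightarrow> 'a \<Rightarrow> real) \<Rightarrow> (real \<times> real set) list \<Rightarrow> 'a \<Rightarrow> real" where
  "simple_int \<Lambda> xs \<omega> = (\<Sum>(c, B)\<leftarrow>xs. c * \<Lambda> B \<omega>)"

definition bounded_borel :: "real set \<Rightarrow> bool" where
  "bounded_borel B \<longleftrightarrow> B \<in> sets borel \<and> bounded B"

definition valid_rep :: "(real \<times> real set) list \<Rightarrow> bool" where
  "valid_rep xs \<longleftrightarrow> (\<forall>x\<in>set xs. bounded_borel (snd x))"

definition smult_rep :: "real \<Rightarrow> (real \<times> real set) list \<Rightarrow> (real \<times> real set) list" where
  "smult_rep a xs = map (\<lambda>(c, B). (a * c, B)) xs"

definition restrict_rep :: "real set \<Rightarrow> (real \<times> real set) list \<Rightarrow> (real \<times> real set) list" where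
  "restrict_rep A xs = map (\<lambda>(c, B). (c, A \<inter> B)) xs"

lemma bounded_borel_ops [simp]:
  "bounded_borel {}"
  "bounded_borel A \<Longrightarrow> B \<in> sets borel \<Longrightarrow> bounded_borel (A - B)"
  "bounded_borel A \<Longrightarrow> B \<in> sets borel \<Longrightarrow> bounded_borel (A \<inter> B)"
  "bounded_borel A \<Longrightarrow> B \<in> sets borel \<Longrightarrow> bounded_borel (B \<inter> A)"
  "bounded_borel A \<Longrightarrow> bounded_borel B \<Longrightarrow> bounded_borel (A \<union> B)"
  by (auto simp: bounded_borel_def intro: bounded_subset)

lemma bounded_borelD: "bounded_borel A \<Longrightarrow> A \<in> sets borel" "bounded_borel A \<Longrightarrow> bounded A"
  by (auto simp: bounded_borel_def)

lemma simple_fun_simps [simp]: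
  "simple_fun [] s = 0"
  "simple_fun (x # xs) s = fst x * indicator (snd x) s + simple_fun xs s"
  "simple_fun (xs @ ys) s = simple_fun xs s + simple_fun ys s"
  by (auto simp: simple_fun_def split_beta)

lemma simple_int_simps [simp]:
  "simple_int \<Lambda> [] \<omega> = 0"
  "simple_int \<Lambda> (x # xs) \<omega> = fst x * \<Lambda> (snd x) \<omega> + simple_int \<Lambda> xs \<omega>"
  "simple_int \<Lambda> (xs @ ys) \<omega> = simple_int \<Lambda> xs \<omega> + simple_int \<Lambda> ys \<omega>"
  by (auto simp: simple_int_def split_beta)

lemma valid_rep_simps [simp]:
  "valid_rep []"
  "valid_rep (x # xs) \<longleftrightarrow> bounded_borel (snd x) \<and> valid_rep xs"
  "valid_rep (xs @ ys) \<longleftrightarrow> valid_rep xs \<and> valid_rep ys"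
  by (auto simp: valid_rep_def)

lemma smult_rep_simps [simp]:
  "simple_fun (smult_rep a xs) s = a * simple_fun xs s"
  "simple_int \<Lambda> (smult_rep a xs) \<omega> = a * simple_int \<Lambda> xs \<omega>"
  "valid_rep xs \<Longrightarrow> valid_rep (smult_rep a xs)"
  by (induction xs) (auto simp: smult_rep_def algebra_simps)

lemma restrict_rep_simps [simp]:
  "simple_fun (restrict_rep A xs) s = indicator A s * simple_fun xs s"
  "valid_rep xs \<Longrightarrow> A \<in> sets borel \<Longrightarrow> valid_rep (restrict_rep A xs)"
  by (induction xs) (auto simp: restrict_rep_def algebra_simps indicator_inter_arith)

lemma restrict_rep_append: "restrict_rep A (xs @ ys) = restrict_rep A xs @ restrict_rep A ys"
  by (simp add: restrict_rep_def)

lemma restrict_rep_smult: "restrict_rep A (smult_rep a xs) = smult_rep a (restrict_rep A xs)"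
  by (simp add: restrict_rep_def smult_rep_def split_beta)

lemma restrict_rep_UNIV [simp]: "restrict_rep UNIV xs = xs"
  by (induction xs) (auto simp: restrict_rep_def)

lemma simple_fun_measurable [measurable]: "valid_rep xs \<Longrightarrow> simple_fun xs \<in> borel_measurable borel"
proof (induction xs)
  case (Cons x xs)
  then have [measurable]: "snd x \<in> sets borel" "simple_fun xs \<in> borel_measurable borel"
    by (auto simp: bounded_borel_def)
  have "simple_fun (x # xs) = (\<lambda>s. fst x * indicator (snd x) s + simple_fun xs s)" by auto
  then show ?case by simp
qed (simp add: simple_fun_def[abs_def])

lemma simple_fun_bound:
  assumes "valid_rep xs"
  obtains C b where "0 \<le> C" "\<And>s. \<bar>simple_fun xs s\<bar> \<le> C * indicator {-b..b} s"
proof -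
  have "\<exists>C b. 0 \<le> C \<and> (\<forall>s. \<bar>simple_fun xs s\<bar> \<le> C * indicator {-b..b} s)"
    using assms
  proof (induction xs)
    case (Cons x xs)
    then obtain C b where C: "0 \<le> C" "\<And>s. \<bar>simple_fun xs s\<bar> \<le> C * indicator {-b..b} s"
      by auto
    obtain b' where b': "\<And>s. s \<in> snd x \<Longrightarrow> \<bar>s\<bar> \<le> b'"
      using Cons.prems by (auto simp: bounded_borel_def bounded_iff)
    have "\<bar>simple_fun (x # xs) s\<bar> \<le> (\<bar>fst x\<bar> + C) * indicator {- max b b'..max b b'} s" for s
    proof -
      have "\<bar>simple_fun (x # xs) s\<bar> \<le> \<bar>fst x * indicator (snd x) s\<bar> + \<bar>simple_fun xs s\<bar>"
        by (simp add: abs_triangle_ineq)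
      also have "\<dots> \<le> \<bar>fst x\<bar> * indicator {- max b b'..max b b'} s + C * indicator {- max b b'..max b b'} s"
      proof (rule add_mono)
        show "\<bar>fst x * indicator (snd x) s\<bar> \<le> \<bar>fst x\<bar> * indicator {- max b b'..max b b'} s"
          using b'[of s] by (auto simp: indicator_def abs_le_iff)
        have "C * indicator {-b..b} s \<le> C * indicator {- max b b'..max b b'} s"
          using C(1) by (intro mult_left_mono) (auto simp: indicator_def)
        then show "\<bar>simple_fun xs s\<bar> \<le> C * indicator {- max b b'..max b b'} s"
          using C(2)[of s] by linarith
      qed
      finally show ?thesis by (simp add: distrib_right)
    qed
    then show ?case using C(1) by (intro exI[of _ "\<bar>fst x\<bar> + C"] exI[of _ "max b b'"]) auto
  qed auto
  then show ?thesis using that by blast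
qed

text \<open>Independence of \<open>\<Lambda>\<close> is available on disjoint sets, so overlapping
  sets have to be cut into cells before the law of a simple integral can be computed.\<close>

fun disjoint_rep :: "(real \<times> real set) list \<Rightarrow> (real \<times> real set) list" where
  "disjoint_rep [] = []"
| "disjoint_rep (x # xs) = (let ys = disjoint_rep xs in
    map (\<lambda>y. (fst y + fst x, snd y \<inter> snd x)) ys @ map (\<lambda>y. (fst y, snd y - snd x)) ys @
    [(fst x, snd x - \<Union>(snd ` set ys))])"

abbreviation "disjnt_list \<equiv> sorted_wrt (\<lambda>x y. snd x \<inter> snd y = {})"

lemma disjnt_list_disjoint_rep: "disjnt_list (disjoint_rep xs)"
  by (induction xs) (auto simp: Let_def sorted_wrt_append sorted_wrt_map intro: sorted_wrt_mono_rel[rotated])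

lemma valid_disjoint_rep: "valid_rep xs \<Longrightarrow> valid_rep (disjoint_rep xs)"
proof (induction xs)
  case (Cons x xs)
  then have ys: "valid_rep (disjoint_rep xs)" "bounded_borel (snd x)" by auto
  then have "\<Union>(snd ` set (disjoint_rep xs)) \<in> sets borel"
    by (intro sets.finite_Union) (auto simp: valid_rep_def bounded_borel_def)
  then show ?case
    using ys by (auto simp: Let_def valid_rep_def bounded_borelD)
qed auto

lemma additive_split:
  assumes add: "\<And>A B. bounded_borel A \<Longrightarrow> bounded_borel B \<Longrightarrow> A \<inter> B = {} \<Longrightarrow>
      AE x in N. F (A \<union> B) x = F A x + (F B x :: real)"
    and "disjnt_list ys" "valid_rep ys" "bounded_borel B"
  shows "AE x in N. F B x = (\<Sum>y\<leftarrow>ys. F (snd y \<inter> B) x) + F (B - \<Union>(snd ` set ys)) x"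
  using assms(2-)
proof (induction ys arbitrary: B)
  case (Cons y ys)
  have [simp]: "snd y \<in> sets borel" "B \<in> sets borel" using Cons.prems by (auto simp: bounded_borelD)
  have "(snd y \<inter> B) \<union> (B - snd y) = B" by auto
  then have 1: "AE x in N. F B x = F (snd y \<inter> B) x + F (B - snd y) x"
    using add[of "snd y \<inter> B" "B - snd y"] Cons.prems by (auto simp: Int_commute)
  have 2: "AE x in N. F (B - snd y) x = (\<Sum>z\<leftarrow>ys. F (snd z \<inter> (B - snd y)) x) + F (B - snd y - \<Union>(snd ` set ys)) x"
    by (rule Cons.IH) (use Cons.prems in auto)
  have 3: "(\<Sum>z\<leftarrow>ys. F (snd z \<inter> (B - snd y)) x) = (\<Sum>z\<leftarrow>ys. F (snd z \<inter> B) x)" for x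
  proof -
    have "snd z \<inter> (B - snd y) = snd z \<inter> B" if "z \<in> set ys" for z using Cons.prems that by auto
    then show ?thesis by (simp cong: map_cong)
  qed
  have 4: "B - snd y - \<Union>(snd ` set ys) = B - \<Union>(snd ` set (y # ys))" by auto
  show ?case using 1 2 unfolding 3 4 by eventually_elim simp
qed auto

text \<open>Additivity up to null sets of an arbitrary measure \<open>N\<close> covers two uses:
  with \<open>\<Lambda>\<close> over \<open>M\<close> the refinement preserves the integral almost
  surely, and with \<open>indicator\<close> over a counting measure it preserves the function at
  every point.\<close>

lemma additive_disjoint_rep:
  assumes add: "\<And>A B. bounded_borel A \<Longrightarrow> bounded_borel B \<Longrightarrow> A \<inter> B = {} \<Longrightarrow>
      AE x in N. F (A \<union> B) x = F A x + (F B x :: real)"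
    and "valid_rep xs"
  shows "AE x in N. simple_int F (disjoint_rep xs) x = simple_int F xs x"
  using assms(2)
proof (induction xs)
  case (Cons x xs)
  define ys where "ys = disjoint_rep xs"
  have ys: "disjnt_list ys" "valid_rep ys"
    using Cons.prems by (auto simp: ys_def disjnt_list_disjoint_rep valid_disjoint_rep)
  have x: "bounded_borel (snd x)" using Cons.prems by simp
  have 1: "AE \<omega> in N. F (snd x) \<omega> = (\<Sum>y\<leftarrow>ys. F (snd y \<inter> snd x) \<omega>) + F (snd x - \<Union>(snd ` set ys)) \<omega>"
    by (rule additive_split[OF add ys x])
  \<comment> \<open>Every cell is split along \<open>snd x\<close>; the amount \<open>a\<close>
    added to the coefficients of the inner parts collects the contribution of \<open>x\<close> on
    the existing cells.\<close>
  have "AE \<omega> in N. simple_int F (map (\<lambda>y. (fst y + a, snd y \<inter> snd x)) zs) \<omega>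
      + simple_int F (map (\<lambda>y. (fst y, snd y - snd x)) zs) \<omega>
      = simple_int F zs \<omega> + a * (\<Sum>y\<leftarrow>zs. F (snd y \<inter> snd x) \<omega>)" if "valid_rep zs" for a zs
    using that
  proof (induction zs)
    case (Cons z zs)
    then have [simp]: "snd z \<in> sets borel" "snd x \<in> sets borel" using x by (auto simp: bounded_borelD)
    have "(snd z \<inter> snd x) \<union> (snd z - snd x) = snd z" by auto
    then have "AE \<omega> in N. F (snd z) \<omega> = F (snd z \<inter> snd x) \<omega> + F (snd z - snd x) \<omega>"
      using add[of "snd z \<inter> snd x" "snd z - snd x"] Cons.prems by auto
    moreover have "AE \<omega> in N. simple_int F (map (\<lambda>y. (fst y + a, snd y \<inter> snd x)) zs) \<omega>
      + simple_int F (map (\<lambda>y. (fst y, snd y - snd x)) zs) \<omega>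
      = simple_int F zs \<omega> + a * (\<Sum>y\<leftarrow>zs. F (snd y \<inter> snd x) \<omega>)"
      using Cons by simp
    ultimately show ?case by eventually_elim (simp add: algebra_simps)
  qed simp
  from this[OF ys(2), of "fst x"] have 2: "AE \<omega> in N. simple_int F (map (\<lambda>y. (fst y + fst x, snd y \<inter> snd x)) ys) \<omega>
      + simple_int F (map (\<lambda>y. (fst y, snd y - snd x)) ys) \<omega>
      = simple_int F ys \<omega> + fst x * (\<Sum>y\<leftarrow>ys. F (snd y \<inter> snd x) \<omega>)" .
  have "AE \<omega> in N. simple_int F ys \<omega> = simple_int F xs \<omega>"
    using Cons by (simp add: ys_def)
  then show ?case
    using 1 2
  proof eventually_elim
    case (elim \<omega>)
    have "simple_int F (disjoint_rep (x # xs)) \<omega>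
      = (simple_int F (map (\<lambda>y. (fst y + fst x, snd y \<inter> snd x)) ys) \<omega>
        + simple_int F (map (\<lambda>y. (fst y, snd y - snd x)) ys) \<omega>) + fst x * F (snd x - \<Union>(snd ` set ys)) \<omega>"
      unfolding disjoint_rep.simps Let_def ys_def by simp
    also have "\<dots> = simple_int F xs \<omega> + fst x * F (snd x) \<omega>"
      unfolding elim by (simp add: distrib_left)
    finally show ?case by simp
  qed
qed simp

lemma simple_fun_disjoint_rep: "valid_rep xs \<Longrightarrow> simple_fun (disjoint_rep xs) s = simple_fun xs s"
proof -
  assume "valid_rep xs"
  \<comment> \<open>For a counting measure, almost everywhere means everywhere.\<close>
  then have "AE s in count_space UNIV. simple_int indicator (disjoint_rep xs) s = simple_int indicator xs s"
    by (rule additive_disjoint_rep[rotated]) (auto simp: AE_count_space indicator_def)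
  then show ?thesis by (simp add: AE_count_space simple_fun_def simple_int_def)
qed

section \<open>The exponent along simple functions and the law of simple integrals\<close>

context levy_basis begin

lemma exponent_measurable [measurable]: "\<kappa> \<in> borel_measurable borel"
  by (intro borel_measurable_continuous_onI continuous_on_exponent)

lemma exponent_bounded: obtains D where "0 \<le> D" "\<And>x. \<bar>x\<bar> \<le> C \<Longrightarrow> norm (\<kappa> x) \<le> D"
proof -
  have "compact (\<kappa> ` {- C..C})"
    by (intro compact_continuous_image continuous_on_subset[OF continuous_on_exponent]) auto
  then have "bounded (\<kappa> ` {- C..C})" by (rule compact_imp_bounded)
  then obtain D where D: "\<forall>z\<in>\<kappa> ` {- C..C}. norm z \<le> D"
    unfolding bounded_iff ..
  show ?thesis
  proof (rule that[of "max D 0"])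
    show "norm (\<kappa> x) \<le> max D 0" if "\<bar>x\<bar> \<le> C" for x
      using bspec[OF D imageI, of x] that by (auto simp: abs_le_iff)
  qed simp
qed

text \<open>Since \<open>\<kappa> 0 = 0\<close>, the bound is supported where the simple function
  may be nonzero. Uniformity in \<open>c\<close> makes it a dominating function when
  \<open>c\<close> varies.\<close>

lemma exponent_simple_bound:
  assumes "valid_rep xs"
  obtains D b where "\<And>c s. \<bar>c\<bar> \<le> r \<Longrightarrow> norm (\<kappa> (c * simple_fun xs s)) \<le> D * indicator {-b..b} s"
proof -
  obtain C b where C: "0 \<le> C" "\<And>s. \<bar>simple_fun xs s\<bar> \<le> C * indicator {-b..b} s"
    using simple_fun_bound[OF assms] by blast
  obtain D where D: "0 \<le> D" "\<And>x. \<bar>x\<bar> \<le> r * C \<Longrightarrow> norm (\<kappa> x) \<le> D"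
    using exponent_bounded[of "r * C"] by blast
  show ?thesis
  proof (rule that[of D b])
    fix c s assume c: "\<bar>c\<bar> \<le> r"
    show "norm (\<kappa> (c * simple_fun xs s)) \<le> D * indicator {-b..b} s"
    proof (cases "s \<in> {-b..b}")
      case True
      have "\<bar>c * simple_fun xs s\<bar> \<le> r * C"
        unfolding abs_mult using c C(1) C(2)[of s] True by (intro mult_mono) auto
      then show ?thesis using D True by simp
    next
      case False
      then have "simple_fun xs s = 0" using C(2)[of s] by simp
      then show ?thesis using False by simp
    qed
  qed
qed

lemma integrable_exponent_simple:
  assumes "valid_rep xs"
  shows "integrable lborel (\<lambda>s. \<kappa> (u * simple_fun xs s))"
proof -
  obtain D b where D: "\<And>c s. \<bar>c\<bar> \<le> \<bar>u\<bar> \<Longrightarrow> norm (\<kappa> (c * simple_fun xs s)) \<le> D * indicator {-b..b} s"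
    using exponent_simple_bound[OF assms, of "\<bar>u\<bar>"] by blast
  note [measurable] = simple_fun_measurable[OF assms]
  show ?thesis
  proof (rule Bochner_Integration.integrable_bound)
    show "integrable lborel (\<lambda>s. D * indicator {-b..b} s)"
      by (intro integrable_mult_right integrable_real_indicator) (auto simp: emeasure_lborel_Icc_eq)
    show "AE s in lborel. norm (\<kappa> (u * simple_fun xs s)) \<le> norm (D * indicator {-b..b} s)"
      using D[of u] by (intro AE_I2) (simp add: order_trans[OF _ abs_ge_self])
  qed simp
qed

text \<open>Scaling by \<open>c\<close> joins 0 to \<open>u\<close>; this is the path along which
  logarithms of characteristic functions will be followed.\<close>

lemma continuous_on_integral_exponent_simple:
  assumes "valid_rep xs"
  shows "continuous_on {0..1} (\<lambda>c. CLBINT s. \<kappa> (c * u * simple_fun xs s))"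
proof -
  obtain D b where D: "\<And>c s. \<bar>c\<bar> \<le> \<bar>u\<bar> \<Longrightarrow> norm (\<kappa> (c * simple_fun xs s)) \<le> D * indicator {-b..b} s"
    using exponent_simple_bound[OF assms, of "\<bar>u\<bar>"] by blast
  note [measurable] = simple_fun_measurable[OF assms]
  show ?thesis
    unfolding continuous_on_sequentially
  proof (intro allI impI ballI, elim conjE)
    fix x :: "nat \<Rightarrow> real" and a assume x: "a \<in> {0..1}" "\<forall>n. x n \<in> {0..1}" "x \<longlonglongrightarrow> a"
    show "((\<lambda>c. CLBINT s. \<kappa> (c * u * simple_fun xs s)) \<circ> x) \<longlonglongrightarrow> (CLBINT s. \<kappa> (a * u * simple_fun xs s))"
      unfolding comp_def
    proof (rule integral_dominated_convergence[where w = "\<lambda>s. D * indicator {-b..b} s"])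
      show "AE s in lborel. (\<lambda>n. \<kappa> (x n * u * simple_fun xs s)) \<longlonglongrightarrow> \<kappa> (a * u * simple_fun xs s)"
        by (intro AE_I2 continuous_on_tendsto_compose[OF continuous_on_exponent] tendsto_intros x UNIV_I) simp
      show "AE s in lborel. norm (\<kappa> (x n * u * simple_fun xs s)) \<le> D * indicator {- b..b} s" for n
      proof (intro AE_I2 D)
        have "\<bar>x n\<bar> \<le> 1" using x(2) by (simp add: abs_le_iff)
        then show "\<bar>x n * u\<bar> \<le> \<bar>u\<bar>" by (simp add: abs_mult mult_left_le_one_le)
      qed
    qed (auto intro!: integrable_real_indicator simp: emeasure_lborel_Icc_eq)
  qed
qed

context
  fixes \<Lambda> assumes basis: "levy_basis_of M Z \<Lambda>"
begin

lemma simple_int_measurable [measurable]: "valid_rep xs \<Longrightarrow> simple_int \<Lambda> xs \<in> borel_measurable M"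
proof (induction xs)
  case (Cons x xs)
  then have [measurable]: "\<Lambda> (snd x) \<in> borel_measurable M" "simple_int \<Lambda> xs \<in> borel_measurable M"
    using basis_measurable[OF basis] by (auto simp: bounded_borel_def)
  have "simple_int \<Lambda> (x # xs) = (\<lambda>\<omega>. fst x * \<Lambda> (snd x) \<omega> + simple_int \<Lambda> xs \<omega>)" by auto
  then show ?case by simp
qed (simp add: simple_int_def[abs_def])

lemma integral_exponent_disjnt:
  assumes "disjnt_list xs" "valid_rep xs"
  shows "(CLBINT s. \<kappa> (u * simple_fun xs s)) = (\<Sum>x\<leftarrow>xs. of_real (measure lborel (snd x)) * \<kappa> (u * fst x))"
  using assms
proof (induction xs)
  case (Cons x xs)
  have x: "snd x \<in> sets borel" "bounded (snd x)" using Cons.prems by (auto simp: bounded_borelD)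
  have "simple_fun xs s = 0" if "s \<in> snd x" for s
  proof -
    have "\<forall>y\<in>set xs. s \<notin> snd y" using Cons.prems(1) that by auto
    then show ?thesis by (induction xs) auto
  qed
  then have eq: "\<kappa> (u * simple_fun (x # xs) s) = indicator (snd x) s *\<^sub>R \<kappa> (u * fst x) + \<kappa> (u * simple_fun xs s)" for s
    by (auto simp: indicator_def)
  have fin: "emeasure lborel (snd x) < \<infinity>" using emeasure_bounded_finite[OF x(2)] .
  have "(CLBINT s. \<kappa> (u * simple_fun (x # xs) s))
    = (CLBINT s. indicator (snd x) s *\<^sub>R \<kappa> (u * fst x)) + (CLBINT s. \<kappa> (u * simple_fun xs s))"
    unfolding eq
    using x fin Cons.prems by (intro Bochner_Integration.integral_add integrable_exponent_simple integrable_indicator) auto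
  also have "(CLBINT s. indicator (snd x) s *\<^sub>R \<kappa> (u * fst x)) = measure lborel (snd x) *\<^sub>R \<kappa> (u * fst x)"
    using x fin by (subst integral_scaleR_left) (auto intro!: integrable_real_indicator)
  finally show ?case using Cons by (simp add: scaleR_conv_of_real)
qed simp

text \<open>Over disjoint cells the integral becomes a sum of independent multiples of values of
  \<open>\<Lambda>\<close>, and the product of their characteristic functions is the exponential of
  the integral of a step function.\<close>

lemma char_simple_int:
  assumes "valid_rep xs"
  shows "char (distr M borel (simple_int \<Lambda> xs)) u = exp (CLBINT s. \<kappa> (u * simple_fun xs s))"
proof -
  define ys where "ys = disjoint_rep xs"
  have ys: "disjnt_list ys" "valid_rep ys"
    using assms by (auto simp: ys_def disjnt_list_disjoint_rep valid_disjoint_rep)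
  let ?n = "length ys" let ?c = "\<lambda>i. fst (ys ! i)" let ?A = "\<lambda>i. snd (ys ! i)"
  have A: "?A i \<in> sets borel" "bounded (?A i)" if "i < ?n" for i
    using ys(2) that by (auto simp: valid_rep_def bounded_borel_def)
  have "AE \<omega> in M. simple_int \<Lambda> ys \<omega> = simple_int \<Lambda> xs \<omega>"
    unfolding ys_def
    by (rule additive_disjoint_rep[OF _ assms]) (auto simp: bounded_borel_def intro: basis_Un[OF basis])
  then have "distr M borel (simple_int \<Lambda> xs) = distr M borel (simple_int \<Lambda> ys)"
    using assms ys by (intro distr_cong_AE) auto
  also have "simple_int \<Lambda> ys = (\<lambda>\<omega>. \<Sum>i<?n. ?c i * \<Lambda> (?A i) \<omega>)"
    by (auto simp: simple_int_def sum_list_sum_nth split_beta atLeast0LessThan)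
  also have "char (distr M borel \<dots>) u = (\<Prod>i<?n. char (distr M borel (\<lambda>\<omega>. ?c i * \<Lambda> (?A i) \<omega>)) u)"
  proof (rule char_distr_sum)
    have "indep_vars (\<lambda>_. borel) (\<lambda>i. \<Lambda> (?A i)) {..<?n}"
    proof (rule basis_indep[OF basis])
      show "disjoint_family_on ?A {..<?n}"
        unfolding disjoint_family_on_def
      proof (intro ballI impI)
        fix i j assume "i \<in> {..<?n}" "j \<in> {..<?n}" "i \<noteq> j"
        then show "?A i \<inter> ?A j = {}"
          using sorted_wrt_nth_less[OF ys(1), of i j] sorted_wrt_nth_less[OF ys(1), of j i]
          by (cases i j rule: linorder_cases) auto
      qed
    qed (use A in auto)
    then show "indep_vars (\<lambda>_. borel) (\<lambda>i \<omega>. ?c i * \<Lambda> (?A i) \<omega>) {..<?n}"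
      by (rule indep_vars_compose2) auto
  qed
  also have "\<dots> = (\<Prod>i<?n. exp (of_real (measure lborel (?A i)) * \<kappa> (u * ?c i)))"
  proof (intro prod.cong refl)
    fix i assume "i \<in> {..<?n}"
    then have A': "?A i \<in> sets borel" "bounded (?A i)" using A by auto
    note [measurable] = basis_measurable[OF basis A']
    have "char (distr M borel (\<lambda>\<omega>. ?c i * \<Lambda> (?A i) \<omega>)) u = char (distr M borel (\<Lambda> (?A i))) (u * ?c i)"
      by (simp add: char_distr mult_ac)
    then show "char (distr M borel (\<lambda>\<omega>. ?c i * \<Lambda> (?A i) \<omega>)) u = exp (of_real (measure lborel (?A i)) * \<kappa> (u * ?c i))"
      by (simp add: char_basis[OF basis A'])
  qed
  also have "\<dots> = exp (\<Sum>i<?n. of_real (measure lborel (?A i)) * \<kappa> (u * ?c i))"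
    by (simp add: exp_sum)
  also have "(\<Sum>i<?n. of_real (measure lborel (?A i)) * \<kappa> (u * ?c i)) = (CLBINT s. \<kappa> (u * simple_fun ys s))"
    unfolding integral_exponent_disjnt[OF ys] by (simp add: sum_list_sum_nth atLeast0LessThan)
  finally show ?thesis using assms by (simp add: ys_def simple_fun_disjoint_rep)
qed

end

end

section \<open>The characteristic function of a stochastic integral\<close>

context prob_space begin

text \<open>The mean of the distance truncated at 1 metrises convergence in probability. In this
  form a triangle inequality holds and characteristic functions are easily compared.\<close>

lemma conv_in_prob_imp_tendsto_expectation:
  assumes [measurable]: "\<And>n. X n \<in> borel_measurable M" "Y \<in> borel_measurable M"
    and conv: "conv_in_prob M X Y"
  shows "(\<lambda>n. expectation (\<lambda>\<omega>. min 1 \<bar>X n \<omega> - Y \<omega>\<bar>)) \<longlonglongrightarrow> 0"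
proof (rule LIMSEQ_I)
  fix r :: real assume r: "0 < r"
  have "(\<lambda>n. prob {\<omega> \<in> space M. r / 2 < \<bar>X n \<omega> - Y \<omega>\<bar>}) \<longlonglongrightarrow> 0"
    using conv r unfolding conv_in_prob_def by (meson half_gt_zero)
  from LIMSEQ_D[OF this, of "r / 2"] r obtain N where
    N: "\<And>n. n \<ge> N \<Longrightarrow> prob {\<omega> \<in> space M. r / 2 < \<bar>X n \<omega> - Y \<omega>\<bar>} < r / 2"
    by auto
  have "expectation (\<lambda>\<omega>. min 1 \<bar>X n \<omega> - Y \<omega>\<bar>) < r" if "n \<ge> N" for n
  proof -
    have "expectation (\<lambda>\<omega>. min 1 \<bar>X n \<omega> - Y \<omega>\<bar>)
      \<le> expectation (\<lambda>\<omega>. r / 2 + indicator {\<omega> \<in> space M. r / 2 < \<bar>X n \<omega> - Y \<omega>\<bar>} \<omega>)"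
    proof (rule integral_mono)
      show "integrable M (\<lambda>\<omega>. min 1 \<bar>X n \<omega> - Y \<omega>\<bar>)"
        by (rule integrable_const_bound[of _ 1]) auto
      show "integrable M (\<lambda>\<omega>. r / 2 + indicator {\<omega> \<in> space M. r / 2 < \<bar>X n \<omega> - Y \<omega>\<bar>} \<omega>)"
        by (intro Bochner_Integration.integrable_add integrable_real_indicator) (auto simp: less_top[symmetric])
      show "min 1 \<bar>X n \<omega> - Y \<omega>\<bar> \<le> r / 2 + indicator {\<omega> \<in> space M. r / 2 < \<bar>X n \<omega> - Y \<omega>\<bar>} \<omega>"
        if "\<omega> \<in> space M" for \<omega>
        using that r by (cases "r / 2 < \<bar>X n \<omega> - Y \<omega>\<bar>") (auto simp: min_def)
    qed
    also have "\<dots> = r / 2 + prob {\<omega> \<in> space M. r / 2 < \<bar>X n \<omega> - Y \<omega>\<bar>}"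
      by (subst Bochner_Integration.integral_add)
        (auto intro!: integrable_real_indicator simp: less_top[symmetric] prob_space Int_def conj_ac cong: conj_cong)
    also have "\<dots> < r" using N[OF that] by simp
    finally show ?thesis .
  qed
  moreover have "0 \<le> expectation (\<lambda>\<omega>. min 1 \<bar>X n \<omega> - Y \<omega>\<bar>)" for n
    by (rule integral_nonneg_AE) auto
  ultimately show "\<exists>no. \<forall>n\<ge>no. norm (expectation (\<lambda>\<omega>. min 1 \<bar>X n \<omega> - Y \<omega>\<bar>) - 0) < r"
    by (intro exI[of _ N]) auto
qed

lemma conv_in_prob_imp_Cauchy_expectation:
  assumes [measurable]: "\<And>n. X n \<in> borel_measurable M" "Y \<in> borel_measurable M"
    and conv: "conv_in_prob M X Y" and "0 < e"
  obtains N where "\<And>n m. n \<ge> N \<Longrightarrow> m \<ge> N \<Longrightarrow> expectation (\<lambda>\<omega>. min 1 \<bar>X n \<omega> - X m \<omega>\<bar>) < e"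
proof -
  obtain N where N: "\<And>n. n \<ge> N \<Longrightarrow> expectation (\<lambda>\<omega>. min 1 \<bar>X n \<omega> - Y \<omega>\<bar>) < e / 2"
    using LIMSEQ_D[OF conv_in_prob_imp_tendsto_expectation[OF assms(1-3)], of "e / 2"] \<open>0 < e\<close> by auto
  have "expectation (\<lambda>\<omega>. min 1 \<bar>X n \<omega> - X m \<omega>\<bar>) < e" if "n \<ge> N" "m \<ge> N" for n m
  proof -
    have int: "integrable M (\<lambda>\<omega>. min 1 \<bar>U \<omega> - V \<omega>\<bar>)"
      if [measurable]: "U \<in> borel_measurable M" "V \<in> borel_measurable M" for U V :: "'a \<Rightarrow> real"
      by (rule integrable_const_bound[of _ 1]) auto
    have "expectation (\<lambda>\<omega>. min 1 \<bar>X n \<omega> - X m \<omega>\<bar>)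
      \<le> expectation (\<lambda>\<omega>. min 1 \<bar>X n \<omega> - Y \<omega>\<bar> + min 1 \<bar>X m \<omega> - Y \<omega>\<bar>)"
      by (intro integral_mono Bochner_Integration.integrable_add int) auto
    also have "\<dots> = expectation (\<lambda>\<omega>. min 1 \<bar>X n \<omega> - Y \<omega>\<bar>) + expectation (\<lambda>\<omega>. min 1 \<bar>X m \<omega> - Y \<omega>\<bar>)"
      by (intro Bochner_Integration.integral_add int) auto
    also have "\<dots> < e" using N[OF that(1)] N[OF that(2)] by simp
    finally show ?thesis .
  qed
  then show ?thesis by (rule that)
qed

text \<open>If the variables differ by at most 1, the Lipschitz constant \<open>r\<close> of the
  exponential applies; otherwise the trivial bound 2 does. The constant depends on \<open>r\<close>
  alone and so serves a whole range of arguments \<open>c\<close>.\<close>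

lemma norm_char_diff_le:
  assumes [measurable]: "X \<in> borel_measurable M" "Y \<in> borel_measurable M" and c: "\<bar>c\<bar> \<le> r"
  shows "norm (char (distr M borel X) c - char (distr M borel Y) c) \<le> (2 + r) * expectation (\<lambda>\<omega>. min 1 \<bar>X \<omega> - Y \<omega>\<bar>)"
proof -
  have int: "integrable M (\<lambda>\<omega>. iexp (c * Z \<omega>))" if [measurable]: "Z \<in> borel_measurable M" for Z
    by (rule integrable_const_bound[of _ 1]) auto
  have "norm (char (distr M borel X) c - char (distr M borel Y) c)
    = norm (CLINT \<omega>|M. iexp (c * X \<omega>) - iexp (c * Y \<omega>))"
    unfolding char_distr[OF assms(1)] char_distr[OF assms(2)]
    by (subst Bochner_Integration.integral_diff[OF int int]) auto
  also have "\<dots> \<le> (LINT \<omega>|M. norm (iexp (c * X \<omega>) - iexp (c * Y \<omega>)))"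
    by (rule integral_norm_bound)
  also have "\<dots> \<le> (LINT \<omega>|M. (2 + r) * min 1 \<bar>X \<omega> - Y \<omega>\<bar>)"
  proof (rule integral_mono)
    show "integrable M (\<lambda>\<omega>. norm (iexp (c * X \<omega>) - iexp (c * Y \<omega>)))"
      by (intro integrable_norm Bochner_Integration.integrable_diff int) auto
    show "integrable M (\<lambda>\<omega>. (2 + r) * min 1 \<bar>X \<omega> - Y \<omega>\<bar>)"
      by (intro integrable_mult_right integrable_const_bound[of _ 1]) auto
    fix \<omega>
    define a where "a = X \<omega>" define b where "b = Y \<omega>"
    have "norm (iexp (c * a) - iexp (c * b)) \<le> norm (iexp (c * a)) + norm (iexp (c * b))"
      by (rule norm_triangle_ineq4)
    then have 1: "norm (iexp (c * a) - iexp (c * b)) \<le> 2" by simp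
    have "iexp (c * a) - iexp (c * b) = iexp (c * b) * (iexp (c * (a - b)) - 1)"
      by (simp add: algebra_simps flip: exp_add)
    then have "norm (iexp (c * a) - iexp (c * b)) = norm (iexp (c * (a - b)) - 1)"
      by (simp add: norm_mult)
    also have "\<dots> \<le> \<bar>c * (a - b)\<bar>"
      using iexp_approx1[of "c * (a - b)" 0] by simp
    also have "\<dots> \<le> r * \<bar>a - b\<bar>"
      unfolding abs_mult using c by (intro mult_right_mono) auto
    finally have 2: "norm (iexp (c * a) - iexp (c * b)) \<le> r * \<bar>a - b\<bar>" .
    have "r \<ge> 0" using c by simp
    have "norm (iexp (c * a) - iexp (c * b)) \<le> (2 + r) * min 1 \<bar>a - b\<bar>"
    proof (cases "\<bar>a - b\<bar> \<le> 1")
      case True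
      then have "norm (iexp (c * a) - iexp (c * b)) \<le> 2 * \<bar>a - b\<bar> + r * \<bar>a - b\<bar>"
        using 2 by (intro order_trans[OF 2]) simp
      then show ?thesis using True by (simp add: min_absorb2 distrib_right)
    next
      case False
      then show ?thesis using 1 \<open>r \<ge> 0\<close> by simp
    qed
    then show "norm (iexp (c * X \<omega>) - iexp (c * Y \<omega>)) \<le> (2 + r) * min 1 \<bar>X \<omega> - Y \<omega>\<bar>"
      by (simp add: a_def b_def)
  qed
  finally show ?thesis by simp
qed

lemma conv_in_prob_add:
  assumes [measurable]: "\<And>n. X n \<in> borel_measurable M" "Y \<in> borel_measurable M"
      "\<And>n. X' n \<in> borel_measurable M" "Y' \<in> borel_measurable M"
    and "conv_in_prob M X Y" "conv_in_prob M X' Y'"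
  shows "conv_in_prob M (\<lambda>n \<omega>. X n \<omega> + X' n \<omega>) (\<lambda>\<omega>. Y \<omega> + Y' \<omega>)"
  unfolding conv_in_prob_def
proof (intro allI impI)
  fix e :: real assume e: "0 < e"
  show "(\<lambda>n. prob {\<omega> \<in> space M. e < \<bar>X n \<omega> + X' n \<omega> - (Y \<omega> + Y' \<omega>)\<bar>}) \<longlonglongrightarrow> 0"
  proof (rule tendsto_sandwich[of "\<lambda>_. 0"])
    have "(\<lambda>n. prob {\<omega> \<in> space M. e / 2 < \<bar>X n \<omega> - Y \<omega>\<bar>} + prob {\<omega> \<in> space M. e / 2 < \<bar>X' n \<omega> - Y' \<omega>\<bar>}) \<longlonglongrightarrow> 0 + 0"
      using assms(5,6) half_gt_zero[OF e] unfolding conv_in_prob_def by (intro tendsto_add) blast+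
    then show "(\<lambda>n. prob {\<omega> \<in> space M. e / 2 < \<bar>X n \<omega> - Y \<omega>\<bar>} + prob {\<omega> \<in> space M. e / 2 < \<bar>X' n \<omega> - Y' \<omega>\<bar>}) \<longlonglongrightarrow> 0"
      by simp
    have "prob {\<omega> \<in> space M. e < \<bar>X n \<omega> + X' n \<omega> - (Y \<omega> + Y' \<omega>)\<bar>}
      \<le> prob ({\<omega> \<in> space M. e / 2 < \<bar>X n \<omega> - Y \<omega>\<bar>} \<union> {\<omega> \<in> space M. e / 2 < \<bar>X' n \<omega> - Y' \<omega>\<bar>})" for n
      by (intro finite_measure_mono) (auto simp: abs_if split: if_splits)
    also have "\<dots> n \<le> prob {\<omega> \<in> space M. e / 2 < \<bar>X n \<omega> - Y \<omega>\<bar>} + prob {\<omega> \<in> space M. e / 2 < \<bar>X' n \<omega> - Y' \<omega>\<bar>}" for n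
      by (intro measure_Un_le) auto
    finally show "\<forall>\<^sub>F n in sequentially. prob {\<omega> \<in> space M. e < \<bar>X n \<omega> + X' n \<omega> - (Y \<omega> + Y' \<omega>)\<bar>}
      \<le> prob {\<omega> \<in> space M. e / 2 < \<bar>X n \<omega> - Y \<omega>\<bar>} + prob {\<omega> \<in> space M. e / 2 < \<bar>X' n \<omega> - Y' \<omega>\<bar>}"
      by (intro always_eventually allI)
  qed auto
qed

lemma conv_in_prob_mult:
  assumes "conv_in_prob M X Y"
  shows "conv_in_prob M (\<lambda>n \<omega>. a * X n \<omega>) (\<lambda>\<omega>. a * Y \<omega>)"
proof (cases "a = 0")
  case True
  then show ?thesis by (simp add: conv_in_prob_def)
next
  case False
  have "(e < \<bar>a * x - a * y\<bar>) = (e / \<bar>a\<bar> < \<bar>x - y\<bar>)" for e x y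
    using False by (simp add: pos_divide_less_eq mult.commute flip: right_diff_distrib abs_mult)
  then show ?thesis using assms False by (simp add: conv_in_prob_def)
qed

lemma conv_in_prob_cong_AE:
  assumes [measurable]: "\<And>n. X n \<in> borel_measurable M" "\<And>n. X' n \<in> borel_measurable M" "Y \<in> borel_measurable M"
    and ae: "\<And>n. AE \<omega> in M. X n \<omega> = X' n \<omega>"
  shows "conv_in_prob M X Y \<longleftrightarrow> conv_in_prob M X' Y"
proof -
  have "prob {\<omega> \<in> space M. e < \<bar>X n \<omega> - Y \<omega>\<bar>} = prob {\<omega> \<in> space M. e < \<bar>X' n \<omega> - Y \<omega>\<bar>}" for e n
  proof (rule finite_measure_eq_AE)
    show "AE \<omega> in M. (\<omega> \<in> {\<omega> \<in> space M. e < \<bar>X n \<omega> - Y \<omega>\<bar>}) = (\<omega> \<in> {\<omega> \<in> space M. e < \<bar>X' n \<omega> - Y \<omega>\<bar>})"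
      using ae[of n] by eventually_elim simp
  qed auto
  then show ?thesis by (simp add: conv_in_prob_def)
qed

end

section \<open>Convergence of the logarithms of characteristic functions\<close>

context levy_basis begin

context
  fixes \<Lambda> assumes basis: "levy_basis_of M Z \<Lambda>"
begin

lemma norm_char_simple_int:
  assumes "valid_rep xs"
  shows "norm (char (distr M borel (simple_int \<Lambda> xs)) u) = exp (- (LBINT s. - Re (\<kappa> (u * simple_fun xs s))))"
  unfolding char_simple_int[OF basis assms] norm_exp_eq_Re
  using integral_Re[OF integrable_exponent_simple[OF assms, of u]] by simp

text \<open>\<open>Re_exponent_add_le\<close> integrated over the line; the square reflects its
  factor 2. The two integrals may be dependent, so their characteristic functions cannot simply be
  multiplied.\<close>

lemma norm_char_simple_int_ge:
  assumes "valid_rep xs" "valid_rep ys"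
  shows "norm (char (distr M borel (simple_int \<Lambda> (xs @ ys))) u)
    \<ge> (norm (char (distr M borel (simple_int \<Lambda> xs)) u) * norm (char (distr M borel (simple_int \<Lambda> ys)) u))\<^sup>2"
proof -
  note int = integrable_Re[OF integrable_exponent_simple, of _ u]
  let ?p = "\<lambda>xs s. - Re (\<kappa> (u * simple_fun xs s))"
  have "(LBINT s. ?p (xs @ ys) s) \<le> (LBINT s. 2 * ?p xs s + 2 * ?p ys s)"
  proof (rule integral_mono)
    show "integrable lborel (?p (xs @ ys))" using assms int[of "xs @ ys"] by simp
    show "?p (xs @ ys) s \<le> 2 * ?p xs s + 2 * ?p ys s" for s
      using Re_exponent_add_le[of "u * simple_fun xs s" "u * simple_fun ys s"] by (simp add: distrib_left)
  qed (use assms int in auto)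
  also have "\<dots> = 2 * (LBINT s. ?p xs s) + 2 * (LBINT s. ?p ys s)"
    using assms int by simp
  finally show ?thesis
    using assms
    by (simp add: norm_char_simple_int power2_eq_square flip: exp_add)
qed

text \<open>The characteristic functions are bounded away from \<open>0\<close>, uniformly in \<open>n\<close>, so that their logarithms converge.\<close>

lemma Cauchy_integral_exponent_simple:
  assumes valid: "\<And>n. valid_rep (xs n)"
    and [measurable]: "X \<in> borel_measurable M" and conv: "conv_in_prob M (\<lambda>n. simple_int \<Lambda> (xs n)) X"
  shows "Cauchy (\<lambda>n. CLBINT s. \<kappa> (u * simple_fun (xs n) s))"
proof (rule CauchyI)
  fix e :: real assume e: "0 < e"
  let ?S = "\<lambda>n. simple_int \<Lambda> (xs n)"
  let ?\<phi> = "\<lambda>n c. char (distr M borel (?S n)) (c * u)"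
  let ?E = "\<lambda>n m. expectation (\<lambda>\<omega>. min 1 \<bar>?S n \<omega> - ?S m \<omega>\<bar>)"
  have [measurable]: "?S n \<in> borel_measurable M" for n by (intro simple_int_measurable basis valid)
  have le: "norm (?\<phi> n c - ?\<phi> m c) \<le> (2 + \<bar>u\<bar>) * ?E n m" if "c \<in> {0..1}" for n m c
    using that by (intro norm_char_diff_le) (auto simp: abs_mult mult_left_le_one_le)
  \<comment> \<open>With this threshold \<open>norm_char_diff_le\<close> puts the characteristic
    function of \<open>?S n - ?S N0\<close> within 1 / 2 of 1, hence at distance at least 1 / 2 from
    0.\<close>
  obtain N0 where N0: "\<And>n m. n \<ge> N0 \<Longrightarrow> m \<ge> N0 \<Longrightarrow> ?E n m < 1 / (2 * (2 + \<bar>u\<bar>))"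
    by (rule conv_in_prob_imp_Cauchy_expectation[OF _ _ conv, of "1 / (2 * (2 + \<bar>u\<bar>))"]) auto
  have pos: "?\<phi> n c \<noteq> 0" for n c
    using char_simple_int[OF basis valid] by simp
  have "continuous_on {0..1} (\<lambda>c. norm (?\<phi> N0 c))"
    unfolding char_simple_int[OF basis valid]
    using continuous_on_integral_exponent_simple[OF valid] by (intro continuous_intros) auto
  then obtain c0 where c0: "\<And>c. c \<in> {0..1} \<Longrightarrow> norm (?\<phi> N0 c0) \<le> norm (?\<phi> N0 c)"
    using continuous_attains_inf[of "{0..1::real}" "\<lambda>c. norm (?\<phi> N0 c)"] by (metis atLeastAtMost_iff compact_Icc empty_iff zero_le_one order_refl)
  \<comment> \<open>The bound that \<open>norm_char_simple_int_ge\<close> yields for the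
    decomposition of \<open>?S n\<close> into \<open>?S n - ?S N0\<close> and \<open>?S N0\<close>,
    using the minimum over the compact path for the second part.\<close>
  define \<delta> where "\<delta> = (1 / 2 * norm (?\<phi> N0 c0))\<^sup>2"
  have \<delta>: "0 < \<delta>" using pos[of N0 c0] by (simp add: \<delta>_def)
  have lower: "\<delta> \<le> norm (?\<phi> n c)" if n: "n \<ge> N0" and c: "c \<in> {0..1}" for n c
  proof -
    define ds where "ds = xs n @ smult_rep (-1) (xs N0)"
    have ds: "valid_rep ds" using valid by (simp add: ds_def)
    have sds: "simple_int \<Lambda> ds = (\<lambda>\<omega>. ?S n \<omega> - ?S N0 \<omega>)" by (auto simp: ds_def)
    have "norm (char (distr M borel (simple_int \<Lambda> ds)) (c * u) - char (distr M borel (\<lambda>_. 0)) (c * u))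
      \<le> (2 + \<bar>u\<bar>) * expectation (\<lambda>\<omega>. min 1 \<bar>simple_int \<Lambda> ds \<omega> - 0\<bar>)"
      using c ds by (intro norm_char_diff_le simple_int_measurable[OF basis]) (auto simp: abs_mult mult_left_le_one_le)
    also have "\<dots> = (2 + \<bar>u\<bar>) * ?E n N0" by (simp add: sds)
    also have "\<dots> \<le> (2 + \<bar>u\<bar>) * (1 / (2 * (2 + \<bar>u\<bar>)))"
      using N0[of n N0] n by (intro mult_left_mono) auto
    also have "\<dots> = 1 / 2" by (simp add: field_simps)
    finally have "norm (char (distr M borel (simple_int \<Lambda> ds)) (c * u) - 1) \<le> 1 / 2"
      by (subst (asm) (2) char_distr) (auto simp: prob_space)
    then have "1 / 2 \<le> norm (char (distr M borel (simple_int \<Lambda> ds)) (c * u))"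
      using norm_triangle_ineq2[of 1 "1 - char (distr M borel (simple_int \<Lambda> ds)) (c * u)"]
      by (simp add: norm_minus_commute)
    then have "\<delta> \<le> (norm (char (distr M borel (simple_int \<Lambda> ds)) (c * u)) * norm (?\<phi> N0 c))\<^sup>2"
      unfolding \<delta>_def using c0[OF c] by (intro power_mono mult_mono) auto
    also have "\<dots> \<le> norm (char (distr M borel (simple_int \<Lambda> (ds @ xs N0))) (c * u))"
      by (intro norm_char_simple_int_ge ds valid)
    also have "simple_int \<Lambda> (ds @ xs N0) = ?S n" by (auto simp: sds)
    finally show ?thesis .
  qed
  obtain \<eta> where \<eta>: "\<eta> > 0" "\<And>q :: real \<Rightarrow> complex. continuous_on {0..1} q \<Longrightarrow> q 0 = 0 \<Longrightarrow>
      (\<And>c. c \<in> {0..1} \<Longrightarrow> norm (exp (q c) - 1) < \<eta>) \<Longrightarrow> norm (q 1) < e"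
    using small_if_exp_near_one[OF e] by metis
  have "0 < \<eta> * \<delta> / (2 + \<bar>u\<bar>)" using \<delta> \<eta>(1) by simp
  then obtain N1 where N1: "\<And>n m. n \<ge> N1 \<Longrightarrow> m \<ge> N1 \<Longrightarrow> ?E n m < \<eta> * \<delta> / (2 + \<bar>u\<bar>)"
    using conv_in_prob_imp_Cauchy_expectation[OF _ _ conv] by (metis \<open>\<And>n. ?S n \<in> borel_measurable M\<close> assms(2))
  have "norm ((CLBINT s. \<kappa> (u * simple_fun (xs n) s)) - (CLBINT s. \<kappa> (u * simple_fun (xs m) s))) < e"
    if nm: "n \<ge> max N0 N1" "m \<ge> max N0 N1" for n m
  proof -
    \<comment> \<open>The difference of two logarithms along the path from 0 to \<open>u\<close>.
      Its exponential is a quotient of characteristic functions; \<open>N1\<close> makes the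
      numerator of the deviation from 1 small and \<open>\<delta>\<close> bounds the
      denominator.\<close>
    define q where "q c = (CLBINT s. \<kappa> (c * u * simple_fun (xs n) s)) - (CLBINT s. \<kappa> (c * u * simple_fun (xs m) s))" for c
    have "norm (q 1) < e"
    proof (rule \<eta>(2))
      show "continuous_on {0..1} q"
        unfolding q_def by (intro continuous_intros continuous_on_integral_exponent_simple valid)
      show "q 0 = 0" by (simp add: q_def)
      fix c :: real assume c: "c \<in> {0..1}"
      have "exp (q c) - 1 = (?\<phi> n c - ?\<phi> m c) / ?\<phi> m c"
        using pos[of m c] unfolding q_def exp_diff char_simple_int[OF basis valid, symmetric]
        by (simp add: diff_divide_distrib)
      then have "norm (exp (q c) - 1) = norm (?\<phi> n c - ?\<phi> m c) / norm (?\<phi> m c)"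
        by (simp add: norm_divide)
      also have "\<dots> \<le> ((2 + \<bar>u\<bar>) * ?E n m) / \<delta>"
      proof (rule frac_le)
        show "0 \<le> (2 + \<bar>u\<bar>) * ?E n m" using le[OF c, of n m] norm_ge_zero order_trans by blast
      qed (use le[OF c] lower[of m c] nm c \<delta> in auto)
      also have "\<dots> < \<eta>"
        using N1[of n m] nm \<delta> by (simp add: field_simps)
      finally show "norm (exp (q c) - 1) < \<eta>" .
    qed
    then show ?thesis by (simp add: q_def)
  qed
  then show "\<exists>N. \<forall>m\<ge>N. \<forall>n\<ge>N. norm ((CLBINT s. \<kappa> (u * simple_fun (xs m) s)) - (CLBINT s. \<kappa> (u * simple_fun (xs n) s))) < e"
    by (intro exI[of _ "max N0 N1"]) auto
qed

text \<open>The condition in \<open>lb_integral\<close> with the basis held fixed, so that integrals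
  of different functions can be added.\<close>

definition approximable :: "(real \<Rightarrow> real) \<Rightarrow> ('a \<Rightarrow> real) \<Rightarrow> bool" where
  "approximable g X \<longleftrightarrow> g \<in> borel_measurable borel \<and> X \<in> borel_measurable M \<and>
    (\<exists>xs. (\<forall>n. valid_rep (xs n)) \<and> (AE s in lborel. (\<lambda>n. simple_fun (xs n) s) \<longlonglongrightarrow> g s) \<and>
      (\<forall>A\<in>sets borel. \<exists>XA\<in>borel_measurable M. conv_in_prob M (\<lambda>n. simple_int \<Lambda> (restrict_rep A (xs n))) XA) \<and>
      conv_in_prob M (\<lambda>n. simple_int \<Lambda> (xs n)) X)"

text \<open>The definition asks for convergence of the restricted integrals over every Borel set.
  Through logarithms this gives Cauchy integrals of
  \<open>\<kappa> (u * simple_fun (xs n) s)\<close> over every Borel set, and therefore convergence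
  in L1.\<close>

lemma char_approximable:
  assumes "approximable g X"
  shows "integrable lborel (\<lambda>s. \<kappa> (u * g s))"
    and "char (distr M borel X) u = exp (CLBINT s. \<kappa> (u * g s))"
proof -
  have [measurable]: "g \<in> borel_measurable borel" "X \<in> borel_measurable M"
    using assms by (auto simp: approximable_def)
  obtain xs where valid: "\<And>n. valid_rep (xs n)"
    and ae: "AE s in lborel. (\<lambda>n. simple_fun (xs n) s) \<longlonglongrightarrow> g s"
    and convA: "\<And>A. A \<in> sets borel \<Longrightarrow> \<exists>XA\<in>borel_measurable M. conv_in_prob M (\<lambda>n. simple_int \<Lambda> (restrict_rep A (xs n))) XA"
    and conv: "conv_in_prob M (\<lambda>n. simple_int \<Lambda> (xs n)) X"
    using assms by (auto simp: approximable_def)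
  have 1: "AE s in lborel. (\<lambda>n. \<kappa> (u * simple_fun (xs n) s)) \<longlonglongrightarrow> \<kappa> (u * g s)"
    using ae
  proof eventually_elim
    case (elim s)
    show ?case
      by (rule continuous_on_tendsto_compose[OF continuous_on_exponent tendsto_mult[OF tendsto_const elim]]) auto
  qed
  have 2: "Cauchy (\<lambda>n. CLINT s:A|lborel. \<kappa> (u * simple_fun (xs n) s))" if A: "A \<in> sets borel" for A
  proof -
    obtain XA where "XA \<in> borel_measurable M" "conv_in_prob M (\<lambda>n. simple_int \<Lambda> (restrict_rep A (xs n))) XA"
      using convA[OF A] by blast
    then have "Cauchy (\<lambda>n. CLBINT s. \<kappa> (u * simple_fun (restrict_rep A (xs n)) s))"
      using valid A by (intro Cauchy_integral_exponent_simple[where xs = "\<lambda>n. restrict_rep A (xs n)"]) auto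
    \<comment> \<open>Restriction to \<open>A\<close> commutes with \<open>\<kappa>\<close> because
      \<open>\<kappa> 0 = 0\<close>.\<close>
    moreover have "\<kappa> (u * simple_fun (restrict_rep A (xs n)) s) = indicator A s *\<^sub>R \<kappa> (u * simple_fun (xs n) s)" for n s
      by (auto simp: indicator_def)
    ultimately show ?thesis by (simp add: set_lebesgue_integral_def)
  qed
  note L1 = integral_convergence_if_set_integrals_Cauchy[OF integrable_exponent_simple[OF valid] 1 _ 2]
  show "integrable lborel (\<lambda>s. \<kappa> (u * g s))" by (rule L1) auto
  have [measurable]: "simple_int \<Lambda> (xs n) \<in> borel_measurable M" for n by (intro simple_int_measurable basis valid)
  have "(\<lambda>n. char (distr M borel (simple_int \<Lambda> (xs n))) u) \<longlonglongrightarrow> exp (CLBINT s. \<kappa> (u * g s))"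
    unfolding char_simple_int[OF basis valid] by (intro tendsto_exp L1) auto
  moreover have "(\<lambda>n. char (distr M borel (simple_int \<Lambda> (xs n))) u) \<longlonglongrightarrow> char (distr M borel X) u"
  proof (rule Lim_null[THEN iffD2], rule Lim_null_comparison)
    show "\<forall>\<^sub>F n in sequentially. norm (char (distr M borel (simple_int \<Lambda> (xs n))) u - char (distr M borel X) u)
      \<le> (2 + \<bar>u\<bar>) * expectation (\<lambda>\<omega>. min 1 \<bar>simple_int \<Lambda> (xs n) \<omega> - X \<omega>\<bar>)"
      by (intro always_eventually allI norm_char_diff_le) auto
    show "(\<lambda>n. (2 + \<bar>u\<bar>) * expectation (\<lambda>\<omega>. min 1 \<bar>simple_int \<Lambda> (xs n) \<omega> - X \<omega>\<bar>)) \<longlonglongrightarrow> 0"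
      by (intro tendsto_mult_right_zero conv_in_prob_imp_tendsto_expectation conv) auto
  qed
  ultimately show "char (distr M borel X) u = exp (CLBINT s. \<kappa> (u * g s))"
    by (rule LIMSEQ_unique[rotated])
qed

lemma approximable_zero: "approximable (\<lambda>_. 0) (\<lambda>_. 0)"
  unfolding approximable_def
  by (intro conjI exI[of _ "\<lambda>_. []"]) (auto simp: restrict_rep_def conv_in_prob_def intro!: bexI[of _ "\<lambda>_. 0"])

lemma approximable_mult:
  assumes "approximable g X"
  shows "approximable (\<lambda>s. a * g s) (\<lambda>\<omega>. a * X \<omega>)"
proof -
  obtain xs where xs: "\<And>n. valid_rep (xs n)"
    "AE s in lborel. (\<lambda>n. simple_fun (xs n) s) \<longlonglongrightarrow> g s"
    "\<And>A. A \<in> sets borel \<Longrightarrow> \<exists>XA\<in>borel_measurable M. conv_in_prob M (\<lambda>n. simple_int \<Lambda> (restrict_rep A (xs n))) XA"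
    "conv_in_prob M (\<lambda>n. simple_int \<Lambda> (xs n)) X"
    using assms by (auto simp: approximable_def)
  have si: "simple_int \<Lambda> (smult_rep a ys) = (\<lambda>\<omega>. a * simple_int \<Lambda> ys \<omega>)" for ys by auto
  show ?thesis
    unfolding approximable_def
  proof (intro conjI exI[of _ "\<lambda>n. smult_rep a (xs n)"] ballI allI)
    show "AE s in lborel. (\<lambda>n. simple_fun (smult_rep a (xs n)) s) \<longlonglongrightarrow> a * g s"
      using xs(2) by eventually_elim (auto intro!: tendsto_intros)
    fix A :: "real set" assume "A \<in> sets borel"
    then obtain XA where XA: "XA \<in> borel_measurable M" "conv_in_prob M (\<lambda>n. simple_int \<Lambda> (restrict_rep A (xs n))) XA"
      using xs(3) by blast
    then show "\<exists>XA\<in>borel_measurable M. conv_in_prob M (\<lambda>n. simple_int \<Lambda> (restrict_rep A (smult_rep a (xs n)))) XA"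
      unfolding restrict_rep_smult si by (intro bexI[of _ "\<lambda>\<omega>. a * XA \<omega>"] conv_in_prob_mult) auto
  qed (use assms xs in \<open>auto simp: approximable_def si intro!: conv_in_prob_mult\<close>)
qed

lemma approximable_add:
  assumes "approximable g X" "approximable h Y"
  shows "approximable (\<lambda>s. g s + h s) (\<lambda>\<omega>. X \<omega> + Y \<omega>)"
proof -
  obtain xs where xs: "\<And>n. valid_rep (xs n)"
    "AE s in lborel. (\<lambda>n. simple_fun (xs n) s) \<longlonglongrightarrow> g s"
    "\<And>A. A \<in> sets borel \<Longrightarrow> \<exists>XA\<in>borel_measurable M. conv_in_prob M (\<lambda>n. simple_int \<Lambda> (restrict_rep A (xs n))) XA"
    "conv_in_prob M (\<lambda>n. simple_int \<Lambda> (xs n)) X"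
    using assms(1) by (auto simp: approximable_def)
  obtain ys where ys: "\<And>n. valid_rep (ys n)"
    "AE s in lborel. (\<lambda>n. simple_fun (ys n) s) \<longlonglongrightarrow> h s"
    "\<And>A. A \<in> sets borel \<Longrightarrow> \<exists>XA\<in>borel_measurable M. conv_in_prob M (\<lambda>n. simple_int \<Lambda> (restrict_rep A (ys n))) XA"
    "conv_in_prob M (\<lambda>n. simple_int \<Lambda> (ys n)) Y"
    using assms(2) by (auto simp: approximable_def)
  have [measurable]: "X \<in> borel_measurable M" "Y \<in> borel_measurable M" "g \<in> borel_measurable borel" "h \<in> borel_measurable borel"
    using assms by (auto simp: approximable_def)
  have si: "simple_int \<Lambda> (xs @ ys) = (\<lambda>\<omega>. simple_int \<Lambda> xs \<omega> + simple_int \<Lambda> ys \<omega>)" for xs ys by auto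
  show ?thesis
    unfolding approximable_def
  proof (intro conjI exI[of _ "\<lambda>n. xs n @ ys n"] ballI allI)
    show "AE s in lborel. (\<lambda>n. simple_fun (xs n @ ys n) s) \<longlonglongrightarrow> g s + h s"
      using xs(2) ys(2) by eventually_elim (auto intro!: tendsto_intros)
    show "conv_in_prob M (\<lambda>n. simple_int \<Lambda> (xs n @ ys n)) (\<lambda>\<omega>. X \<omega> + Y \<omega>)"
      unfolding si by (intro conv_in_prob_add simple_int_measurable[OF basis] xs ys) auto
    fix A :: "real set" assume A: "A \<in> sets borel"
    obtain XA where XA: "XA \<in> borel_measurable M" "conv_in_prob M (\<lambda>n. simple_int \<Lambda> (restrict_rep A (xs n))) XA"
      using xs(3) A by blast
    obtain YA where YA: "YA \<in> borel_measurable M" "conv_in_prob M (\<lambda>n. simple_int \<Lambda> (restrict_rep A (ys n))) YA"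
      using ys(3) A by blast
    show "\<exists>XA\<in>borel_measurable M. conv_in_prob M (\<lambda>n. simple_int \<Lambda> (restrict_rep A (xs n @ ys n))) XA"
      unfolding restrict_rep_append si
      using XA YA xs ys A
      by (intro bexI[of _ "\<lambda>\<omega>. XA \<omega> + YA \<omega>"] conv_in_prob_add simple_int_measurable[OF basis] restrict_rep_simps) auto
  qed (use xs ys in auto)
qed

end

end

lemma simple_rep_upt:
  "simple_fun (map (\<lambda>j. (c j, B j)) [0..<k]) s = (\<Sum>j<k. c j * indicator (B j) s)"
  "simple_int \<Lambda> (map (\<lambda>j. (c j, B j)) [0..<k]) \<omega> = (\<Sum>j<k. c j * \<Lambda> (B j) \<omega>)"
  by (simp_all add: simple_fun_def simple_int_def comp_def interv_sum_list_conv_sum_set_nat atLeast0LessThan)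

context levy_basis begin

lemma lb_integral_approximable:
  assumes "lb_integral M Z g X"
  obtains \<Lambda> where "levy_basis_of M Z \<Lambda>" "approximable \<Lambda> g X"
proof -
  obtain \<Lambda> and K :: "nat \<Rightarrow> nat" and c B where gX: "g \<in> borel_measurable borel" "X \<in> borel_measurable M"
    and basis: "levy_basis_of M Z \<Lambda>"
    and B: "\<And>n j. B n j \<in> sets borel \<and> bounded (B n j)"
    and ae: "AE s in lborel. (\<lambda>n. \<Sum>j<K n. c n j * indicator (B n j) s) \<longlonglongrightarrow> g s"
    and convA: "\<forall>A \<in> sets borel. \<exists>XA \<in> borel_measurable M.
           conv_in_prob M (\<lambda>n \<omega>. \<Sum>j<K n. c n j * \<Lambda> (A \<inter> B n j) \<omega>) XA"
    and conv: "conv_in_prob M (\<lambda>n \<omega>. \<Sum>j<K n. c n j * \<Lambda> (B n j) \<omega>) X"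
    using assms unfolding lb_integral_def by (elim conjE exE) blast
  define xs where "xs n = map (\<lambda>j. (c n j, B n j)) [0..<K n]" for n
  have restr: "restrict_rep A (xs n) = map (\<lambda>j. (c n j, A \<inter> B n j)) [0..<K n]" for A n
    by (simp add: xs_def restrict_rep_def)
  have si: "simple_int \<Lambda> (xs n) = (\<lambda>\<omega>. \<Sum>j<K n. c n j * \<Lambda> (B n j) \<omega>)"
    "simple_int \<Lambda> (restrict_rep A (xs n)) = (\<lambda>\<omega>. \<Sum>j<K n. c n j * \<Lambda> (A \<inter> B n j) \<omega>)" for A n
    unfolding restr unfolding xs_def by (auto simp: simple_rep_upt)
  have "approximable \<Lambda> g X"
    unfolding approximable_def[OF basis]
  proof (intro conjI gX exI[of _ xs] allI)
    show "valid_rep (xs n)" for n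
      using B by (auto simp: valid_rep_def xs_def bounded_borel_def)
    show "AE s in lborel. (\<lambda>n. simple_fun (xs n) s) \<longlonglongrightarrow> g s"
      using ae unfolding xs_def simple_rep_upt .
  qed (use convA conv in \<open>simp_all only: si\<close>)
  then show ?thesis using basis that by blast
qed

lemma approximable_change_basis:
  assumes basis: "levy_basis_of M Z \<Lambda>" "levy_basis_of M Z \<Lambda>'" and "approximable \<Lambda> g X"
  shows "approximable \<Lambda>' g X"
proof -
  have ae: "AE \<omega> in M. simple_int \<Lambda> xs \<omega> = simple_int \<Lambda>' xs \<omega>" if "valid_rep xs" for xs
    using that
  proof (induction xs)
    case (Cons x xs)
    have "AE \<omega> in M. \<Lambda> (snd x) \<omega> = \<Lambda>' (snd x) \<omega>"
      using Cons.prems by (intro basis_unique[OF basis]) (auto simp: bounded_borel_def)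
    moreover have "AE \<omega> in M. simple_int \<Lambda> xs \<omega> = simple_int \<Lambda>' xs \<omega>"
      using Cons by simp
    ultimately show ?case by eventually_elim simp
  qed simp
  have iff: "conv_in_prob M (\<lambda>n. simple_int \<Lambda> (xs n)) Y \<longleftrightarrow> conv_in_prob M (\<lambda>n. simple_int \<Lambda>' (xs n)) Y"
    if "\<And>n. valid_rep (xs n)" "Y \<in> borel_measurable M" for xs Y
    using that ae by (intro conv_in_prob_cong_AE simple_int_measurable basis) auto
  obtain xs where xs: "\<And>n. valid_rep (xs n)"
    "AE s in lborel. (\<lambda>n. simple_fun (xs n) s) \<longlonglongrightarrow> g s"
    "\<And>A. A \<in> sets borel \<Longrightarrow> \<exists>XA\<in>borel_measurable M. conv_in_prob M (\<lambda>n. simple_int \<Lambda> (restrict_rep A (xs n))) XA"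
    "conv_in_prob M (\<lambda>n. simple_int \<Lambda> (xs n)) X"
    using assms(3) by (auto simp: approximable_def[OF basis(1)])
  have X: "X \<in> borel_measurable M" "g \<in> borel_measurable borel" using assms(3) by (auto simp: approximable_def[OF basis(1)])
  show ?thesis
    unfolding approximable_def[OF basis(2)]
  proof (intro conjI exI[of _ xs] ballI allI)
    fix A :: "real set" assume A: "A \<in> sets borel"
    then obtain XA where XA: "XA \<in> borel_measurable M" "conv_in_prob M (\<lambda>n. simple_int \<Lambda> (restrict_rep A (xs n))) XA"
      using xs(3) by blast
    then show "\<exists>XA\<in>borel_measurable M. conv_in_prob M (\<lambda>n. simple_int \<Lambda>' (restrict_rep A (xs n))) XA"
      using iff[of "\<lambda>n. restrict_rep A (xs n)" XA] xs(1) A by auto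
  qed (use xs X iff[of xs X] in auto)
qed

text \<open>All the integrals are first moved to one common basis, where they can be combined
  linearly. As the coefficients are arbitrary, the argument 1 already yields all joint
  characteristic functions of \<open>Y\<close>.\<close>

lemma char_lb_integral:
  assumes Y: "\<And>t :: real. lb_integral M Z (g t) (Y t)"
  shows "integrable lborel (\<lambda>s. \<kappa> (\<Sum>(u, t)\<leftarrow>ts. u * g t s))"
    and "char (distr M borel (\<lambda>\<omega>. \<Sum>(u, t)\<leftarrow>ts. u * Y t \<omega>)) 1 = exp (CLBINT s. \<kappa> (\<Sum>(u, t)\<leftarrow>ts. u * g t s))"
proof -
  obtain \<Lambda> where basis: "levy_basis_of M Z \<Lambda>"
    using lb_integral_approximable[OF Y[of 0]] by blast
  have *: "approximable \<Lambda> (g t) (Y t)" for t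
  proof -
    obtain \<Lambda>' where "levy_basis_of M Z \<Lambda>'" "approximable \<Lambda>' (g t) (Y t)"
      using lb_integral_approximable[OF Y[of t]] by blast
    then show ?thesis using approximable_change_basis[OF _ basis] by blast
  qed
  have "approximable \<Lambda> (\<lambda>s. \<Sum>(u, t)\<leftarrow>ts. u * g t s) (\<lambda>\<omega>. \<Sum>(u, t)\<leftarrow>ts. u * Y t \<omega>)"
  proof (induction ts)
    case (Cons x ts)
    then show ?case
      using approximable_add[OF basis approximable_mult[OF basis *, of "fst x" "snd x"]]
      by (simp add: split_beta)
  qed (simp add: approximable_zero[OF basis])
  from char_approximable[OF basis this, of 1]
  show "integrable lborel (\<lambda>s. \<kappa> (\<Sum>(u, t)\<leftarrow>ts. u * g t s))"
    and "char (distr M borel (\<lambda>\<omega>. \<Sum>(u, t)\<leftarrow>ts. u * Y t \<omega>)) 1 = exp (CLBINT s. \<kappa> (\<Sum>(u, t)\<leftarrow>ts. u * g t s))"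
    by simp_all
qed

end

section \<open>Uniqueness of the characteristic exponent\<close>

lemma Fubini_product_bound:
  fixes F :: "real \<Rightarrow> real \<Rightarrow> complex"
  assumes [measurable]: "case_prod F \<in> borel_measurable (borel \<Otimes>\<^sub>M borel)"
    and w: "integrable lborel w" and B: "integrable lborel B"
    and le: "\<And>t s. norm (F t s) \<le> w t * B s"
  shows "(CLBINT s. CLBINT t. F t s) = (CLBINT t. CLBINT s. F t s)"
proof (rule lborel_pair.Fubini_integral)
  have [measurable]: "w \<in> borel_measurable borel" "B \<in> borel_measurable borel" using w B by auto
  have "integrable (lborel \<Otimes>\<^sub>M lborel) (\<lambda>(t, s). w t * B s)"
  proof (rule lborel_pair.Fubini_integrable)
    have "(LBINT s. norm (w t * B s)) = \<bar>w t\<bar> * (LBINT s. \<bar>B s\<bar>)" for t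
      by (simp add: abs_mult)
    then show "integrable lborel (\<lambda>t. LBINT s. norm (case (t, s) of (t, s) \<Rightarrow> w t * B s))"
      using w by simp
  qed (use B in auto)
  then show "integrable (lborel \<Otimes>\<^sub>M lborel) (\<lambda>(t, s). F t s)"
    by (rule Bochner_Integration.integrable_bound) (use le in \<open>auto simp: split_beta intro: order_trans[OF _ abs_ge_self]\<close>)
qed

text \<open>Half-lines form a generator stable under intersection, and \<open>total\<close> supplies
  the passage to complements. Hence all integrals over Borel sets vanish, in particular those over
  the sets where \<open>F\<close> or \<open>- F\<close> is positive.\<close>

lemma AE_zero_if_integral_atLeast_zero:
  fixes F :: "real \<Rightarrow> real"
  assumes F: "integrable lborel F" and zero: "\<And>x. (LINT s:{x..}|lborel. F s) = 0"
    and total: "(LBINT s. F s) = 0"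
  shows "AE s in lborel. F s = 0"
proof -
  have int: "integrable lborel (\<lambda>s. indicator A s *\<^sub>R F s)" if "A \<in> sets borel" for A
    using F that by (intro integrable_mult_indicator) auto
  have A: "(LINT s:A|lborel. F s) = 0" if "A \<in> sets borel" for A
  proof -
    have "Int_stable (range (atLeast :: real \<Rightarrow> _))"
    proof (rule Int_stableI)
      fix X Y :: "real set" assume "X \<in> range atLeast" "Y \<in> range atLeast"
      then obtain a b where "X = {a..}" "Y = {b..}" by auto
      then have "X \<inter> Y = {max a b..}" by auto
      then show "X \<inter> Y \<in> range atLeast" by auto
    qed
    moreover have "range atLeast \<subseteq> Pow (UNIV :: real set)" by simp
    moreover have "A \<in> sigma_sets UNIV (range atLeast)" using that by (simp add: borel_Ici)
    ultimately show ?thesis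
    proof (induction rule: sigma_sets_induct_disjoint[where G = "range atLeast" and \<Omega> = UNIV])
      case (compl A)
      then have [measurable]: "A \<in> sets borel" by (simp add: borel_Ici)
      have "(LINT s:UNIV - A|lborel. F s) = (LBINT s. F s - indicator A s *\<^sub>R F s)"
        unfolding set_lebesgue_integral_def
        by (intro Bochner_Integration.integral_cong) (auto simp: indicator_def)
      also have "\<dots> = (LBINT s. F s) - (LINT s:A|lborel. F s)"
        unfolding set_lebesgue_integral_def by (intro Bochner_Integration.integral_diff F int) auto
      finally show ?case using compl total by simp
    next
      case (union A)
      then have [measurable]: "A i \<in> sets borel" for i by (auto simp: borel_Ici)
      have "(LINT s:(\<Union>i. A i)|lborel. F s) = (\<Sum>i. (LINT s:(A i)|lborel. F s))"
        by (rule lebesgue_integral_countable_add)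
          (use union(1) int in \<open>auto simp: disjoint_family_on_def set_integrable_def\<close>)
      then show ?case using union by simp
    qed (use zero in \<open>auto simp: set_lebesgue_integral_def\<close>)
  qed
  have [measurable]: "F \<in> borel_measurable borel" using F by auto
  have nonpos: "AE s in lborel. \<not> 0 < G s"
    if G: "integrable lborel G" "\<And>A. A \<in> sets borel \<Longrightarrow> (LINT s:A|lborel. G s) = 0" for G :: "real \<Rightarrow> real"
  proof -
    have [measurable]: "G \<in> borel_measurable borel" using G by auto
    let ?P = "{s. 0 < G s}"
    have "integrable lborel (\<lambda>s. indicator ?P s *\<^sub>R G s)"
      using G(1) by (intro integrable_mult_indicator) auto
    moreover have "(LBINT s. indicator ?P s *\<^sub>R G s) = 0"
      using G(2)[of ?P] by (simp add: set_lebesgue_integral_def)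
    moreover have "AE s in lborel. 0 \<le> indicator ?P s *\<^sub>R G s"
      by (auto simp: indicator_def)
    ultimately have "AE s in lborel. indicator ?P s *\<^sub>R G s = 0"
      using integral_nonneg_eq_0_iff_AE by blast
    then show ?thesis by eventually_elim (auto simp: indicator_def)
  qed
  have "AE s in lborel. \<not> 0 < F s" by (rule nonpos[OF F A])
  moreover have "AE s in lborel. \<not> 0 < - F s"
    using A by (intro nonpos integrable_minus F) (simp add: set_lebesgue_integral_def)
  ultimately show ?thesis by eventually_elim simp
qed

text \<open>After the substitution \<open>u \<mapsto> u - v / y\<close> the two integrals differ only near the end points.\<close>

lemma mean_difference_tendsto_zero:
  fixes w :: "real \<Rightarrow> complex"
  assumes [measurable]: "w \<in> borel_measurable borel" and B: "\<And>x. norm (w x) \<le> B" and y: "y \<noteq> 0"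
  shows "(\<lambda>N. (CLBINT u. indicator {0..real N} u *\<^sub>R (w (v + u * y) - w (u * y))) / of_nat N) \<longlonglongrightarrow> 0"
proof (rule Lim_null_comparison)
  define c where "c = v / y"
  let ?w = "\<lambda>u. w (u * y)"
  have B0: "0 \<le> B" using norm_ge_zero[of "w 0"] B[of 0] by linarith
  have int: "integrable lborel (\<lambda>u. indicator {a..b} u *\<^sub>R z u)"
    if [measurable]: "z \<in> borel_measurable borel" and "\<And>u. norm (z u) \<le> B" for a b :: real and z :: "real \<Rightarrow> complex"
  proof (rule Bochner_Integration.integrable_bound[of lborel "\<lambda>u. B * indicator {a..b} u"])
    show "integrable lborel (\<lambda>u. B * indicator {a..b} u)"
      by (intro integrable_mult_right integrable_real_indicator) (auto simp: emeasure_lborel_Icc_eq)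
    show "AE u in lborel. norm (indicator {a..b} u *\<^sub>R z u) \<le> norm (B * indicator {a..b} u)"
      using that(2) B0 by (auto simp: indicator_def)
  qed simp
  have ind: "integrable lborel (indicator {a..b} :: real \<Rightarrow> real)" for a b :: real
    by (intro integrable_real_indicator) (auto simp: emeasure_lborel_Icc_eq)
  have "norm (CLBINT u. indicator {0..real N} u *\<^sub>R (w (v + u * y) - w (u * y))) \<le> 2 * B * \<bar>c\<bar>" for N
  proof -
    let ?N = "real N"
    have "(CLBINT u. indicator {0..?N} u *\<^sub>R (w (v + u * y) - w (u * y)))
      = (CLBINT u. indicator {0..?N} u *\<^sub>R w (v + u * y)) - (CLBINT u. indicator {0..?N} u *\<^sub>R ?w u)"
      unfolding scaleR_diff_right by (intro Bochner_Integration.integral_diff int) (auto intro: B)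
    also have "(CLBINT u. indicator {0..?N} u *\<^sub>R w (v + u * y)) = (CLBINT u. indicator {c..?N + c} u *\<^sub>R ?w u)"
    proof -
      have "(CLBINT u. indicator {c..?N + c} u *\<^sub>R ?w u) = (CLBINT u. indicator {c..?N + c} (c + 1 * u) *\<^sub>R ?w (c + 1 * u))"
        by (subst lborel_integral_real_affine[of 1 _ c]) simp_all
      also have "\<dots> = (CLBINT u. indicator {0..?N} u *\<^sub>R w (v + u * y))"
        using y by (intro Bochner_Integration.integral_cong) (auto simp: indicator_def c_def algebra_simps)
      finally show ?thesis ..
    qed
    also have "\<dots> - (CLBINT u. indicator {0..?N} u *\<^sub>R ?w u)
      = (CLBINT u. indicator {c..?N + c} u *\<^sub>R ?w u - indicator {0..?N} u *\<^sub>R ?w u)"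
      by (intro Bochner_Integration.integral_diff[symmetric] int) (auto intro: B)
    finally have "norm (CLBINT u. indicator {0..?N} u *\<^sub>R (w (v + u * y) - w (u * y)))
      \<le> (LBINT u. norm (indicator {c..?N + c} u *\<^sub>R ?w u - indicator {0..?N} u *\<^sub>R ?w u))"
      by simp
    also have "\<dots> \<le> (LBINT u. B * indicator {min 0 c..max 0 c} u + B * indicator {?N + min 0 c..?N + max 0 c} u)"
    proof (rule integral_mono)
      show "integrable lborel (\<lambda>u. norm (indicator {c..?N + c} u *\<^sub>R ?w u - indicator {0..?N} u *\<^sub>R ?w u))"
        by (intro integrable_norm Bochner_Integration.integrable_diff int) (auto intro: B)
      show "integrable lborel (\<lambda>u. B * indicator {min 0 c..max 0 c} u + B * indicator {?N + min 0 c..?N + max 0 c} u)"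
        by (intro Bochner_Integration.integrable_add integrable_mult_right ind)
      fix u :: real
      \<comment> \<open>The two intervals differ only within distance \<open>\<bar>c\<bar>\<close>
        of the end points 0 and \<open>?N\<close>; this remains true when
        \<open>\<bar>c\<bar>\<close> exceeds \<open>?N\<close> and the intervals are
        disjoint.\<close>
      have "\<bar>indicator {c..?N + c} u - indicator {0..?N} u :: real\<bar>
        \<le> indicator {min 0 c..max 0 c} u + indicator {?N + min 0 c..?N + max 0 c} u"
        by (auto simp: indicator_def)
      then have "\<bar>indicator {c..?N + c} u - indicator {0..?N} u :: real\<bar> * norm (?w u)
        \<le> (indicator {min 0 c..max 0 c} u + indicator {?N + min 0 c..?N + max 0 c} u) * B"
        by (intro mult_mono B) auto
      then show "norm (indicator {c..?N + c} u *\<^sub>R ?w u - indicator {0..?N} u *\<^sub>R ?w u)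
        \<le> B * indicator {min 0 c..max 0 c} u + B * indicator {?N + min 0 c..?N + max 0 c} u"
        by (simp add: distrib_right mult.commute[of B] flip: scaleR_diff_left)
    qed
    also have "\<dots> = B * (max 0 c - min 0 c) + B * (max 0 c - min 0 c)"
      using ind by (simp add: max_def min_def)
    also have "\<dots> = 2 * B * \<bar>c\<bar>" by (auto simp: max_def min_def)
    finally show ?thesis .
  qed
  then show "\<forall>\<^sub>F N in sequentially. norm ((CLBINT u. indicator {0..real N} u *\<^sub>R (w (v + u * y) - w (u * y))) / of_nat N)
      \<le> 2 * B * \<bar>c\<bar> / real N"
    by (auto simp: norm_divide intro!: always_eventually divide_right_mono)
  show "(\<lambda>N. 2 * B * \<bar>c\<bar> / real N) \<longlonglongrightarrow> 0" by (rule lim_const_over_n)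
qed

text \<open>Drygas's functional equation. Subtracting the quadratic polynomial that agrees with
  \<open>D\<close> at 0, 1 and -1 leaves a solution \<open>G\<close> vanishing there;
  \<open>G\<close> then vanishes on the rationals and, by continuity, everywhere.\<close>

lemma quadratic_functional_equation:
  fixes D :: "real \<Rightarrow> complex"
  assumes cont: "continuous_on UNIV D" and eq: "\<And>x h. D (x + h) + D (x - h) = 2 * D x + D h + D (- h)"
    and "D 0 = 0"
  shows "D x = of_real (x\<^sup>2) * ((D 1 + D (- 1)) / 2) + of_real x * ((D 1 - D (- 1)) / 2)"
proof -
  define Q where "Q x = of_real (x\<^sup>2) * ((D 1 + D (- 1)) / 2) + of_real x * ((D 1 - D (- 1)) / 2)" for x :: real
  define G where "G x = D x - Q x" for x
  have Q: "Q (x + h) + Q (x - h) = 2 * Q x + Q h + Q (- h)" for x h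
    by (simp add: Q_def power2_eq_square field_simps)
  have G: "G (x + h) + G (x - h) = 2 * G x + G h + G (- h)" for x h
    using eq[of x h] Q[of x h] by (simp add: G_def algebra_simps)
  have G1: "G 0 = 0" "G 1 = 0" "G (- 1) = 0"
    using \<open>D 0 = 0\<close> by (simp_all add: G_def Q_def field_simps)
  have contG: "continuous_on UNIV G"
    unfolding G_def Q_def by (intro continuous_intros cont)
  \<comment> \<open>The functional equation gives a recursion of order two, so two consecutive
    multiples are carried through the induction.\<close>
  have mult: "G (real n * h) = of_nat n * (of_nat n + 1) / 2 * G h + of_nat n * (of_nat n - 1) / 2 * G (- h)
      \<and> G (real (Suc n) * h) = of_nat (Suc n) * (of_nat (Suc n) + 1) / 2 * G h + of_nat (Suc n) * (of_nat (Suc n) - 1) / 2 * G (- h)" for n h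
  proof (induction n)
    case 0
    then show ?case using G1 by simp
  next
    case (Suc n)
    have "real (Suc n) * h + h = real (Suc (Suc n)) * h" "real (Suc n) * h - h = real n * h"
      by (simp_all add: algebra_simps)
    then have "G (real (Suc (Suc n)) * h) = 2 * G (real (Suc n) * h) - G (real n * h) + G h + G (- h)"
      using G[of "real (Suc n) * h" h] by (simp only:) (simp add: algebra_simps)
    also have "\<dots> = of_nat (Suc (Suc n)) * (of_nat (Suc (Suc n)) + 1) / 2 * G h
        + of_nat (Suc (Suc n)) * (of_nat (Suc (Suc n)) - 1) / 2 * G (- h)"
      unfolding Suc[THEN conjunct1] Suc[THEN conjunct2] by (simp add: field_simps)
    finally show ?case using Suc by blast
  qed
  \<comment> \<open>Taking \<open>h\<close> to be 1 / n and -1 / n in \<open>mult\<close> reaches 1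
    and -1, where \<open>G\<close> vanishes. This gives two independent linear equations for the two
    unknown values.\<close>
  have inv: "G (1 / real n) = 0" "G (- (1 / real n)) = 0" if n: "n > 0" for n
  proof -
    define a where "a = G (1 / real n)" define b where "b = G (- (1 / real n))"
    have 1: "of_nat n * (of_nat n + 1) / 2 * a + of_nat n * (of_nat n - 1) / 2 * b = 0"
      using mult[of n "1 / real n"] n G1 by (simp add: a_def b_def)
    have 2: "of_nat n * (of_nat n + 1) / 2 * b + of_nat n * (of_nat n - 1) / 2 * a = 0"
      using mult[of n "- (1 / real n)"] n G1 by (simp add: a_def b_def)
    have "of_nat n * (of_nat n * (a + b)) = 0"
    proof -
      have "of_nat n * (of_nat n * (a + b)) = (of_nat n * (of_nat n + 1) / 2 * a + of_nat n * (of_nat n - 1) / 2 * b)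
          + (of_nat n * (of_nat n + 1) / 2 * b + of_nat n * (of_nat n - 1) / 2 * a)"
        by (simp add: field_simps)
      then show ?thesis unfolding 1 2 by simp
    qed
    then have ab: "b = - a" using n by (simp add: add_eq_0_iff)
    have "of_nat n * a = 0" using 1 unfolding ab by (simp add: field_simps)
    then have "a = 0" using n by simp
    then show "G (1 / real n) = 0" "G (- (1 / real n)) = 0" using ab by (simp_all add: a_def b_def)
  qed
  have rat: "G q = 0" if q_rat: "q \<in> \<rat>" for q
  proof -
    obtain m :: int and n :: int where n: "n > 0" and q: "q = of_int m / of_int n"
      using Rats_cases'[OF q_rat] by blast
    define k where "k = nat n"
    have k: "k > 0" "real k = of_int n" using n by (simp_all add: k_def)
    show ?thesis
    proof (cases "m \<ge> 0")
      case True
      then have "q = real (nat m) * (1 / real k)" by (simp add: q k)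
      then show ?thesis using mult[of "nat m" "1 / real k"] inv[OF k(1)] by simp
    next
      case False
      then have "q = real (nat (- m)) * (- (1 / real k))" by (simp add: q k)
      then show ?thesis using mult[of "nat (- m)" "- (1 / real k)"] inv[OF k(1)] by simp
    qed
  qed
  have "closed {q. G q = 0}"
    using continuous_closed_preimage_constant[OF contG closed_UNIV, of 0] by simp
  then have "closure \<rat> \<subseteq> {q. G q = 0}"
    using rat by (intro closure_minimal) auto
  then have "G x = 0" using Rats_closure_real by auto
  then show ?thesis by (simp add: G_def Q_def)
qed

section \<open>The span of the translates and second differences of the exponents\<close>

definition translate_comb :: "(real \<Rightarrow> real) \<Rightarrow> (real \<times> real) list \<Rightarrow> real \<Rightarrow> real" where
  "translate_comb f ts s = (\<Sum>(u, t)\<leftarrow>ts. u * f (t - s))"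

lemma translate_comb_simps [simp]:
  "translate_comb f [] s = 0"
  "translate_comb f (x # ts) s = fst x * f (snd x - s) + translate_comb f ts s"
  "translate_comb f (ts @ ts') s = translate_comb f ts s + translate_comb f ts' s"
  "translate_comb f (map (\<lambda>(u, t). (c * u, t)) ts) s = c * translate_comb f ts s"
  by (induction ts) (auto simp: translate_comb_def split_beta algebra_simps)

locale exponent_pair = K: levy_exponent \<mu> \<kappa> + K': levy_exponent \<mu>' \<kappa>'
  for \<mu> \<kappa> \<mu>' \<kappa>' +
  fixes f :: "real \<Rightarrow> real"
  assumes integrable_f: "integrable lborel f"
    and causal: "\<And>x. x \<le> 0 \<Longrightarrow> f x = 0"
    and integral_f: "(LBINT x. f x) \<noteq> 0"
    and integrable_K: "\<And>ts. integrable lborel (\<lambda>s. \<kappa> (translate_comb f ts s))"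
    and integrable_K': "\<And>ts. integrable lborel (\<lambda>s. \<kappa>' (translate_comb f ts s))"
    and exp_eq: "\<And>ts. exp (CLBINT s. \<kappa> (translate_comb f ts s)) = exp (CLBINT s. \<kappa>' (translate_comb f ts s))"
begin

definition V :: "(real \<Rightarrow> real) set" where
  "V = range (translate_comb f)"

definition D :: "real \<Rightarrow> complex" where
  "D v = \<kappa> v - \<kappa>' v"

text \<open>Unlike \<open>D\<close> itself, its second differences are bounded; \<open>W k s\<close> takes the step \<open>k s\<close>.\<close>

definition W :: "(real \<Rightarrow> real) \<Rightarrow> real \<Rightarrow> real \<Rightarrow> complex" where
  "W k s v = D v - (D (v + k s) + D (v - k s)) / 2"

definition W_bound :: "(real \<Rightarrow> real) \<Rightarrow> real \<Rightarrow> real" where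
  "W_bound k s = - Re (\<kappa> (k s)) - Re (\<kappa>' (k s))"

lemma f_measurable [measurable]: "f \<in> borel_measurable borel"
  using integrable_f by auto

lemma V_closed:
  "g \<in> V \<Longrightarrow> h \<in> V \<Longrightarrow> (\<lambda>s. g s + h s) \<in> V"
  "g \<in> V \<Longrightarrow> (\<lambda>s. c * g s) \<in> V"
  "(\<lambda>s. c * f (t - s)) \<in> V"
  "(\<lambda>s. f (t - s)) \<in> V"
  "(\<lambda>s. 0) \<in> V"
proof -
  have I: "h \<in> V" if "\<And>s. h s = translate_comb f ts s" for h ts
  proof -
    have "h = translate_comb f ts" using that by auto
    then show ?thesis by (simp add: V_def)
  qed
  show "(\<lambda>s. c * g s) \<in> V" if g: "g \<in> V" for g c
  proof -
    obtain ts where "g = translate_comb f ts" using g by (auto simp: V_def)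
    then show ?thesis by (intro I[of _ "map (\<lambda>(u, t). (c * u, t)) ts"]) simp
  qed
  show "(\<lambda>s. g s + h s) \<in> V" if gh: "g \<in> V" "h \<in> V" for g h
  proof -
    obtain ts ts' where "g = translate_comb f ts" "h = translate_comb f ts'" using gh by (auto simp: V_def)
    then show ?thesis by (intro I[of _ "ts @ ts'"]) simp
  qed
  show "(\<lambda>s. c * f (t - s)) \<in> V" for c t by (rule I[of _ "[(c, t)]"]) simp
  show "(\<lambda>s. f (t - s)) \<in> V" by (rule I[of _ "[(1, t)]"]) simp
  show "(\<lambda>s. 0) \<in> V" by (rule I[of _ "[]"]) simp
qed

lemma V_diff: "g \<in> V \<Longrightarrow> h \<in> V \<Longrightarrow> (\<lambda>s. g s - h s) \<in> V"
  using V_closed(1)[of g "\<lambda>s. - 1 * h s"] V_closed(2)[of h "- 1"] by simp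

lemma V_measurable [measurable_dest]: "g \<in> V \<Longrightarrow> g \<in> borel_measurable borel"
proof -
  assume "g \<in> V"
  then obtain ts where g: "g = translate_comb f ts" by (auto simp: V_def)
  have "translate_comb f ts \<in> borel_measurable borel"
  proof (induction ts)
    case (Cons x ts)
    have "translate_comb f (x # ts) = (\<lambda>s. fst x * f (snd x - s) + translate_comb f ts s)" by auto
    then show ?case using Cons by simp
  qed (simp add: translate_comb_def[abs_def])
  then show ?thesis by (simp add: g)
qed

lemma continuous_on_D: "continuous_on UNIV D"
  unfolding D_def by (intro continuous_intros K.continuous_on_exponent K'.continuous_on_exponent)

lemma D_measurable [measurable]: "D \<in> borel_measurable borel"
  by (intro borel_measurable_continuous_onI continuous_on_D)

lemma K_measurable [measurable]: "\<kappa> \<in> borel_measurable borel" "\<kappa>' \<in> borel_measurable borel"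
  by (intro borel_measurable_continuous_onI K.continuous_on_exponent K'.continuous_on_exponent)+

lemma D_zero: "D 0 = 0"
  by (simp add: D_def)

lemma integrable_D: "g \<in> V \<Longrightarrow> integrable lborel (\<lambda>s. D (g s))"
  using integrable_K integrable_K' by (auto simp: V_def D_def)

lemma exp_integral_D: "g \<in> V \<Longrightarrow> exp (CLBINT s. D (g s)) = 1"
  using integrable_K integrable_K' exp_eq
  by (auto simp: V_def D_def exp_diff)

lemma norm_W_le: "norm (W k s v) \<le> W_bound k s"
proof -
  have "W k s v = (\<kappa> v - (\<kappa> (v + k s) + \<kappa> (v - k s)) / 2) - (\<kappa>' v - (\<kappa>' (v + k s) + \<kappa>' (v - k s)) / 2)"
    by (simp add: W_def D_def field_simps)
  also have "norm \<dots> \<le> - Re (\<kappa> (k s)) + - Re (\<kappa>' (k s))"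
    by (intro order_trans[OF norm_triangle_ineq4] add_mono K.norm_second_difference_le K'.norm_second_difference_le)
  finally show ?thesis by (simp add: W_bound_def)
qed

lemma W_bound_nonneg: "0 \<le> W_bound k s"
  using norm_W_le[of k s 0] norm_ge_zero order_trans by blast

lemma integrable_W_bound: "k \<in> V \<Longrightarrow> integrable lborel (W_bound k)"
  unfolding W_bound_def[abs_def] using integrable_K integrable_K'
  by (auto simp: V_def intro!: Bochner_Integration.integrable_diff integrable_minus integrable_Re)

lemma continuous_on_W: "continuous_on UNIV (W k s)"
  unfolding W_def
  by (intro continuous_intros continuous_on_compose2[OF continuous_on_D]) auto

lemma W_measurable [measurable]:
  assumes [measurable]: "k \<in> borel_measurable borel" "g \<in> borel_measurable N" "h \<in> borel_measurable N"
  shows "(\<lambda>x. W k (h x) (g x)) \<in> borel_measurable N"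
  unfolding W_def by measurable

text \<open>Once \<open>annihilates k a\<close> is known for \<open>a = 1\<close>, the class of such weights \<open>a\<close> is enlarged until it contains
  the indicators of all half-lines.\<close>

definition annihilates :: "(real \<Rightarrow> real) \<Rightarrow> (real \<Rightarrow> real) \<Rightarrow> bool" where
  "annihilates k a \<longleftrightarrow> (\<forall>h\<in>V. (CLBINT s. a s *\<^sub>R (W k s (h s) - W k s 0)) = 0)"

lemma integrable_W_diff:
  assumes k: "k \<in> V" and [measurable]: "a \<in> borel_measurable borel" "g \<in> borel_measurable borel" "h \<in> borel_measurable borel"
    and a: "\<And>s. 0 \<le> a s \<and> a s \<le> 1"
  shows "integrable lborel (\<lambda>s. a s *\<^sub>R (W k s (g s) - W k s (h s)))"
proof (rule Bochner_Integration.integrable_bound)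
  note [measurable] = V_measurable[OF k]
  show "integrable lborel (\<lambda>s. 2 * W_bound k s)"
    by (intro integrable_mult_right integrable_W_bound k)
  show "(\<lambda>s. a s *\<^sub>R (W k s (g s) - W k s (h s))) \<in> borel_measurable lborel"
    by measurable
  show "AE s in lborel. norm (a s *\<^sub>R (W k s (g s) - W k s (h s))) \<le> norm (2 * W_bound k s)"
  proof (intro AE_I2)
    fix s
    have "norm (a s *\<^sub>R (W k s (g s) - W k s (h s))) \<le> 1 * (W_bound k s + W_bound k s)"
      unfolding norm_scaleR
      by (intro mult_mono order_trans[OF norm_triangle_ineq4] add_mono norm_W_le) (use a in auto)
    then show "norm (a s *\<^sub>R (W k s (g s) - W k s (h s))) \<le> norm (2 * W_bound k s)"
      using W_bound_nonneg[of k s] by simp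
  qed
qed

text \<open>Along \<open>c * h\<close> the number \<open>2 * I c\<close> is an integer combination
  of integrals of \<open>D\<close> over members of \<open>V\<close>, so its exponential is 1. It
  depends continuously on \<open>c\<close>, and a continuous function with values in a discrete set
  is constant.\<close>

lemma annihilates_one:
  assumes k: "k \<in> V"
  shows "annihilates k (\<lambda>_. 1)"
  unfolding annihilates_def
proof
  fix h assume h: "h \<in> V"
  note [measurable] = V_measurable[OF k] V_measurable[OF h]
  define I where "I c = (CLBINT s. W k s (c * h s))" for c
  have intW: "integrable lborel (\<lambda>s. W k s (c * h s))" for c
  proof (rule Bochner_Integration.integrable_bound[OF integrable_W_bound[OF k]])
    show "AE s in lborel. norm (W k s (c * h s)) \<le> norm (W_bound k s)"
      using norm_W_le W_bound_nonneg by auto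
  qed measurable
  \<comment> \<open>Doubling clears the denominator in \<open>W\<close>; half of a multiple of 2
    \<pi> \<i> would give no information of this kind.\<close>
  have exp_I: "exp (2 * I c) = 1" for c
  proof -
    have V: "(\<lambda>s. c * h s) \<in> V" "(\<lambda>s. c * h s + k s) \<in> V" "(\<lambda>s. c * h s - k s) \<in> V"
      using h k V_closed(1,2) V_diff by auto
    note ints = integrable_D[OF V(1)] integrable_D[OF V(2)] integrable_D[OF V(3)]
    have "I c = (CLBINT s. D (c * h s)) - ((CLBINT s. D (c * h s + k s)) + (CLBINT s. D (c * h s - k s))) / 2"
      unfolding I_def W_def using ints by simp
    then have "2 * I c = 2 * (CLBINT s. D (c * h s)) - ((CLBINT s. D (c * h s + k s)) + (CLBINT s. D (c * h s - k s)))"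
      by (simp add: field_simps)
    also have "exp \<dots> = 1"
      unfolding exp_diff exp_add mult_2 by (simp add: exp_integral_D[OF V(1)] exp_integral_D[OF V(2)] exp_integral_D[OF V(3)])
    finally show ?thesis .
  qed
  have cont_I: "continuous_on {0..1} I"
    unfolding continuous_on_sequentially
  proof (intro allI impI ballI, elim conjE)
    fix x :: "nat \<Rightarrow> real" and a assume x: "x \<longlonglongrightarrow> a"
    show "(I \<circ> x) \<longlonglongrightarrow> I a"
      unfolding comp_def I_def
    proof (rule integral_dominated_convergence[OF _ _ integrable_W_bound[OF k]])
      show "AE s in lborel. (\<lambda>n. W k s (x n * h s)) \<longlonglongrightarrow> W k s (a * h s)"
        by (intro AE_I2 continuous_on_tendsto_compose[OF continuous_on_W] tendsto_intros x UNIV_I) simp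
      show "AE s in lborel. norm (W k s (x n * h s)) \<le> W_bound k s" for n
        by (intro AE_I2 norm_W_le)
    qed measurable
  qed
  have "norm (2 * (I 1 - I 0)) < e" if e: "e > 0" for e
  proof -
    obtain \<delta> where \<delta>: "\<delta> > 0" "\<And>q :: real \<Rightarrow> complex. continuous_on {0..1} q \<Longrightarrow> q 0 = 0 \<Longrightarrow>
      (\<And>c. c \<in> {0..1} \<Longrightarrow> norm (exp (q c) - 1) < \<delta>) \<Longrightarrow> norm (q 1) < e"
      using small_if_exp_near_one[OF e] by metis
    show ?thesis
    proof (rule \<delta>(2)[of "\<lambda>c. 2 * (I c - I 0)"])
      show "continuous_on {0..1} (\<lambda>c. 2 * (I c - I 0))"
        by (intro continuous_intros cont_I)
      show "norm (exp (2 * (I c - I 0)) - 1) < \<delta>" for c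
        using \<delta>(1) exp_I[of c] exp_I[of 0] by (simp add: right_diff_distrib exp_diff)
    qed simp
  qed
  then have "2 * (I 1 - I 0) = 0" by (metis less_irrefl zero_less_norm_iff)
  then have "I 1 = I 0" by simp
  moreover have "(CLBINT s. W k s (h s) - W k s 0) = I 1 - I 0"
    using intW[of 1] intW[of 0] by (simp add: I_def)
  ultimately show "(CLBINT s. 1 *\<^sub>R (W k s (h s) - W k s 0)) = 0" by simp
qed

text \<open>Perturbing by \<open>u * g\<close> stays inside \<open>V\<close>. In the mean over
  \<open>u\<close> in [0, N] the perturbed integrand tends to 0 wherever
  \<open>g s \<noteq> 0\<close> and is unchanged wherever \<open>g s = 0\<close>; the bound
  \<open>2 * W_bound k s\<close> permits the limit under the integral.\<close>

lemma annihilates_zero_set: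
  assumes k: "k \<in> V" and g: "g \<in> V" and [measurable]: "a \<in> borel_measurable borel"
    and a: "\<And>s. 0 \<le> a s \<and> a s \<le> 1" and ann: "annihilates k a"
  shows "annihilates k (\<lambda>s. a s * indicator {s. g s = 0} s)"
  unfolding annihilates_def
proof
  fix h assume h: "h \<in> V"
  note [measurable] = V_measurable[OF k] V_measurable[OF h] V_measurable[OF g]
  let ?X = "\<lambda>u s. W k s (h s + u * g s) - W k s (u * g s)"
  \<comment> \<open>Two instances of \<open>ann\<close> are subtracted so that the reference value
    \<open>W k s 0\<close> cancels.\<close>
  have zero: "(CLBINT s. a s *\<^sub>R ?X u s) = 0" for u
  proof -
    have V: "(\<lambda>s. h s + u * g s) \<in> V" "(\<lambda>s. u * g s) \<in> V"
      using V_closed h g by auto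
    note [measurable] = V_measurable[OF V(1)] V_measurable[OF V(2)]
    have "(CLBINT s. a s *\<^sub>R ?X u s)
      = (CLBINT s. a s *\<^sub>R (W k s (h s + u * g s) - W k s 0) - a s *\<^sub>R (W k s (u * g s) - W k s 0))"
      by (simp add: algebra_simps)
    also have "\<dots> = (CLBINT s. a s *\<^sub>R (W k s (h s + u * g s) - W k s 0)) - (CLBINT s. a s *\<^sub>R (W k s (u * g s) - W k s 0))"
      by (intro Bochner_Integration.integral_diff integrable_W_diff k a) measurable
    also have "\<dots> = 0"
      using ann V unfolding annihilates_def by auto
    finally show ?thesis .
  qed
  define J where "J N s = (CLBINT u. indicator {0..real N} u *\<^sub>R (a s *\<^sub>R ?X u s)) / of_nat N" for N s
  have norm_X: "norm (a s *\<^sub>R ?X u s) \<le> 2 * W_bound k s" for u s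
  proof -
    have "norm (a s *\<^sub>R ?X u s) \<le> 1 * (W_bound k s + W_bound k s)"
      unfolding norm_scaleR
      by (intro mult_mono order_trans[OF norm_triangle_ineq4] add_mono norm_W_le) (use a in auto)
    then show ?thesis by simp
  qed
  have int_ind: "integrable lborel (indicator {0..b} :: real \<Rightarrow> real)" for b
    by (intro integrable_real_indicator) (auto simp: emeasure_lborel_Icc_eq)
  have "(CLBINT s. J N s) = 0" for N
  proof -
    have "(CLBINT s. CLBINT u. indicator {0..real N} u *\<^sub>R (a s *\<^sub>R ?X u s))
      = (CLBINT u. CLBINT s. indicator {0..real N} u *\<^sub>R (a s *\<^sub>R ?X u s))"
    proof (rule Fubini_product_bound[where w = "indicator {0..real N}" and B = "\<lambda>s. 2 * W_bound k s"])
      show "integrable lborel (\<lambda>s. 2 * W_bound k s)"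
        by (intro integrable_mult_right integrable_W_bound k)
      show "norm (indicator {0..real N} u *\<^sub>R (a s *\<^sub>R ?X u s)) \<le> indicator {0..real N} u * (2 * W_bound k s)" for u s
        using norm_X[of s u] by (simp add: indicator_def)
    qed (use int_ind in measurable)
    also have "\<dots> = 0" by (simp add: zero del: scaleR_scaleR)
    finally show ?thesis by (simp add: J_def)
  qed
  moreover have "(\<lambda>N. CLBINT s. J N s) \<longlonglongrightarrow> (CLBINT s. (a s * indicator {s. g s = 0} s) *\<^sub>R (W k s (h s) - W k s 0))"
  proof (rule integral_dominated_convergence[where w = "\<lambda>s. 2 * W_bound k s"])
    show "J N \<in> borel_measurable lborel" for N
      unfolding J_def by measurable
    show "integrable lborel (\<lambda>s. 2 * W_bound k s)"
      by (intro integrable_mult_right integrable_W_bound k)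
    show "AE s in lborel. norm (J N s) \<le> 2 * W_bound k s" for N
    proof (intro AE_I2)
      fix s
      have int_w: "integrable lborel (\<lambda>u. 2 * W_bound k s * indicator {0..real N} u)"
        by (intro integrable_mult_right int_ind)
      have le: "norm (indicator {0..real N} u *\<^sub>R (a s *\<^sub>R ?X u s)) \<le> 2 * W_bound k s * indicator {0..real N} u" for u
        using norm_X[of s u] W_bound_nonneg[of k s] by (simp add: indicator_def)
      have int_f: "integrable lborel (\<lambda>u. indicator {0..real N} u *\<^sub>R (a s *\<^sub>R ?X u s))"
      proof (rule Bochner_Integration.integrable_bound[OF int_w])
        show "AE u in lborel. norm (indicator {0..real N} u *\<^sub>R (a s *\<^sub>R ?X u s)) \<le> norm (2 * W_bound k s * indicator {0..real N} u)"
          by (intro AE_I2 order_trans[OF le]) simp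
      qed measurable
      have "norm (CLBINT u. indicator {0..real N} u *\<^sub>R (a s *\<^sub>R ?X u s)) \<le> (LBINT u. 2 * W_bound k s * indicator {0..real N} u)"
        by (rule Bochner_Integration.integral_norm_bound_integral[OF int_f int_w le])
      also have "\<dots> = 2 * W_bound k s * real N" by simp
      finally show "norm (J N s) \<le> 2 * W_bound k s"
        using W_bound_nonneg[of k s] by (cases "N = 0") (simp_all add: J_def norm_divide pos_divide_le_eq)
    qed
    show "AE s in lborel. (\<lambda>N. J N s) \<longlonglongrightarrow> (a s * indicator {s. g s = 0} s) *\<^sub>R (W k s (h s) - W k s 0)"
    proof (intro AE_I2)
      fix s
      show "(\<lambda>N. J N s) \<longlonglongrightarrow> (a s * indicator {s. g s = 0} s) *\<^sub>R (W k s (h s) - W k s 0)"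
      proof (cases "g s = 0")
        case True
        have "J N s = a s *\<^sub>R (W k s (h s) - W k s 0)" if "N > 0" for N
        proof -
          have "(CLBINT u. indicator {0..real N} u *\<^sub>R (a s *\<^sub>R ?X u s)) = real N *\<^sub>R (a s *\<^sub>R (W k s (h s) - W k s 0))"
          proof -
            have "(CLBINT u. indicator {0..real N} u *\<^sub>R (a s *\<^sub>R ?X u s))
              = (CLBINT u. indicator {0..real N} u *\<^sub>R (a s *\<^sub>R (W k s (h s) - W k s 0)))"
              by (simp add: True)
            also have "\<dots> = (LBINT u. indicator {0..real N} u) *\<^sub>R (a s *\<^sub>R (W k s (h s) - W k s 0))"
              by (intro integral_scaleR_left int_ind)
            finally show ?thesis by simp
          qed
          then show ?thesis using that by (simp add: J_def scaleR_conv_of_real)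
        qed
        note J = this
        have "\<forall>\<^sub>F N in sequentially. J N s = (a s * indicator {s. g s = 0} s) *\<^sub>R (W k s (h s) - W k s 0)"
          using eventually_gt_at_top[of 0] by eventually_elim (simp add: True J)
        then show ?thesis by (rule tendsto_eventually)
      next
        case False
        have [measurable]: "W k s \<in> borel_measurable borel"
          by (intro borel_measurable_continuous_onI continuous_on_W)
        have "(\<lambda>N. (CLBINT u. indicator {0..real N} u *\<^sub>R ?X u s) / of_nat N) \<longlonglongrightarrow> 0"
          by (rule mean_difference_tendsto_zero[OF _ norm_W_le False]) simp
        then have "(\<lambda>N. a s *\<^sub>R ((CLBINT u. indicator {0..real N} u *\<^sub>R ?X u s) / of_nat N)) \<longlonglongrightarrow> a s *\<^sub>R 0"
          by (intro tendsto_intros)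
        moreover have "J N s = a s *\<^sub>R ((CLBINT u. indicator {0..real N} u *\<^sub>R ?X u s) / of_nat N)" for N
          unfolding J_def by (subst scaleR_left_commute, subst integral_scaleR_right) (simp add: scaleR_conv_of_real)
        ultimately show ?thesis using False by simp
      qed
    qed
  qed measurable
  ultimately show "(CLBINT s. (a s * indicator {s. g s = 0} s) *\<^sub>R (W k s (h s) - W k s 0)) = 0"
    by (simp add: LIMSEQ_const_iff)
qed

end

section \<open>Localisation to half-lines and equality of the exponents\<close>

context exponent_pair begin

text \<open>Strict positivity on the half-line makes a vanishing weighted integral of an indicator
  equivalent to a Lebesgue null set there, and total mass at most 1 keeps \<open>visible\<close>
  between 0 and 1.\<close>

definition weight :: "real \<Rightarrow> real \<Rightarrow> real" where
  "weight \<tau> t = indicator {..\<tau>} t * std_normal_density t"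

text \<open>The chance that \<open>s\<close> is seen by \<open>f (t - \<cdot>)\<close> for a random \<open>t \<le> \<tau>\<close>: it vanishes iff \<open>f (t - s) = 0\<close> for
  almost all \<open>t \<le> \<tau>\<close>, that is, iff \<open>s\<close> lies in a half-line.\<close>

definition visible :: "real \<Rightarrow> real \<Rightarrow> real" where
  "visible \<tau> s = (LBINT t. weight \<tau> t * indicator {t. f (t - s) \<noteq> 0} t)"

lemma weight_measurable [measurable]: "weight \<tau> \<in> borel_measurable borel"
  unfolding weight_def by measurable

lemma weight_nonneg: "0 \<le> weight \<tau> t"
  by (simp add: weight_def)

lemma weight_pos: "t \<le> \<tau> \<Longrightarrow> 0 < weight \<tau> t"
  by (simp add: weight_def normal_density_pos)

lemma integrable_weight: "integrable lborel (weight \<tau>)"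
  unfolding weight_def using integrable_mult_indicator[of "{..\<tau>}" lborel std_normal_density] by simp

lemma integral_weight_le: "(LBINT t. weight \<tau> t) \<le> 1"
proof -
  have "(LBINT t. weight \<tau> t) \<le> (LBINT t. std_normal_density t)"
    by (intro integral_mono integrable_weight) (auto simp: weight_def indicator_def)
  then show ?thesis by simp
qed

lemma integrable_weight_indicator:
  assumes "A \<in> sets borel"
  shows "integrable lborel (\<lambda>t. weight \<tau> t * indicator A t)"
  using integrable_mult_indicator[of A lborel "weight \<tau>"] integrable_weight assms by (simp add: mult.commute)

lemma visible_measurable [measurable]: "visible \<tau> \<in> borel_measurable borel"
  unfolding visible_def[abs_def] by measurable

lemma visible_bounds: "0 \<le> visible \<tau> s" "visible \<tau> s \<le> 1"
proof -
  show "0 \<le> visible \<tau> s"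
    unfolding visible_def by (intro integral_nonneg_AE AE_I2) (simp add: weight_nonneg)
  have "visible \<tau> s \<le> (LBINT t. weight \<tau> t)"
    unfolding visible_def
    by (intro integral_mono integrable_weight integrable_weight_indicator) (auto simp: indicator_def weight_nonneg)
  then show "visible \<tau> s \<le> 1" using integral_weight_le order_trans by blast
qed

text \<open>For each fixed \<open>t\<close> the weight may be multiplied by the indicator of
  \<open>f (t - s) \<noteq> 0\<close>, because the complementary zero set is covered by
  \<open>annihilates_zero_set\<close>. Uncountably many zero sets cannot be intersected one by one;
  integrating over \<open>t\<close> against \<open>weight\<close> and exchanging the integrals
  treats them together.\<close>

lemma annihilates_visible:
  assumes k: "k \<in> V" and [measurable]: "a \<in> borel_measurable borel"
    and a: "\<And>s. 0 \<le> a s \<and> a s \<le> 1" and ann: "annihilates k a"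
  shows "annihilates k (\<lambda>s. a s * (1 - visible \<tau> s))"
  unfolding annihilates_def
proof
  fix h assume h: "h \<in> V"
  note [measurable] = V_measurable[OF k] V_measurable[OF h]
  let ?X = "\<lambda>s. a s *\<^sub>R (W k s (h s) - W k s 0)"
  have int_X: "integrable lborel ?X"
    by (intro integrable_W_diff k a) measurable
  have X: "(CLBINT s. ?X s) = 0"
    using ann h by (simp add: annihilates_def)
  have zero: "(CLBINT s. indicator {t. f (t - s) \<noteq> 0} t *\<^sub>R ?X s) = 0" for t
  proof -
    have "annihilates k (\<lambda>s. a s * indicator {s. f (t - s) = 0} s)"
      by (rule annihilates_zero_set[OF k V_closed(4) _ a ann]) simp
    then have 0: "(CLBINT s. (a s * indicator {s. f (t - s) = 0} s) *\<^sub>R (W k s (h s) - W k s 0)) = 0"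
      using h by (simp add: annihilates_def)
    have "(CLBINT s. indicator {t. f (t - s) \<noteq> 0} t *\<^sub>R ?X s)
      = (CLBINT s. ?X s - (a s * indicator {s. f (t - s) = 0} s) *\<^sub>R (W k s (h s) - W k s 0))"
      by (intro Bochner_Integration.integral_cong) (auto simp: indicator_def)
    also have "\<dots> = 0 - 0"
    proof (subst Bochner_Integration.integral_diff[OF int_X])
      show "integrable lborel (\<lambda>s. (a s * indicator {s. f (t - s) = 0} s) *\<^sub>R (W k s (h s) - W k s 0))"
      proof (rule integrable_W_diff[OF k])
        show "0 \<le> a s * indicator {s. f (t - s) = 0} s \<and> a s * indicator {s. f (t - s) = 0} s \<le> 1" for s
          using a[of s] by (simp add: indicator_def)
      qed measurable
    qed (simp add: X 0)
    finally show ?thesis by simp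
  qed
  have "(CLBINT s. visible \<tau> s *\<^sub>R ?X s) = (CLBINT s. CLBINT t. weight \<tau> t *\<^sub>R (indicator {t. f (t - s) \<noteq> 0} t *\<^sub>R ?X s))"
  proof (intro Bochner_Integration.integral_cong refl)
    fix s
    have "(CLBINT t. weight \<tau> t *\<^sub>R (indicator {t. f (t - s) \<noteq> 0} t *\<^sub>R ?X s))
      = (CLBINT t. (weight \<tau> t * indicator {t. f (t - s) \<noteq> 0} t) *\<^sub>R ?X s)"
      by (simp only: scaleR_scaleR mult.assoc)
    also have "\<dots> = visible \<tau> s *\<^sub>R ?X s"
      unfolding visible_def by (intro integral_scaleR_left integrable_weight_indicator) measurable
    finally show "visible \<tau> s *\<^sub>R ?X s = (CLBINT t. weight \<tau> t *\<^sub>R (indicator {t. f (t - s) \<noteq> 0} t *\<^sub>R ?X s))" ..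
  qed
  also have "\<dots> = (CLBINT t. CLBINT s. weight \<tau> t *\<^sub>R (indicator {t. f (t - s) \<noteq> 0} t *\<^sub>R ?X s))"
  proof (rule Fubini_product_bound[where w = "weight \<tau>" and B = "\<lambda>s. norm (?X s)"])
    show "norm (weight \<tau> t *\<^sub>R (indicator {t. f (t - s) \<noteq> 0} t *\<^sub>R ?X s)) \<le> weight \<tau> t * norm (?X s)" for t s
      using weight_nonneg[of \<tau> t] by (simp add: indicator_def abs_mult)
    show "integrable lborel (\<lambda>s. norm (?X s))" by (intro integrable_norm int_X)
    show "integrable lborel (weight \<tau>)" by (rule integrable_weight)
  qed measurable
  also have "\<dots> = 0"
    by (simp only: integral_scaleR_right zero) simp
  finally have vis: "(CLBINT s. visible \<tau> s *\<^sub>R ?X s) = 0" .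
  have "(CLBINT s. (a s * (1 - visible \<tau> s)) *\<^sub>R (W k s (h s) - W k s 0)) = (CLBINT s. ?X s - visible \<tau> s *\<^sub>R ?X s)"
    by (intro Bochner_Integration.integral_cong refl)
      (simp add: right_diff_distrib scaleR_diff_left mult.commute[of "visible \<tau> _"])
  also have "\<dots> = (CLBINT s. ?X s) - (CLBINT s. visible \<tau> s *\<^sub>R ?X s)"
  proof (intro Bochner_Integration.integral_diff int_X)
    show "integrable lborel (\<lambda>s. visible \<tau> s *\<^sub>R ?X s)"
    proof (rule Bochner_Integration.integrable_bound[OF int_X])
      show "AE s in lborel. norm (visible \<tau> s *\<^sub>R ?X s) \<le> norm (?X s)"
      proof (intro AE_I2)
        fix s
        show "norm (visible \<tau> s *\<^sub>R ?X s) \<le> norm (?X s)"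
          using mult_right_mono[OF visible_bounds(2)[of \<tau> s] norm_ge_zero[of "?X s"]]
          by (simp only: norm_scaleR[of "visible \<tau> s"] abs_of_nonneg[OF visible_bounds(1)] mult_1)
      qed
    qed measurable
  qed
  finally show "(CLBINT s. (a s * (1 - visible \<tau> s)) *\<^sub>R (W k s (h s) - W k s 0)) = 0"
    using X vis by simp
qed

text \<open>The preceding lemma can be iterated, which yields the weights
  \<open>(1 - visible \<tau> s) ^ n\<close>. As \<open>n\<close> grows they decrease to the
  indicator of the zeros of \<open>visible \<tau>\<close>.\<close>

lemma annihilates_invisible:
  assumes k: "k \<in> V"
  shows "annihilates k (indicator {s. visible \<tau> s = 0})"
  unfolding annihilates_def
proof
  fix h assume h: "h \<in> V"
  note [measurable] = V_measurable[OF k] V_measurable[OF h]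
  have pow: "annihilates k (\<lambda>s. (1 - visible \<tau> s) ^ n)" for n
  proof (induction n)
    case 0
    show ?case using annihilates_one[OF k] by simp
  next
    case (Suc n)
    have "0 \<le> (1 - visible \<tau> s) ^ n \<and> (1 - visible \<tau> s) ^ n \<le> 1" for s
      using visible_bounds[of \<tau> s] by (simp add: power_le_one)
    from annihilates_visible[OF k _ this Suc, of \<tau>] show ?case
      by (simp add: mult.commute)
  qed
  have "(\<lambda>n. CLBINT s. (1 - visible \<tau> s) ^ n *\<^sub>R (W k s (h s) - W k s 0))
    \<longlonglongrightarrow> (CLBINT s. indicator {s. visible \<tau> s = 0} s *\<^sub>R (W k s (h s) - W k s 0))"
  proof (rule integral_dominated_convergence[where w = "\<lambda>s. norm (1 *\<^sub>R (W k s (h s) - W k s 0))"])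
    show "integrable lborel (\<lambda>s. norm (1 *\<^sub>R (W k s (h s) - W k s 0)))"
      by (intro integrable_norm integrable_W_diff k) auto
    show "AE s in lborel. norm ((1 - visible \<tau> s) ^ n *\<^sub>R (W k s (h s) - W k s 0)) \<le> norm (1 *\<^sub>R (W k s (h s) - W k s 0))" for n
      using visible_bounds by (intro AE_I2) (simp add: power_le_one mult_left_le_one_le norm_power)
    show "AE s in lborel. (\<lambda>n. (1 - visible \<tau> s) ^ n *\<^sub>R (W k s (h s) - W k s 0)) \<longlonglongrightarrow> indicator {s. visible \<tau> s = 0} s *\<^sub>R (W k s (h s) - W k s 0)"
    proof (intro AE_I2 tendsto_scaleR tendsto_const)
      fix s
      show "(\<lambda>n. (1 - visible \<tau> s) ^ n) \<longlonglongrightarrow> indicator {s. visible \<tau> s = 0} s"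
      proof (cases "visible \<tau> s = 0")
        case False
        then have "(\<lambda>n. (1 - visible \<tau> s) ^ n) \<longlonglongrightarrow> 0"
          using visible_bounds[of \<tau> s] by (intro LIMSEQ_power_zero) auto
        then show ?thesis using False by simp
      qed simp
    qed
  qed measurable
  then show "(CLBINT s. indicator {s. visible \<tau> s = 0} s *\<^sub>R (W k s (h s) - W k s 0)) = 0"
    using pow h by (simp add: annihilates_def LIMSEQ_const_iff)
qed

lemma f_not_AE_zero: "\<not> (AE x in lborel. f x = 0)"
proof
  assume "AE x in lborel. f x = 0"
  then have "(LBINT x. f x) = (LINT x::real|lborel. 0)"
    by (intro integral_cong_AE) auto
  then show False using integral_f by simp
qed

text \<open>The number \<open>x0\<close> is the essential left end of the support of
  \<open>f\<close>. It exists because causality puts 0 into \<open>S\<close>, while \<open>S\<close>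
  is bounded above since \<open>f\<close> is not almost everywhere 0.\<close>

lemma support_start:
  obtains x0 where "\<And>x. (AE r in lborel. r \<le> x \<longrightarrow> f r = 0) \<longleftrightarrow> x \<le> x0"
proof -
  define S where "S = {x. AE r in lborel. r \<le> x \<longrightarrow> f r = 0}"
  have S_iff: "x \<in> S \<longleftrightarrow> (AE r in lborel. r \<le> x \<longrightarrow> f r = 0)" for x
    by (simp add: S_def)
  have down: "x \<in> S" if "y \<in> S" "x \<le> y" for x y
    using that(1) unfolding S_iff by eventually_elim (use that(2) in auto)
  have ne: "0 \<in> S" using causal by (simp add: S_iff)
  have bdd: "bdd_above S"
  proof (rule ccontr)
    assume *: "\<not> bdd_above S"
    have "\<forall>n. AE r in lborel. r \<le> real n \<longrightarrow> f r = 0"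
    proof
      fix n
      obtain y where "y \<in> S" "\<not> y \<le> real n" using * unfolding bdd_above_def by blast
      then have "real n \<in> S" using down[of y "real n"] by simp
      then show "AE r in lborel. r \<le> real n \<longrightarrow> f r = 0" by (simp only: S_iff)
    qed
    then have "AE r in lborel. \<forall>n. r \<le> real n \<longrightarrow> f r = 0"
      by (rule AE_all_countable[THEN iffD2])
    then have "AE r in lborel. f r = 0"
    proof eventually_elim
      case (elim r)
      obtain n where "r \<le> real n" using real_arch_simple by blast
      then show ?case using elim by blast
    qed
    then show False using f_not_AE_zero by simp
  qed
  have "\<forall>n. AE r in lborel. r \<le> Sup S - 1 / real (Suc n) \<longrightarrow> f r = 0"
  proof
    fix n
    have "Sup S - 1 / real (Suc n) < Sup S" by simp
    then obtain y where "y \<in> S" "Sup S - 1 / real (Suc n) < y"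
      using less_cSup_iff[OF _ bdd] ne by blast
    then have "Sup S - 1 / real (Suc n) \<in> S" using down[of y] by simp
    then show "AE r in lborel. r \<le> Sup S - 1 / real (Suc n) \<longrightarrow> f r = 0" by (simp only: S_iff)
  qed
  then have "AE r in lborel. \<forall>n. r \<le> Sup S - 1 / real (Suc n) \<longrightarrow> f r = 0"
    by (rule AE_all_countable[THEN iffD2])
  \<comment> \<open>The half-lines approximating \<open>Sup S\<close> from below miss the point
    itself, which is a null set.\<close>
  moreover have "AE r in lborel. r \<noteq> Sup S" by (rule AE_lborel_singleton)
  ultimately have "AE r in lborel. r \<le> Sup S \<longrightarrow> f r = 0"
  proof eventually_elim
    case (elim r)
    show ?case
    proof
      assume "r \<le> Sup S"
      then have "0 < Sup S - r" using elim(2) by linarith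
      then obtain n where "inverse (real (Suc n)) < Sup S - r"
        using reals_Archimedean by blast
      then have "r \<le> Sup S - 1 / real (Suc n)" by (simp add: inverse_eq_divide)
      then show "f r = 0" using elim(1) by blast
    qed
  qed
  then have "Sup S \<in> S" by (simp only: S_iff)
  then have "(AE r in lborel. r \<le> x \<longrightarrow> f r = 0) \<longleftrightarrow> x \<le> Sup S" for x
    unfolding S_iff[symmetric] using down[of "Sup S" x] cSup_upper[OF _ bdd, of x] by blast
  then show ?thesis by (rule that)
qed

text \<open>The point \<open>s\<close> is invisible up to time \<open>\<tau>\<close> exactly when
  \<open>\<tau> - s\<close> does not exceed the start \<open>x0\<close> of the support of
  \<open>f\<close>. The choice \<open>\<tau> = x + x0\<close> therefore produces the prescribed
  half-line.\<close>

lemma annihilates_atLeast: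
  assumes "k \<in> V"
  shows "annihilates k (indicator {x..})"
proof -
  obtain x0 where x0: "\<And>x. (AE r in lborel. r \<le> x \<longrightarrow> f r = 0) \<longleftrightarrow> x \<le> x0"
    using support_start by blast
  have "visible \<tau> s = 0 \<longleftrightarrow> \<tau> - x0 \<le> s" for \<tau> s
  proof -
    have "visible \<tau> s = 0 \<longleftrightarrow> (AE t in lborel. weight \<tau> t * indicator {t. f (t - s) \<noteq> 0} t = 0)"
      unfolding visible_def
      by (rule integral_nonneg_eq_0_iff_AE) (auto intro!: integrable_weight_indicator simp: weight_nonneg)
    also have "\<dots> \<longleftrightarrow> (AE t in lborel. t \<le> \<tau> \<longrightarrow> f (t - s) = 0)"
    proof -
      have "weight \<tau> t * indicator {t. f (t - s) \<noteq> 0} t = 0 \<longleftrightarrow> (t \<le> \<tau> \<longrightarrow> f (t - s) = 0)" for t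
        using weight_pos[of t \<tau>] by (auto simp: indicator_def weight_def)
      then show ?thesis by simp
    qed
    also have "\<dots> \<longleftrightarrow> (AE r in lborel. r \<le> \<tau> - s \<longrightarrow> f r = 0)"
    proof
      assume "AE t in lborel. t \<le> \<tau> \<longrightarrow> f (t - s) = 0"
      from AE_borel_affine[of 1 _ s, OF _ _ this] show "AE r in lborel. r \<le> \<tau> - s \<longrightarrow> f r = 0"
        by (simp add: le_diff_eq add.commute)
    next
      assume "AE r in lborel. r \<le> \<tau> - s \<longrightarrow> f r = 0"
      from AE_borel_affine[of 1 _ "- s", OF _ _ this] show "AE t in lborel. t \<le> \<tau> \<longrightarrow> f (t - s) = 0"
        by simp
    qed
    also have "\<dots> \<longleftrightarrow> \<tau> - x0 \<le> s" unfolding x0 by auto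
    finally show ?thesis .
  qed
  then have "{s. visible (x + x0) s = 0} = {x..}" by auto
  then show ?thesis using annihilates_invisible[OF assms, of "x + x0"] by simp
qed

lemma W_eq_AE:
  assumes k: "k \<in> V" and h: "h \<in> V"
  shows "AE s in lborel. W k s (h s) = W k s 0"
proof -
  note [measurable] = V_measurable[OF k] V_measurable[OF h]
  let ?F = "\<lambda>s. W k s (h s) - W k s 0"
  have int: "integrable lborel (\<lambda>s. indicator A s *\<^sub>R ?F s)" if "A \<in> sets borel" for A
    using that by (intro integrable_W_diff k) auto
  have int': "integrable lborel ?F" using int[of UNIV] by simp
  have total: "(CLBINT s. ?F s) = 0"
    using annihilates_one[OF k] h by (simp add: annihilates_def)
  have half: "(CLBINT s. indicator {x..} s *\<^sub>R ?F s) = 0" for x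
    using annihilates_atLeast[OF k] h by (simp add: annihilates_def)
  have "AE s in lborel. Re (?F s) = 0"
  proof (rule AE_zero_if_integral_atLeast_zero)
    show "(LINT s:{x..}|lborel. Re (?F s)) = 0" for x
      using half[of x] integral_Re[OF int[of "{x..}"]] by (simp add: set_lebesgue_integral_def)
    show "(LBINT s. Re (?F s)) = 0"
      using total integral_Re[OF int'] by simp
  qed (rule integrable_Re[OF int'])
  moreover have "AE s in lborel. Im (?F s) = 0"
  proof (rule AE_zero_if_integral_atLeast_zero)
    show "(LINT s:{x..}|lborel. Im (?F s)) = 0" for x
      using half[of x] integral_Im[OF int[of "{x..}"]] by (simp add: set_lebesgue_integral_def)
    show "(LBINT s. Im (?F s)) = 0"
      using total integral_Im[OF int'] by simp
  qed (rule integrable_Im[OF int'])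
  ultimately show ?thesis by eventually_elim (simp add: complex_eq_iff)
qed

text \<open>Both the step and the argument are taken to be multiples of f(-s). At a point where y =
  f(-s) is nonzero the multiples \<open>u * y\<close> and \<open>c * y\<close> range over all reals,
  so the identity at this single point is already the functional equation.\<close>

lemma D_second_difference: "D (x + h) + D (x - h) = 2 * D x + D h + D (- h)"
proof -
  have "AE s in lborel. W (\<lambda>s. c * f (0 - s)) s (u * f (0 - s)) = W (\<lambda>s. c * f (0 - s)) s 0" for u c
    by (intro W_eq_AE V_closed(3))
  \<comment> \<open>Rational coefficients allow one null set for all of them; real coefficients are
    recovered below by continuity, first in \<open>c\<close> and then in \<open>u\<close>.\<close>
  then have ae: "AE s in lborel. \<forall>u\<in>\<rat>. \<forall>c\<in>\<rat>. W (\<lambda>s. c * f (0 - s)) s (u * f (0 - s)) = W (\<lambda>s. c * f (0 - s)) s 0"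
    by (simp add: AE_ball_countable countable_rat)
  have "\<exists>s. f (0 - s) \<noteq> 0 \<and> (\<forall>u\<in>\<rat>. \<forall>c\<in>\<rat>. W (\<lambda>s. c * f (0 - s)) s (u * f (0 - s)) = W (\<lambda>s. c * f (0 - s)) s 0)"
  proof (rule ccontr)
    assume none: "\<not> ?thesis"
    have "AE s in lborel. f (0 - s) = 0"
      using ae
    proof eventually_elim
      case (elim s)
      then show ?case using none by blast
    qed
    then have "AE s in lborel. f (0 + - 1 * s) = 0" by simp
    from AE_borel_affine[of "- 1" _ 0, OF _ _ this] have "AE s in lborel. f s = 0" by simp
    then show False using f_not_AE_zero by simp
  qed
  then obtain s where s: "f (0 - s) \<noteq> 0"
    "\<And>u c. u \<in> \<rat> \<Longrightarrow> c \<in> \<rat> \<Longrightarrow> W (\<lambda>s. c * f (0 - s)) s (u * f (0 - s)) = W (\<lambda>s. c * f (0 - s)) s 0"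
    by blast
  define y where "y = f (0 - s)"
  define E where "E u c = W (\<lambda>_. c * y) s (u * y) - W (\<lambda>_. c * y) s 0" for u c
  have E: "E u c = D (u * y) - (D (u * y + c * y) + D (u * y - c * y)) / 2 - (D 0 - (D (0 + c * y) + D (0 - c * y)) / 2)" for u c
    by (simp add: E_def W_def)
  have closure_UNIV: "P x" if "closed {x. P x}" "\<And>x. x \<in> \<rat> \<Longrightarrow> P x" for P and x :: real
  proof -
    have "closure \<rat> \<subseteq> {x. P x}" using that by (intro closure_minimal) auto
    then show ?thesis using Rats_closure_real by auto
  qed
  have closed: "closed {u. z u = 0}" if "continuous_on UNIV z" for z :: "real \<Rightarrow> complex"
    using continuous_closed_preimage_constant[OF that closed_UNIV, of 0] by simp
  have rat: "E u c = 0" if "u \<in> \<rat>" "c \<in> \<rat>" for u c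
    using s(2)[OF that] by (simp add: E_def W_def y_def)
  have cont1: "continuous_on UNIV (\<lambda>c. E u c)" for u
    unfolding E by (intro continuous_intros continuous_on_compose2[OF continuous_on_D]) auto
  have cont2: "continuous_on UNIV (\<lambda>u. E u c)" for c
    unfolding E by (intro continuous_intros continuous_on_compose2[OF continuous_on_D]) auto
  have 1: "E u c = 0" if "u \<in> \<rat>" for u c
    by (rule closure_UNIV[where P = "\<lambda>c. E u c = 0", OF closed[OF cont1] rat[OF that]])
  have 2: "E u c = 0" for u c
    by (rule closure_UNIV[where P = "\<lambda>u. E u c = 0", OF closed[OF cont2] 1])
  have "y \<noteq> 0" using s(1) by (simp add: y_def)
  then have "D x - (D (x + h) + D (x - h)) / 2 + (D h + D (- h)) / 2 = 0"
    using 2[of "x / y" "h / y"] by (simp add: E D_zero)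
  moreover have "D (x + h) + D (x - h)
    = 2 * D x + D h + D (- h) - 2 * (D x - (D (x + h) + D (x - h)) / 2 + (D h + D (- h)) / 2)"
    by (simp add: field_simps)
  ultimately show ?thesis by (simp only: mult_zero_right diff_zero)
qed

text \<open>Conjugation symmetry makes the quadratic coefficient of \<open>D\<close> real and the
  linear one purely imaginary. The modulus of \<open>exp_integral_D\<close> then forces a nonzero
  quadratic coefficient to annihilate the integral of f^2, and its phase excludes a linear term by
  scaling f.\<close>

lemma exponents_equal: "\<kappa> u = \<kappa>' u"
proof -
  define \<alpha> where "\<alpha> = (D 1 + D (- 1)) / 2"
  define \<beta> where "\<beta> = (D 1 - D (- 1)) / 2"
  have Dx: "D x = of_real (x\<^sup>2) * \<alpha> + of_real x * \<beta>" for x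
    unfolding \<alpha>_def \<beta>_def by (rule quadratic_functional_equation[OF continuous_on_D D_second_difference D_zero])
  have cnj: "D (- 1) = cnj (D 1)"
    by (simp add: D_def K.exponent_uminus K'.exponent_uminus)
  have \<alpha>: "\<alpha> = of_real (Re \<alpha>)" and \<beta>: "\<beta> = \<i> * of_real (Im \<beta>)"
    unfolding \<alpha>_def \<beta>_def cnj by (simp_all add: complex_eq_iff)
  have V: "(\<lambda>s. c * f (0 - s)) \<in> V" for c by (rule V_closed)
  have int_refl: "integrable lborel (\<lambda>s. f (0 - s))" "(LBINT s. f (0 - s)) = (LBINT s. f s)"
    using lborel_integrable_real_affine[OF integrable_f, of "- 1" 0] lborel_integral_real_affine[of "- 1" f 0] by simp_all
  have "Re \<alpha> = 0"
  proof (rule ccontr)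
    assume nz: "Re \<alpha> \<noteq> 0"
    have ReD: "Re (D (1 * f (0 - s))) = Re \<alpha> * (f (0 - s))\<^sup>2" for s
      unfolding Dx by (subst \<beta>) simp
    have "integrable lborel (\<lambda>s. Re (D (1 * f (0 - s))))"
      by (intro integrable_Re integrable_D V)
    then have int: "integrable lborel (\<lambda>s. (f (0 - s))\<^sup>2)"
      unfolding ReD using nz by simp
    have "norm (exp (CLBINT s. D (1 * f (0 - s)))) = 1"
      using exp_integral_D[OF V[of 1]] by simp
    then have "(LBINT s. Re (D (1 * f (0 - s)))) = 0"
      using integral_Re[OF integrable_D[OF V[of 1]]] by (simp add: norm_exp_eq_Re)
    then have "(LBINT s. (f (0 - s))\<^sup>2) = 0"
      unfolding ReD using nz by simp
    then have "AE s in lborel. (f (0 - s))\<^sup>2 = 0"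
      using integral_nonneg_eq_0_iff_AE[OF int] by simp
    then have "AE s in lborel. f (0 - s) = 0" by simp
    then have "(LBINT s. f (0 - s)) = (LINT s::real|lborel. 0)"
      by (intro integral_cong_AE) auto
    then show False using int_refl(2) integral_f by simp
  qed
  then have \<alpha>0: "\<alpha> = 0" using \<alpha> by simp
  have "Im \<beta> = 0"
  proof (rule ccontr)
    assume nz: "Im \<beta> \<noteq> 0"
    \<comment> \<open>Chosen so that the integral of \<open>D\<close> along
      \<open>c * f (0 - s)\<close> equals \<i> \<pi>, whose exponential is -1 instead of 1.\<close>
    define c where "c = pi / (Im \<beta> * (LBINT s. f s))"
    have "(CLBINT s. D (c * f (0 - s))) = (CLBINT s. of_real (c * f (0 - s)) * \<beta>)"
      by (simp add: Dx \<alpha>0)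
    also have "\<dots> = of_real (c * (LBINT s. f s)) * \<beta>"
      using int_refl by simp
    also have "\<dots> = \<i> * of_real pi"
      by (subst \<beta>) (use nz integral_f in \<open>simp add: c_def\<close>)
    finally have "exp (CLBINT s. D (c * f (0 - s))) = - 1" by simp
    then show False using exp_integral_D[OF V[of c]] by simp
  qed
  then have "\<beta> = 0" using \<beta> by simp
  then show ?thesis using Dx[of u] \<alpha>0 by (simp add: D_def)
qed

end

section \<open>Subordination\<close>

lemma levy_process2_imp_levy_process:
  assumes "levy_process2 M Z"
  shows "levy_process M Z"
  unfolding levy_process_def
proof (intro conjI allI impI)
  have ae: "AE \<omega> in M. \<forall>t. ((\<lambda>s. Z s \<omega>) \<longlongrightarrow> Z t \<omega>) (at_right t) \<and> (\<exists>l. ((\<lambda>s. Z s \<omega>) \<longlongrightarrow> l) (at_left t))"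
    using assms unfolding levy_process2_def by (elim conjE)
  then show "AE \<omega> in M. \<forall>t\<ge>0. ((\<lambda>s. Z s \<omega>) \<longlongrightarrow> Z t \<omega>) (at_right t) \<and> (0 < t \<longrightarrow> (\<exists>l. ((\<lambda>s. Z s \<omega>) \<longlongrightarrow> l) (at_left t)))"
    by eventually_elim blast
qed (use assms in \<open>simp_all add: levy_process2_def\<close>)

context prob_space begin

lemma levy_processD:
  assumes "levy_process M L"
  shows "0 \<le> t \<Longrightarrow> L t \<in> borel_measurable M"
    and "AE \<omega> in M. L 0 \<omega> = 0"
    and "0 \<le> r 0 \<Longrightarrow> strict_mono r \<Longrightarrow> indep_vars (\<lambda>_. borel) (\<lambda>i \<omega>. L (r (Suc i)) \<omega> - L (r i) \<omega>) {..<n}"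
    and "0 \<le> s \<Longrightarrow> 0 \<le> h \<Longrightarrow> distr M borel (\<lambda>\<omega>. L (s + h) \<omega> - L s \<omega>) = distr M borel (\<lambda>\<omega>. L h \<omega> - L 0 \<omega>)"
    and "AE \<omega> in M. \<forall>t\<ge>0. ((\<lambda>s. L s \<omega>) \<longlongrightarrow> L t \<omega>) (at_right t)"
proof -
  have ae: "AE \<omega> in M. \<forall>t\<ge>0. ((\<lambda>s. L s \<omega>) \<longlongrightarrow> L t \<omega>) (at_right t) \<and> (0 < t \<longrightarrow> (\<exists>l. ((\<lambda>s. L s \<omega>) \<longlongrightarrow> l) (at_left t)))"
    using assms unfolding levy_process_def by (elim conjE)
  then show "AE \<omega> in M. \<forall>t\<ge>0. ((\<lambda>s. L s \<omega>) \<longlongrightarrow> L t \<omega>) (at_right t)"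
    by eventually_elim blast
qed (use assms in \<open>simp_all add: levy_process_def\<close>)

lemma levy_process_increment_distr:
  assumes L: "levy_process M L" and "0 \<le> s" "0 \<le> h"
  shows "distr M borel (\<lambda>\<omega>. L (s + h) \<omega> - L s \<omega>) = distr M borel (L h)"
proof -
  note [measurable] = levy_processD(1)[OF L \<open>0 \<le> h\<close>] levy_processD(1)[OF L order_refl]
  have "distr M borel (\<lambda>\<omega>. L h \<omega> - L 0 \<omega>) = distr M borel (L h)"
    using levy_processD(2)[OF L] by (intro distr_cong_AE) auto
  then show ?thesis using levy_processD(4)[OF assms] by simp
qed

text \<open>Independent stationary increments make the characteristic function multiplicative in
  time, and right-continuity of the paths at 0 gives its limit 1.\<close>

lemma levy_process_exponent:
  assumes L: "levy_process M L"
  obtains \<psi> where "levy_exponent (\<lambda>t. distr M borel (L t)) \<psi>"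
proof -
  have meas [measurable]: "L t \<in> borel_measurable M" if "0 \<le> t" for t
    using levy_processD(1)[OF L that] .
  have zero: "char (distr M borel (L 0)) u = 1" for u
  proof -
    have "distr M borel (L 0) = distr M borel (\<lambda>_. 0)"
      using levy_processD(2)[OF L] by (intro distr_cong_AE) auto
    then show ?thesis by (simp add: char_distr prob_space del: distr_const)
  qed
  have mult: "char (distr M borel (L (s + t))) u = char (distr M borel (L s)) u * char (distr M borel (L t)) u"
    if st: "0 \<le> s" "0 \<le> t" for s t u
  proof (cases "s = 0 \<or> t = 0")
    case False
    \<comment> \<open>Independence of increments is stated for infinite strictly increasing
      sequences, so 0, s, s + t is continued by unit steps; the \<open>- 2\<close> makes
      \<open>r 2\<close> equal to \<open>s + t\<close>. Strictness is why \<open>s = 0\<close> and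
      \<open>t = 0\<close> are separate cases.\<close>
    define r :: "nat \<Rightarrow> real" where "r i = (if i = 0 then 0 else if i = 1 then s else s + t + real i - 2)" for i
    have r: "0 \<le> r 0" "strict_mono r"
      using False st by (auto simp: r_def strict_mono_Suc_iff)
    have r': "r 0 = 0" "r 1 = s" "r 2 = s + t" by (simp_all add: r_def)
    have [measurable]: "L 0 \<in> borel_measurable M" "L s \<in> borel_measurable M" "L (s + t) \<in> borel_measurable M"
      using st by auto
    from char_distr_sum[OF levy_processD(3)[OF L r, of 2], of u]
    have "char (distr M borel (\<lambda>\<omega>. L (s + t) \<omega> - L 0 \<omega>)) u
      = char (distr M borel (\<lambda>\<omega>. L s \<omega> - L 0 \<omega>)) u * char (distr M borel (\<lambda>\<omega>. L (s + t) \<omega> - L s \<omega>)) u"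
      using r' by (simp add: numeral_2_eq_2 lessThan_Suc mult.commute)
    then show ?thesis
      using levy_process_increment_distr[OF L order_refl, of "s + t"] levy_process_increment_distr[OF L order_refl, of s]
        levy_process_increment_distr[OF L st] st
      by simp
  qed (auto simp: zero)
  have lim: "((\<lambda>t. char (distr M borel (L t)) u) \<longlongrightarrow> 1) (at_right 0)" for u
  proof (rule tendsto_at_iff_sequentially[THEN iffD2], intro allI impI)
    fix X :: "nat \<Rightarrow> real" assume X: "\<forall>i. X i \<in> {0<..} - {0}" "X \<longlonglongrightarrow> 0"
    have X_right: "filterlim X (at_right 0) sequentially"
      using X by (intro tendsto_imp_filterlim_at_right) auto
    have "(\<lambda>n. char (distr M borel (L (X n))) u) \<longlonglongrightarrow> char (distr M borel (L 0)) u"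
    proof (rule tendsto_char_AE)
      show "AE \<omega> in M. (\<lambda>n. L (X n) \<omega>) \<longlonglongrightarrow> L 0 \<omega>"
        using levy_processD(5)[OF L]
      proof eventually_elim
        case (elim \<omega>)
        then have "((\<lambda>s. L s \<omega>) \<longlongrightarrow> L 0 \<omega>) (at_right 0)" by simp
        from filterlim_compose[OF this X_right] show ?case .
      qed
      show "L (X n) \<in> borel_measurable M" for n
        using X(1) by (intro meas) (auto intro: less_imp_le)
    qed simp
    then show "((\<lambda>t. char (distr M borel (L t)) u) \<circ> X) \<longlonglongrightarrow> 1"
      by (simp add: comp_def zero)
  qed
  have "\<exists>c. \<forall>t\<ge>0. char (distr M borel (L t)) u = exp (of_real t * c)" for u
  proof -
    obtain c where "\<And>t. 0 \<le> t \<Longrightarrow> char (distr M borel (L t)) u = exp (of_real t * c)"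
      using multiplicative_right_continuous_imp_exp[of "\<lambda>t. char (distr M borel (L t)) u", OF mult lim] by blast
    then show ?thesis by blast
  qed
  then obtain \<psi> where "\<And>t u. 0 \<le> t \<Longrightarrow> char (distr M borel (L t)) u = exp (of_real t * \<psi> u)"
    by metis
  moreover have "real_distribution (distr M borel (L t))" if "0 \<le> t" for t
    using that by (intro real_distribution_distr) auto
  ultimately have "levy_exponent (\<lambda>t. distr M borel (L t)) \<psi>"
    by (simp add: levy_exponent_def)
  then show ?thesis by (rule that)
qed

lemma subordinator_nonneg:
  assumes T: "subordinator M T" and "0 \<le> s"
  shows "AE \<omega> in M. 0 \<le> T s \<omega>"
proof -
  have "levy_process M T" "AE \<omega> in M. mono_on {0..} (\<lambda>t. T t \<omega>)"
    using T by (auto simp: subordinator_def)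
  from levy_processD(2)[OF this(1)] this(2) show ?thesis
  proof eventually_elim
    case (elim \<omega>)
    then show ?case using mono_onD[OF elim(2), of 0 s] \<open>0 \<le> s\<close> by simp
  qed
qed

text \<open>Conditioning on \<open>T s\<close> directly would require joint measurability of
  \<open>L\<close>, whereas \<open>indep\<close> concerns coordinates only. The time
  \<open>T s\<close> is therefore replaced by finitely many values to its right, the identity is
  checked value by value with independence of \<open>L (r n k)\<close> and \<open>T s\<close>, and
  right-continuity of \<open>L\<close> gives the limit.\<close>

lemma char_subordinated:
  assumes L: "levy_process M L" and exponent: "levy_exponent (\<lambda>t. distr M borel (L t)) \<psi>"
    and T: "subordinator M T" and s: "0 \<le> s"
    and indep: "indep_var (PiM {0..} (\<lambda>_. borel)) (path0 L) (PiM {0..} (\<lambda>_. borel)) (path0 T)"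
    and [measurable]: "X \<in> borel_measurable M" and X: "AE \<omega> in M. X \<omega> = L (T s \<omega>) \<omega>"
  shows "char (distr M borel X) u = (CLINT x|distr M borel (T s). exp (of_real x * \<psi> u))"
proof -
  interpret levy_exponent "\<lambda>t. distr M borel (L t)" \<psi> by fact
  have meas: "L t \<in> borel_measurable M" if "0 \<le> t" for t
    using levy_processD(1)[OF L that] .
  have levy_T: "levy_process M T" using T by (simp add: subordinator_def)
  note T_meas [measurable] = levy_processD(1)[OF levy_T s]
  have indep_LT: "indep_var borel (L r) borel (T s)" if "0 \<le> r" for r
  proof -
    have "indep_var borel ((\<lambda>x. x r) \<circ> path0 L) borel ((\<lambda>x. x s) \<circ> path0 T)"
      by (rule indep_var_compose[OF indep]) (use that s in \<open>auto intro!: measurable_component_singleton\<close>)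
    moreover have "(\<lambda>x. x r) \<circ> path0 L = L r" "(\<lambda>x. x s) \<circ> path0 T = T s"
      using that s by (auto simp: path0_def)
    ultimately show ?thesis by simp
  qed
  \<comment> \<open>The cap \<open>n * 2 ^ n\<close> leaves finitely many values and is inactive
    once \<open>n\<close> is at least \<open>x\<close>. The grid point uses \<open>k + 1\<close>, so
    it lies strictly to the right of \<open>x\<close>.\<close>
  define j where "j n x = min (nat \<lfloor>2 ^ n * x\<rfloor>) (n * 2 ^ n)" for n :: nat and x :: real
  define r where "r n k = (real k + 1) / 2 ^ n" for n k :: nat
  define \<tau> where "\<tau> n x = r n (j n x)" for n x
  have [measurable]: "j n \<in> measurable borel (count_space UNIV)" for n
    unfolding j_def by measurable
  then have [measurable]: "j n \<in> borel_measurable borel" for n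
    by (rule measurable_compose) simp
  have r_nonneg: "0 \<le> r n k" for n k by (simp add: r_def)
  have r_meas [measurable]: "L (r n k) \<in> borel_measurable M" for n k
    by (rule meas[OF r_nonneg])
  have \<tau>_lim: "filterlim (\<lambda>n. \<tau> n x) (at_right x) sequentially" if x: "0 \<le> x" for x
  proof -
    have bounds: "x < \<tau> n x \<and> \<tau> n x \<le> x + (1 / 2) ^ n" if n: "x \<le> real n" for n
    proof -
      have "2 ^ n * x \<le> 2 ^ n * real n" using n by (intro mult_left_mono) auto
      then have "\<lfloor>2 ^ n * x\<rfloor> \<le> \<lfloor>real (n * 2 ^ n)\<rfloor>" by (intro floor_mono) (simp add: mult.commute)
      then have "nat \<lfloor>2 ^ n * x\<rfloor> \<le> n * 2 ^ n" by (simp only: floor_of_nat nat_le_iff)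
      then have "j n x = nat \<lfloor>2 ^ n * x\<rfloor>" by (simp add: j_def min_absorb1)
      moreover have "0 \<le> \<lfloor>2 ^ n * x\<rfloor>" using x by simp
      ultimately have "real (j n x) = of_int \<lfloor>2 ^ n * x\<rfloor>" by simp
      then have "2 ^ n * x < real (j n x) + 1" "real (j n x) \<le> 2 ^ n * x" by linarith+
      then show ?thesis by (simp add: \<tau>_def r_def field_simps power_one_over)
    qed
    obtain N where N: "x \<le> real N" using real_arch_simple by blast
    have ev: "\<forall>\<^sub>F n in sequentially. x < \<tau> n x \<and> \<tau> n x \<le> x + (1 / 2) ^ n"
      using eventually_ge_at_top[of N] by eventually_elim (use N bounds in force)
    have "(\<lambda>n. \<tau> n x) \<longlonglongrightarrow> x"
    proof (rule tendsto_sandwich)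
      show "\<forall>\<^sub>F n in sequentially. x \<le> \<tau> n x" using ev by eventually_elim simp
      show "\<forall>\<^sub>F n in sequentially. \<tau> n x \<le> x + (1 / 2) ^ n" using ev by eventually_elim simp
      have "(\<lambda>n. x + (1 / 2) ^ n) \<longlonglongrightarrow> x + 0" by (intro tendsto_intros LIMSEQ_power_zero) simp
      then show "(\<lambda>n. x + (1 / 2) ^ n) \<longlonglongrightarrow> x" by simp
    qed simp
    then show ?thesis
      by (rule tendsto_imp_filterlim_at_right) (use ev in \<open>auto elim: eventually_mono\<close>)
  qed
  \<comment> \<open>A function of a random grid index is a finite sum over deterministic indices, to
    which independence applies term by term.\<close>
  have j_split: "z (j n x) = (\<Sum>k\<le>n * 2 ^ n. indicator {k} (j n x) * z k)" for z :: "nat \<Rightarrow> complex" and n x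
  proof -
    have "(\<Sum>k\<le>n * 2 ^ n. indicator {k} (j n x) * z k) = (\<Sum>k\<in>{j n x}. indicator {k} (j n x) * z k)"
      by (rule sum.mono_neutral_right) (auto simp: j_def)
    then show ?thesis by simp
  qed
  have eq: "(CLINT \<omega>|M. iexp (u * L (\<tau> n (T s \<omega>)) \<omega>)) = (CLINT \<omega>|M. exp (of_real (\<tau> n (T s \<omega>)) * \<psi> u))" for n
  proof -
    have int_j: "integrable M (\<lambda>\<omega>. indicator {k} (j n (T s \<omega>)) :: complex)" for k
      by (rule integrable_const_bound[of _ 1]) (auto simp: indicator_def)
    have int_L: "integrable M (\<lambda>\<omega>. iexp (u * L (r n k) \<omega>))" for k
      by (rule integrable_const_bound[of _ 1]) auto
    have "indep_var borel ((\<lambda>x. iexp (u * x)) \<circ> L (r n k)) borel ((\<lambda>x. indicator {k} (j n x) :: complex) \<circ> T s)" for k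
      by (rule indep_var_compose[OF indep_LT[OF r_nonneg]]) measurable
    then have ind: "indep_var borel (\<lambda>\<omega>. iexp (u * L (r n k) \<omega>)) borel (\<lambda>\<omega>. indicator {k} (j n (T s \<omega>)) :: complex)" for k
      by (simp only: comp_def)
    have summand: "(CLINT \<omega>|M. indicator {k} (j n (T s \<omega>)) * iexp (u * L (r n k) \<omega>))
      = (CLINT \<omega>|M. indicator {k} (j n (T s \<omega>)) * exp (of_real (r n k) * \<psi> u))" for k
    proof -
      have "(CLINT \<omega>|M. indicator {k} (j n (T s \<omega>)) * iexp (u * L (r n k) \<omega>))
        = (CLINT \<omega>|M. indicator {k} (j n (T s \<omega>))) * (CLINT \<omega>|M. iexp (u * L (r n k) \<omega>))"
        using indep_var_lebesgue_integral[OF ind int_L int_j] by (simp only: mult.commute)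
      also have "(CLINT \<omega>|M. iexp (u * L (r n k) \<omega>)) = exp (of_real (r n k) * \<psi> u)"
        using char_eq[OF r_nonneg, of n k u] by (simp add: char_distr)
      finally show ?thesis by simp
    qed
    have "(CLINT \<omega>|M. iexp (u * L (\<tau> n (T s \<omega>)) \<omega>))
      = (CLINT \<omega>|M. \<Sum>k\<le>n * 2 ^ n. indicator {k} (j n (T s \<omega>)) * iexp (u * L (r n k) \<omega>))"
      unfolding \<tau>_def
    proof (intro Bochner_Integration.integral_cong refl)
      fix \<omega>
      show "iexp (u * L (r n (j n (T s \<omega>))) \<omega>) = (\<Sum>k\<le>n * 2 ^ n. indicator {k} (j n (T s \<omega>)) * iexp (u * L (r n k) \<omega>))"
        by (rule j_split[of "\<lambda>k. iexp (u * L (r n k) \<omega>)"])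
    qed
    also have "\<dots> = (\<Sum>k\<le>n * 2 ^ n. CLINT \<omega>|M. indicator {k} (j n (T s \<omega>)) * iexp (u * L (r n k) \<omega>))"
      by (intro Bochner_Integration.integral_sum integrable_const_bound[of _ 1]) (auto simp: indicator_def norm_mult)
    also have "\<dots> = (\<Sum>k\<le>n * 2 ^ n. CLINT \<omega>|M. indicator {k} (j n (T s \<omega>)) * exp (of_real (r n k) * \<psi> u))"
      by (simp only: summand)
    also have "\<dots> = (CLINT \<omega>|M. \<Sum>k\<le>n * 2 ^ n. indicator {k} (j n (T s \<omega>)) * exp (of_real (r n k) * \<psi> u))"
      by (intro Bochner_Integration.integral_sum[symmetric] integrable_mult_left int_j)
    also have "\<dots> = (CLINT \<omega>|M. exp (of_real (\<tau> n (T s \<omega>)) * \<psi> u))"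
      unfolding \<tau>_def
    proof (intro Bochner_Integration.integral_cong refl)
      fix \<omega>
      show "(\<Sum>k\<le>n * 2 ^ n. indicator {k} (j n (T s \<omega>)) * exp (of_real (r n k) * \<psi> u)) = exp (of_real (r n (j n (T s \<omega>))) * \<psi> u)"
        by (rule j_split[of "\<lambda>k. exp (of_real (r n k) * \<psi> u)", symmetric])
    qed
    finally show ?thesis .
  qed
  have meas_L: "(\<lambda>\<omega>. iexp (u * L (\<tau> n (T s \<omega>)) \<omega>)) \<in> borel_measurable M" for n
  proof -
    have "(\<lambda>\<omega>. iexp (u * L (\<tau> n (T s \<omega>)) \<omega>))
      = (\<lambda>\<omega>. \<Sum>k\<le>n * 2 ^ n. indicator {k} (j n (T s \<omega>)) * iexp (u * L (r n k) \<omega>))"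
      unfolding \<tau>_def
    proof
      fix \<omega>
      show "iexp (u * L (r n (j n (T s \<omega>))) \<omega>) = (\<Sum>k\<le>n * 2 ^ n. indicator {k} (j n (T s \<omega>)) * iexp (u * L (r n k) \<omega>))"
        by (rule j_split[of "\<lambda>k. iexp (u * L (r n k) \<omega>)"])
    qed
    then show ?thesis by simp
  qed
  have "(\<lambda>n. CLINT \<omega>|M. iexp (u * L (\<tau> n (T s \<omega>)) \<omega>)) \<longlonglongrightarrow> (CLINT \<omega>|M. iexp (u * X \<omega>))"
  proof (rule integral_dominated_convergence[where w = "\<lambda>_. 1"])
    show "AE \<omega> in M. (\<lambda>n. iexp (u * L (\<tau> n (T s \<omega>)) \<omega>)) \<longlonglongrightarrow> iexp (u * X \<omega>)"
      using X subordinator_nonneg[OF T s] levy_processD(5)[OF L]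
    proof eventually_elim
      case (elim \<omega>)
      have "(\<lambda>n. L (\<tau> n (T s \<omega>)) \<omega>) \<longlonglongrightarrow> L (T s \<omega>) \<omega>"
        using elim(2,3) by (intro filterlim_compose[OF _ \<tau>_lim]) auto
      then show ?case unfolding elim(1) by (intro tendsto_intros)
    qed
  qed (use meas_L in auto)
  moreover have "(\<lambda>n. CLINT \<omega>|M. exp (of_real (\<tau> n (T s \<omega>)) * \<psi> u)) \<longlonglongrightarrow> (CLINT \<omega>|M. exp (of_real (T s \<omega>) * \<psi> u))"
  proof (rule integral_dominated_convergence[where w = "\<lambda>_. 1"])
    show "AE \<omega> in M. (\<lambda>n. exp (of_real (\<tau> n (T s \<omega>)) * \<psi> u)) \<longlonglongrightarrow> exp (of_real (T s \<omega>) * \<psi> u)"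
      using subordinator_nonneg[OF T s]
    proof eventually_elim
      case (elim \<omega>)
      then have "(\<lambda>n. \<tau> n (T s \<omega>)) \<longlonglongrightarrow> T s \<omega>"
        by (intro filterlim_compose[OF tendsto_ident_at \<tau>_lim])
      then show ?case by (intro tendsto_intros)
    qed
    show "AE \<omega> in M. norm (exp (of_real (\<tau> n (T s \<omega>)) * \<psi> u)) \<le> 1" for n
      using Re_exponent_nonpos[of u] r_nonneg by (auto simp: \<tau>_def mult_nonneg_nonpos)
    show "(\<lambda>\<omega>. exp (of_real (\<tau> n (T s \<omega>)) * \<psi> u)) \<in> borel_measurable M" for n
      unfolding \<tau>_def r_def by measurable
  qed auto
  ultimately have "(CLINT \<omega>|M. iexp (u * X \<omega>)) = (CLINT \<omega>|M. exp (of_real (T s \<omega>) * \<psi> u))"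
    unfolding eq by (rule LIMSEQ_unique)
  then show ?thesis
    by (simp add: char_distr integral_distr)
qed

end

section \<open>Laplace transforms on the left half-plane\<close>

definition laplace :: "real measure \<Rightarrow> complex \<Rightarrow> complex" where
  "laplace \<mu> z = (CLINT x|\<mu>. exp (of_real x * z))"

context real_distribution begin

lemma integrable_exp_nonneg:
  assumes "AE x in M. 0 \<le> x" "Re z \<le> 0"
  shows "integrable M (\<lambda>x. exp (of_real x * z))"
proof (rule integrable_const_bound[of _ 1])
  show "AE x in M. norm (exp (of_real x * z)) \<le> 1"
    using assms(1) by eventually_elim (use assms(2) in \<open>auto simp: mult_nonneg_nonpos\<close>)
qed simp

text \<open>Differentiation under the integral. Staying at distance \<open>d\<close> from the
  imaginary axis bounds the derivative of the integrand by x exp(- d x), hence by 1 / d, without any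
  moment of the measure.\<close>

lemma laplace_holomorphic:
  assumes nonneg: "AE x in M. 0 \<le> x" and d: "d > 0"
  shows "laplace M holomorphic_on {z. Re z < - d}"
  unfolding holomorphic_on_def field_differentiable_def
proof
  let ?S = "{z. Re z < - d}"
  fix z assume z: "z \<in> ?S"
  have "(laplace M has_field_derivative (CLINT x|M. of_real x * exp (of_real x * z))) (at z within ?S)"
    unfolding has_field_derivative_iff
  proof (rule tendsto_at_iff_sequentially[THEN iffD2], intro allI impI)
    fix X assume X: "\<forall>i. X i \<in> ?S - {z}" "X \<longlonglongrightarrow> z"
    have "(laplace M (X n) - laplace M z) / (X n - z)
      = (CLINT x|M. (exp (of_real x * X n) - exp (of_real x * z)) / (X n - z))" for n
    proof -
      have "X n \<in> ?S" using X(1) by blast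
      then have "integrable M (\<lambda>x. exp (of_real x * X n))" "integrable M (\<lambda>x. exp (of_real x * z))"
        using z d by (auto intro!: integrable_exp_nonneg[OF nonneg])
      then show ?thesis by (simp add: laplace_def)
    qed
    moreover have "(\<lambda>n. CLINT x|M. (exp (of_real x * X n) - exp (of_real x * z)) / (X n - z))
      \<longlonglongrightarrow> (CLINT x|M. of_real x * exp (of_real x * z))"
    proof (rule integral_dominated_convergence[where w = "\<lambda>_. 1 / d"])
      show "AE x in M. (\<lambda>n. (exp (of_real x * X n) - exp (of_real x * z)) / (X n - z)) \<longlonglongrightarrow> of_real x * exp (of_real x * z)"
      proof (intro AE_I2)
        fix x :: real
        have "((\<lambda>w. exp (of_real x * w)) has_field_derivative of_real x * exp (of_real x * z)) (at z within ?S)"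
          by (auto intro!: derivative_eq_intros)
        then have "((\<lambda>w. (exp (of_real x * w) - exp (of_real x * z)) / (w - z)) \<longlongrightarrow> of_real x * exp (of_real x * z)) (at z within ?S)"
          by (simp add: has_field_derivative_iff)
        then show "(\<lambda>n. (exp (of_real x * X n) - exp (of_real x * z)) / (X n - z)) \<longlonglongrightarrow> of_real x * exp (of_real x * z)"
          using X unfolding tendsto_at_iff_sequentially by (auto simp: comp_def)
      qed
      show "AE x in M. norm ((exp (of_real x * X n) - exp (of_real x * z)) / (X n - z)) \<le> 1 / d" for n
        using nonneg
      proof eventually_elim
        case (elim x)
        have "norm (exp (of_real x * X n) - exp (of_real x * z)) \<le> 1 / d * norm (X n - z)"
        proof (rule field_differentiable_bound[where S = ?S])
          show "convex ?S" by (rule convex_halfspace_Re_lt)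
          show "((\<lambda>w. exp (of_real x * w)) has_field_derivative of_real x * exp (of_real x * w)) (at w within ?S)" for w
            by (auto intro!: derivative_eq_intros)
          fix w assume w: "w \<in> ?S"
          have "x * Re w \<le> - (d * x)"
            using mult_left_mono[of "Re w" "- d" x] elim w by (simp add: mult.commute)
          then have "norm (of_real x * exp (of_real x * w)) \<le> x * exp (- (d * x))"
            using elim by (simp add: norm_mult mult_left_mono)
          also have "\<dots> \<le> 1 / d"
          proof -
            \<comment> \<open>The source of the constant: y exp(- y) \<le> 1 with y = d x.\<close>
            have "d * x \<le> exp (d * x)" using exp_ge_add_one_self[of "d * x"] by linarith
            then have "d * x * exp (- (d * x)) \<le> exp (d * x) * exp (- (d * x))"
              by (intro mult_right_mono) auto
            also have "\<dots> = 1" by (simp flip: exp_add)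
            finally show ?thesis using d by (simp add: field_simps)
          qed
          finally show "norm (of_real x * exp (of_real x * w)) \<le> 1 / d" .
        qed (use z X(1) in auto)
        moreover have "X n \<noteq> z" using X(1) by blast
        ultimately show ?case by (simp add: norm_divide pos_divide_le_eq)
      qed
    qed auto
    ultimately show "((\<lambda>y. (laplace M y - laplace M z) / (y - z)) \<circ> X) \<longlonglongrightarrow> (CLINT x|M. of_real x * exp (of_real x * z))"
      unfolding comp_def by (simp only:)
  qed
  then show "\<exists>f'. (laplace M has_field_derivative f') (at z within ?S)" by blast
qed

text \<open>The imaginary axis is approached from inside the open half-plane; \<open>Suc n\<close>
  keeps every argument strictly inside, where analytic continuation applies.\<close>

lemma laplace_boundary:
  assumes nonneg: "AE x in M. 0 \<le> x"
  shows "(\<lambda>n. laplace M (\<i> * of_real t - of_real (1 / real (Suc n)))) \<longlonglongrightarrow> char M t"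
  unfolding laplace_def char_def
proof (rule integral_dominated_convergence[where w = "\<lambda>_. 1"])
  show "AE x in M. (\<lambda>n. exp (of_real x * (\<i> * of_real t - of_real (1 / real (Suc n))))) \<longlonglongrightarrow> iexp (t * x)"
  proof (intro AE_I2)
    fix x
    have "(\<lambda>n. 1 / real (Suc n)) \<longlonglongrightarrow> 0"
      using LIMSEQ_inverse_real_of_nat by (simp add: inverse_eq_divide)
    then have "(\<lambda>n. exp (of_real x * (\<i> * of_real t - of_real (1 / real (Suc n))))) \<longlonglongrightarrow> exp (of_real x * (\<i> * of_real t - of_real 0))"
      by (intro tendsto_intros)
    then show "(\<lambda>n. exp (of_real x * (\<i> * of_real t - of_real (1 / real (Suc n))))) \<longlonglongrightarrow> iexp (t * x)"
      by (simp add: mult_ac)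
  qed
  show "AE x in M. norm (exp (of_real x * (\<i> * of_real t - of_real (1 / real (Suc n))))) \<le> 1" for n
    using nonneg by eventually_elim simp
qed auto

end

text \<open>Laws are compared through their characteristic functions, the Laplace transforms on the
  imaginary axis. The range of \<open>\<kappa>\<close> either covers that axis or determines the
  transforms on the open half-plane, whose boundary values are then compared.\<close>

lemma (in levy_exponent) distribution_eq_if_laplace_eq:
  assumes P: "real_distribution P" "AE x in P. 0 \<le> x" and Q: "real_distribution Q" "AE x in Q. 0 \<le> x"
    and eq: "\<And>u. laplace P (\<kappa> u) = laplace Q (\<kappa> u)" and nontrivial: "\<kappa> u1 \<noteq> 0"
  shows "P = Q"
proof (rule Levy_uniqueness[OF P(1) Q(1)], rule ext)
  fix t
  interpret P: real_distribution P by fact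
  interpret Q: real_distribution Q by fact
  show "char P t = char Q t"
  proof (cases "\<forall>u. Re (\<kappa> u) = 0")
    case True
    \<comment> \<open>When \<open>Re \<kappa>\<close> vanishes, the second differences of
      \<open>\<kappa>\<close> vanish too, so \<open>\<kappa>\<close> is linear: the case of a
      deterministic drift \<open>b\<close>.\<close>
    have odd: "\<kappa> (- h) = - \<kappa> h" for h
      using True by (simp add: exponent_uminus complex_eq_iff)
    have quad: "\<kappa> x = of_real (x\<^sup>2) * ((\<kappa> 1 + \<kappa> (- 1)) / 2) + of_real x * ((\<kappa> 1 - \<kappa> (- 1)) / 2)" for x
    proof (rule quadratic_functional_equation[OF continuous_on_exponent _ exponent_zero])
      fix x h
      have zero: "\<kappa> x - (\<kappa> (x + h) + \<kappa> (x - h)) / 2 = 0"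
        using norm_second_difference_le[of x h] True by simp
      show "\<kappa> (x + h) + \<kappa> (x - h) = 2 * \<kappa> x + \<kappa> h + \<kappa> (- h)"
      proof -
        have "\<kappa> (x + h) + \<kappa> (x - h) = 2 * (\<kappa> x - (\<kappa> x - (\<kappa> (x + h) + \<kappa> (x - h)) / 2))"
          by (simp add: field_simps)
        also have "\<dots> = 2 * \<kappa> x" unfolding zero by simp
        finally show ?thesis by (simp only: odd) simp
      qed
    qed
    have lin: "\<kappa> x = of_real x * \<kappa> 1" for x
      by (rule trans[OF quad]) (simp add: odd)
    have b: "\<kappa> 1 = \<i> * of_real (Im (\<kappa> 1))" using True by (simp add: complex_eq_iff)
    define b where "b = Im (\<kappa> 1)"
    have lin_b: "\<kappa> x = \<i> * of_real (x * b)" for x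
      unfolding lin[of x] by (subst b) (simp add: b_def)
    have "b \<noteq> 0" using nontrivial lin_b[of u1] by auto
    then have "\<kappa> (t / b) = \<i> * of_real t" using lin_b[of "t / b"] by simp
    then have "char R t = laplace R (\<kappa> (t / b))" for R
      by (simp add: char_def laplace_def mult_ac)
    then show ?thesis using eq by simp
  next
    case False
    then obtain u0 where u0: "Re (\<kappa> u0) < 0" using Re_exponent_nonpos by (metis order.not_eq_order_implies_strict)
    define K where "K = \<kappa> ` {min 0 u0..max 0 u0}"
    \<comment> \<open>The part of the curve \<open>K\<close> at a positive distance from the
      imaginary axis. The curve joins 0 to \<open>\<kappa> u0\<close>, so its real parts fill an
      interval; thus \<open>U\<close> is infinite, and being compact it has an accumulation point in
      itself.\<close>
    define U where "U = K \<inter> {z. Re z \<le> Re (\<kappa> u0) / 2}"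
    have "compact K"
      unfolding K_def by (intro compact_continuous_image continuous_on_subset[OF continuous_on_exponent]) auto
    then have "compact U"
      unfolding U_def by (intro compact_Int_closed closed_halfspace_Re_le)
    have "connected K"
      unfolding K_def by (intro connected_continuous_image continuous_on_subset[OF continuous_on_exponent]) auto
    have "{Re (\<kappa> u0)..Re (\<kappa> u0) / 2} \<subseteq> Re ` U"
    proof
      fix y assume y: "y \<in> {Re (\<kappa> u0)..Re (\<kappa> u0) / 2}"
      have "connected (Re ` K)"
        by (intro connected_continuous_image continuous_intros \<open>connected K\<close>)
      moreover have "Re (\<kappa> u0) \<in> Re ` K" "0 \<in> Re ` K"
        unfolding K_def image_image by (rule image_eqI[of _ _ u0], simp, simp, rule image_eqI[of _ _ 0], simp, simp)
      ultimately have "y \<in> Re ` K"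
        using y u0 connectedD_interval[of "Re ` K" "Re (\<kappa> u0)" 0 y] by auto
      then show "y \<in> Re ` U" using y by (auto simp: U_def)
    qed
    moreover have "infinite {Re (\<kappa> u0)..Re (\<kappa> u0) / 2}" using u0 by (intro infinite_Icc) simp
    ultimately have "infinite U" using finite_subset by blast
    then obtain \<xi> where \<xi>: "\<xi> \<in> U" "\<xi> islimpt U"
      using Heine_Borel_imp_Bolzano_Weierstrass[OF \<open>compact U\<close>, of U] by blast
    have Re_\<xi>: "Re \<xi> < 0" using \<xi>(1) u0 by (auto simp: U_def)
    have half: "laplace P z = laplace Q z" if z: "Re z < 0" for z
    proof -
      \<comment> \<open>The factor 1 / 2 places both \<open>z\<close> and all of \<open>U\<close>
        strictly inside the half-plane on which holomorphy is used.\<close>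
      define d where "d = min (- Re z) (- Re (\<kappa> u0) / 2) / 2"
      have d: "d > 0" "Re z < - d" "Re (\<kappa> u0) / 2 < - d"
        using z u0 by (auto simp: d_def min_def)
      let ?S = "{z. Re z < - d}"
      have "laplace P z - laplace Q z = 0"
      proof (rule analytic_continuation[of "\<lambda>z. laplace P z - laplace Q z" ?S U \<xi>])
        show "(\<lambda>z. laplace P z - laplace Q z) holomorphic_on ?S"
          by (intro holomorphic_intros P.laplace_holomorphic Q.laplace_holomorphic P Q d)
        show "connected ?S" by (intro convex_connected convex_halfspace_Re_lt)
        show "open ?S" by (rule open_halfspace_Re_lt)
        show "U \<subseteq> ?S" "\<xi> \<in> ?S" using \<xi>(1) d(3) by (auto simp: U_def)
        show "laplace P w - laplace Q w = 0" if "w \<in> U" for w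
          using that eq by (auto simp: U_def K_def)
      qed (use \<xi> d in auto)
      then show ?thesis by simp
    qed
    have "(\<lambda>n. laplace P (\<i> * of_real t - of_real (1 / real (Suc n)))) \<longlonglongrightarrow> char P t"
      by (rule P.laplace_boundary[OF P(2)])
    moreover have "(\<lambda>n. laplace P (\<i> * of_real t - of_real (1 / real (Suc n)))) \<longlonglongrightarrow> char Q t"
      using Q.laplace_boundary[OF Q(2), of t] by (subst half) simp_all
    ultimately show ?thesis by (rule LIMSEQ_unique)
  qed
qed

section \<open>From marginal laws to the law of the process\<close>

context prob_space begin

text \<open>The values at finitely many times are partial sums of independent increments, and
  stationarity turns the law of each increment into a one-dimensional marginal law.\<close>

lemma levy_process_prob_eq:
  assumes T: "levy_process M T" and T': "levy_process M T'"
    and eq: "\<And>t. 0 \<le> t \<Longrightarrow> distr M borel (T t) = distr M borel (T' t)"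
    and J: "finite J" "J \<subseteq> {0..}" and A: "\<And>t. t \<in> J \<Longrightarrow> A t \<in> sets borel"
  shows "prob {\<omega> \<in> space M. \<forall>t\<in>J. T t \<omega> \<in> A t} = prob {\<omega> \<in> space M. \<forall>t\<in>J. T' t \<omega> \<in> A t}"
proof -
  define xs where "xs = sorted_list_of_set (insert 0 J)"
  \<comment> \<open>The times start at the inserted 0, where the process vanishes almost surely.
    Beyond the list they continue by unit steps, since independence of increments is stated for
    infinite strictly increasing sequences.\<close>
  define r where "r i = (if i < length xs then xs ! i else last xs + real (i + 1 - length xs))" for i
  have set_xs: "set xs = insert 0 J" and sorted: "sorted_wrt (<) xs"
    unfolding xs_def using J(1) by (intro set_sorted_list_of_set strict_sorted_list_of_set; simp)+
  then have ne: "xs \<noteq> []" by auto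
  have r: "strict_mono r"
    unfolding strict_mono_Suc_iff
  proof
    fix i
    consider "Suc i < length xs" | "Suc i = length xs" | "Suc i > length xs" by linarith
    then show "r i < r (Suc i)"
    proof cases
      case 1
      then show ?thesis using sorted_wrt_nth_less[OF sorted, of i "Suc i"] by (simp add: r_def)
    next
      case 2
      then have "last xs = xs ! i" using ne by (simp add: last_conv_nth flip: 2)
      then show ?thesis using 2 by (simp add: r_def)
    next
      case 3
      then show ?thesis by (simp add: r_def)
    qed
  qed
  have r0: "r 0 = 0"
  proof -
    have "0 \<in> set xs" by (simp add: set_xs)
    then obtain i where i: "i < length xs" "xs ! i = 0" by (auto simp: in_set_conv_nth)
    have "xs ! 0 \<in> set xs" using ne by simp
    then have "0 \<le> xs ! 0" using J(2) by (auto simp: set_xs)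
    then have "i = 0"
      using sorted_wrt_nth_less[OF sorted, of 0 i] i by (cases i) auto
    then show ?thesis using i by (simp add: r_def)
  qed
  have r_nonneg: "0 \<le> r i" for i
    using strict_mono_mono[OF r] r0 by (metis le0 monoD)
  define n where "n = length xs"
  have idx: "\<exists>k<n. r k = t" if "t \<in> J" for t
  proof -
    have "t \<in> set xs" using that by (simp add: set_xs)
    then show ?thesis by (auto simp: in_set_conv_nth n_def r_def)
  qed
  have n: "n > 0" using ne by (simp add: n_def)
  \<comment> \<open>The event expressed in the increments. The partial sum of the first
    \<open>k\<close> increments gives the value at time \<open>r k\<close>; as \<open>k < n\<close>,
    the increment from \<open>r (n - 1)\<close> to the artificial time \<open>r n\<close> never
    enters.\<close>
  define B where "B = {x \<in> space (PiM {..<n} (\<lambda>_. borel :: real measure)). \<forall>k\<in>{..<n}. r k \<in> J \<longrightarrow> (\<Sum>i<k. x i) \<in> A (r k)}"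
  have B: "B \<in> sets (PiM {..<n} (\<lambda>_. borel))"
  proof -
    have "{x \<in> space (PiM {..<n} (\<lambda>_. borel :: real measure)). r k \<in> J \<longrightarrow> (\<Sum>i<k. x i) \<in> A (r k)} \<in> sets (PiM {..<n} (\<lambda>_. borel))"
      if k: "k \<in> {..<n}" for k
    proof (cases "r k \<in> J")
      case True
      have "(\<lambda>x. \<Sum>i<k. x i) \<in> borel_measurable (PiM {..<n} (\<lambda>_. borel :: real measure))"
        using k by (intro borel_measurable_sum measurable_component_singleton) auto
      from measurable_sets[OF this A[OF True]] True show ?thesis
        by (simp add: vimage_def Int_def conj_commute)
    qed simp
    then show ?thesis unfolding B_def by (intro sets.sets_Collect_finite_All) auto
  qed
  define incr where "incr S = (\<lambda>\<omega>. \<lambda>i\<in>{..<n}. S (r (Suc i)) \<omega> - S (r i) \<omega>)" for S :: "real \<Rightarrow> 'a \<Rightarrow> real"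
  have incr_meas: "incr S \<in> measurable M (PiM {..<n} (\<lambda>_. borel))" if S: "levy_process M S" for S
    unfolding incr_def
    by (intro measurable_restrict borel_measurable_diff levy_processD(1)[OF S] r_nonneg)
  have prob_S: "prob {\<omega> \<in> space M. \<forall>t\<in>J. S t \<omega> \<in> A t} = measure (distr M (PiM {..<n} (\<lambda>_. borel)) (incr S)) B"
    if S: "levy_process M S" for S
  proof -
    note [measurable] = incr_meas[OF S] B
    have S_meas: "S t \<in> borel_measurable M" if "t \<in> J" for t
      using levy_processD(1)[OF S] J(2) that by auto
    have "{\<omega> \<in> space M. \<forall>t\<in>J. S t \<omega> \<in> A t} \<in> events"
      using J(1) S_meas A measurable_sets by (intro sets.sets_Collect_finite_All) (auto simp: vimage_def Int_def conj_commute)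
    moreover have "AE \<omega> in M. (\<forall>t\<in>J. S t \<omega> \<in> A t) \<longleftrightarrow> incr S \<omega> \<in> B"
      using levy_processD(2)[OF S]
    proof eventually_elim
      case (elim \<omega>)
      have "(\<Sum>i<k. incr S \<omega> i) = S (r k) \<omega>" if "k < n" for k
      proof -
        have "(\<Sum>i<k. incr S \<omega> i) = (\<Sum>i<k. S (r (Suc i)) \<omega> - S (r i) \<omega>)"
          using that by (intro sum.cong) (auto simp: incr_def)
        also have "\<dots> = S (r k) \<omega> - S (r 0) \<omega>" by (rule sum_lessThan_telescope)
        finally show ?thesis using elim r0 by simp
      qed
      moreover have "incr S \<omega> \<in> space (PiM {..<n} (\<lambda>_. borel :: real measure))"
        by (simp add: space_PiM incr_def)
      ultimately have "incr S \<omega> \<in> B \<longleftrightarrow> (\<forall>k\<in>{..<n}. r k \<in> J \<longrightarrow> S (r k) \<omega> \<in> A (r k))"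
        by (simp add: B_def)
      also have "\<dots> \<longleftrightarrow> (\<forall>t\<in>J. S t \<omega> \<in> A t)"
        using idx by (metis lessThan_iff)
      finally show ?case by simp
    qed
    ultimately have "prob {\<omega> \<in> space M. \<forall>t\<in>J. S t \<omega> \<in> A t} = prob (incr S -` B \<inter> space M)"
      by (intro finite_measure_eq_AE) auto
    then show ?thesis by (simp add: measure_distr)
  qed
  have law: "distr M (PiM {..<n} (\<lambda>_. borel)) (incr S) = PiM {..<n} (\<lambda>i. distr M borel (S (r (Suc i) - r i)))"
    if S: "levy_process M S" for S
  proof -
    have "indep_vars (\<lambda>_. borel) (\<lambda>i \<omega>. S (r (Suc i)) \<omega> - S (r i) \<omega>) {..<n}"
      using r0 by (intro levy_processD(3)[OF S _ r]) simp
    then have "distr M (PiM {..<n} (\<lambda>_. borel)) (incr S) = PiM {..<n} (\<lambda>i. distr M borel (\<lambda>\<omega>. S (r (Suc i)) \<omega> - S (r i) \<omega>))"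
      unfolding incr_def
      by (subst (asm) indep_vars_iff_distr_eq_PiM')
        (use n in \<open>auto intro!: borel_measurable_diff levy_processD(1)[OF S] r_nonneg\<close>)
    also have "\<dots> = PiM {..<n} (\<lambda>i. distr M borel (S (r (Suc i) - r i)))"
    proof (intro PiM_cong refl)
      fix i
      have "r i < r (Suc i)" using r by (simp add: strict_mono_Suc_iff)
      then show "distr M borel (\<lambda>\<omega>. S (r (Suc i)) \<omega> - S (r i) \<omega>) = distr M borel (S (r (Suc i) - r i))"
        using levy_process_increment_distr[OF S r_nonneg[of i], of "r (Suc i) - r i"] by simp
    qed
    finally show ?thesis .
  qed
  have "PiM {..<n} (\<lambda>i. distr M borel (T (r (Suc i) - r i))) = PiM {..<n} (\<lambda>i. distr M borel (T' (r (Suc i) - r i)))"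
  proof (intro PiM_cong refl eq)
    fix i show "0 \<le> r (Suc i) - r i" using strict_monoD[OF r, of i "Suc i"] by simp
  qed
  then show ?thesis by (simp add: prob_S[OF T] prob_S[OF T'] law[OF T] law[OF T'])
qed

lemma levy_process_law_eq:
  assumes T: "levy_process M T" and T': "levy_process M T'"
    and eq: "\<And>t. 0 \<le> t \<Longrightarrow> distr M borel (T t) = distr M borel (T' t)"
  shows "distr M (PiM {0..} (\<lambda>_. borel)) (path0 T) = distr M (PiM {0..} (\<lambda>_. borel)) (path0 T')"
proof (rule measure_eqI_PiM_infinite)
  have meas: "path0 S \<in> measurable M (PiM {0..} (\<lambda>_. borel))" if S: "levy_process M S" for S
    unfolding path0_def by (intro measurable_restrict levy_processD(1)[OF S]) simp
  show "finite_measure (distr M (PiM {0..} (\<lambda>_. borel)) (path0 T))"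
    by (intro finite_measure_distr meas T)
  fix A :: "real \<Rightarrow> real set" and J :: "real set"
  assume J: "finite J" "J \<subseteq> {0..}" and A: "\<And>i. i \<in> J \<Longrightarrow> A i \<in> sets borel"
  let ?E = "prod_emb {0..} (\<lambda>_. borel :: real measure) J (Pi\<^sub>E J A)"
  have E: "?E \<in> sets (PiM {0..} (\<lambda>_. borel))" using J A by (intro sets_PiM_I) auto
  have "emeasure (distr M (PiM {0..} (\<lambda>_. borel)) (path0 S)) ?E = prob {\<omega> \<in> space M. \<forall>t\<in>J. S t \<omega> \<in> A t}"
    if S: "levy_process M S" for S
  proof -
    have "path0 S -` ?E \<inter> space M = {\<omega> \<in> space M. \<forall>t\<in>J. S t \<omega> \<in> A t}"
      using J(2) by (auto simp: prod_emb_def path0_def PiE_iff restrict_def extensional_def subset_iff)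
    then show ?thesis using meas[OF S] E by (simp add: emeasure_distr emeasure_eq_measure)
  qed
  then show "emeasure (distr M (PiM {0..} (\<lambda>_. borel)) (path0 T)) ?E = emeasure (distr M (PiM {0..} (\<lambda>_. borel)) (path0 T')) ?E"
    using levy_process_prob_eq[OF T T' eq J A] T T' by simp
qed simp_all

end

theorem theorem5p2:
  fixes M :: "'a measure"
    and L T T' LT LT' Y Y' :: "real \<Rightarrow> 'a \<Rightarrow> real"
    and f :: "real \<Rightarrow> real"
  assumes "prob_space M"
    and "levy_process M L"
    and "distr M borel (L 1) \<noteq> return borel 0"
    and "subordinator M T" and "subordinator M T'"
    and "prob_space.indep_var M (PiM {0..} (\<lambda>_. borel)) (path0 L) (PiM {0..} (\<lambda>_. borel)) (path0 T)"
    and "prob_space.indep_var M (PiM {0..} (\<lambda>_. borel)) (path0 L) (PiM {0..} (\<lambda>_. borel)) (path0 T')"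
    and "levy_process2 M LT" and "levy_process2 M LT'"
    and "\<forall>s\<ge>0. AE \<omega> in M. LT s \<omega> = L (T s \<omega>) \<omega>"
    and "\<forall>s\<ge>0. AE \<omega> in M. LT' s \<omega> = L (T' s \<omega>) \<omega>"
    and "integrable lborel f"
    and "\<forall>x\<le>0. f x = 0"
    and "\<forall>\<theta>. fourier f \<theta> \<noteq> 0"
    and "\<forall>t. lb_integral M LT (\<lambda>s. indicator {..t} s * f (t - s)) (Y t)"
    and "\<forall>t. lb_integral M LT' (\<lambda>s. indicator {..t} s * f (t - s)) (Y' t)"
    and "distr M (PiM UNIV (\<lambda>_. borel)) (path Y) = distr M (PiM UNIV (\<lambda>_. borel)) (path Y')"
  shows "distr M (PiM {0..} (\<lambda>_. borel)) (path0 T) = distr M (PiM {0..} (\<lambda>_. borel)) (path0 T')"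
proof -
  interpret prob_space M by fact
  obtain \<psi> where \<psi>: "levy_exponent (\<lambda>t. distr M borel (L t)) \<psi>"
    using levy_process_exponent[OF assms(2)] by blast
  obtain \<kappa> where \<kappa>: "levy_exponent (\<lambda>t. distr M borel (LT t)) \<kappa>"
    using levy_process_exponent[OF levy_process2_imp_levy_process[OF assms(8)]] by blast
  obtain \<kappa>' where \<kappa>': "levy_exponent (\<lambda>t. distr M borel (LT' t)) \<kappa>'"
    using levy_process_exponent[OF levy_process2_imp_levy_process[OF assms(9)]] by blast
  interpret L: levy_exponent "\<lambda>t. distr M borel (L t)" \<psi> by fact
  interpret LT: levy_basis M LT \<kappa>
    by (intro levy_basis.intro levy_basis_axioms.intro assms(1,8) \<kappa>)
  interpret LT': levy_basis M LT' \<kappa>'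
    by (intro levy_basis.intro levy_basis_axioms.intro assms(1,9) \<kappa>')

  have kernel: "(\<lambda>s. indicator {..t} s * f (t - s)) = (\<lambda>s. f (t - s))" for t
  proof
    fix s show "indicator {..t} s * f (t - s) = f (t - s)"
      using assms(13) by (cases "s \<le> t") auto
  qed
  have Y: "lb_integral M LT (\<lambda>s. f (t - s)) (Y t)" "lb_integral M LT' (\<lambda>s. f (t - s)) (Y' t)" for t
    using assms(15,16) unfolding kernel by blast+
  then have [measurable]: "Y t \<in> borel_measurable M" "Y' t \<in> borel_measurable M" for t
    by (simp_all add: lb_integral_def)
  have "exponent_pair (\<lambda>t. distr M borel (LT t)) \<kappa> (\<lambda>t. distr M borel (LT' t)) \<kappa>' f"
  proof (intro exponent_pair.intro exponent_pair_axioms.intro \<kappa> \<kappa>' assms(12))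
    show "f x = 0" if "x \<le> 0" for x using assms(13) that by blast
    \<comment> \<open>The integral is the Fourier transform at frequency 0.\<close>
    show "(LBINT x. f x) \<noteq> 0"
      using assms(14)[rule_format, of 0] by (simp add: fourier_def cis_zero)
    fix ts
    note charY = LT.char_lb_integral[of "\<lambda>t s. f (t - s)" Y ts, OF Y(1), folded translate_comb_def]
    note charY' = LT'.char_lb_integral[of "\<lambda>t s. f (t - s)" Y' ts, OF Y(2), folded translate_comb_def]
    show "integrable lborel (\<lambda>s. \<kappa> (translate_comb f ts s))" by (rule charY(1))
    show "integrable lborel (\<lambda>s. \<kappa>' (translate_comb f ts s))" by (rule charY'(1))
    have comb: "(\<lambda>y. \<Sum>(u, t)\<leftarrow>ts. u * y t) \<in> borel_measurable (PiM UNIV (\<lambda>_. borel :: real measure))"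
      by (induction ts) (auto simp: split_beta intro!: borel_measurable_add borel_measurable_times)
    \<comment> \<open>A finite linear combination of values is a measurable functional of the whole
      path, so equality of the process laws carries over to it.\<close>
    have law: "distr M borel (\<lambda>\<omega>. \<Sum>(u, t)\<leftarrow>ts. u * X t \<omega>)
      = distr (distr M (PiM UNIV (\<lambda>_. borel)) (path X)) borel (\<lambda>y. \<Sum>(u, t)\<leftarrow>ts. u * y t)"
      if X: "\<And>t. X t \<in> borel_measurable M" for X :: "real \<Rightarrow> 'a \<Rightarrow> real"
    proof -
      have "path X \<in> measurable M (PiM UNIV (\<lambda>_. borel))"
        unfolding path_def using X by (intro measurable_PiM_single') auto
      then show ?thesis by (subst distr_distr[OF comb]) (simp_all add: comp_def path_def)
    qed
    show "exp (CLBINT s. \<kappa> (translate_comb f ts s)) = exp (CLBINT s. \<kappa>' (translate_comb f ts s))"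
      unfolding charY(2)[symmetric] charY'(2)[symmetric] using assms(17) by (simp add: law)
  qed
  then have \<kappa>_eq: "\<kappa> u = \<kappa>' u" for u
    by (rule exponent_pair.exponents_equal)

  \<comment> \<open>If the exponent vanished identically, \<open>L 1\<close> would have the
    characteristic function of the point mass at 0.\<close>
  have "\<exists>u. \<psi> u \<noteq> 0"
  proof (rule ccontr)
    assume "\<not> ?thesis"
    then have "char (distr M borel (L 1)) = char (return borel 0)"
      using L.char_eq[of 1] by (auto simp: char_def integral_return)
    moreover have "real_distribution (return borel (0 :: real))"
      by (simp add: real_distribution_def real_distribution_axioms_def prob_space_return)
    ultimately have "distr M borel (L 1) = return borel 0"
      by (intro Levy_uniqueness L.distribution) auto
    then show False using assms(3) by blast
  qed
  then obtain u1 where u1: "\<psi> u1 \<noteq> 0" by blast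

  have T: "levy_process M T" "levy_process M T'"
    using assms(4,5) by (simp_all add: subordinator_def)
  show ?thesis
  proof (rule levy_process_law_eq[OF T])
    fix t :: real assume t: "0 \<le> t"
    note [measurable] = levy_processD(1)[OF T(1) t] levy_processD(1)[OF T(2) t]
    show "distr M borel (T t) = distr M borel (T' t)"
    proof (rule L.distribution_eq_if_laplace_eq[OF _ _ _ _ _ u1])
      show "real_distribution (distr M borel (T t))" "real_distribution (distr M borel (T' t))"
        by (intro real_distribution_distr; measurable)+
      show "AE x in distr M borel (T t). 0 \<le> x" "AE x in distr M borel (T' t). 0 \<le> x"
        using subordinator_nonneg[OF assms(4) t] subordinator_nonneg[OF assms(5) t] by (simp_all add: AE_distr_iff)
      fix u
      have "laplace (distr M borel (T t)) (\<psi> u) = char (distr M borel (LT t)) u"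
        unfolding laplace_def using assms(10) t
        by (intro char_subordinated[OF assms(2) \<psi> assms(4) t assms(6), symmetric]) auto
      also have "\<dots> = char (distr M borel (LT' t)) u"
        using t by (simp add: LT.char_eq LT'.char_eq \<kappa>_eq)
      also have "\<dots> = laplace (distr M borel (T' t)) (\<psi> u)"
        unfolding laplace_def using assms(11) t
        by (intro char_subordinated[OF assms(2) \<psi> assms(5) t assms(7)]) auto
      finally show "laplace (distr M borel (T t)) (\<psi> u) = laplace (distr M borel (T' t)) (\<psi> u)" .
    qed
  qed
qed

end
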